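(* Let $u\in C_{+,\log}$. Suppose $p>q\geq 0$ are integers such that the inclusion mapping $i_{p,q}:\mathcal E_p\to\mathcal E_q$ is a Hilbert-Schmidt operator with $\|i_{p,q}\|_{HS}<e^{-1}$. Then $$\|F\|_{u,q}\le\left(1-e^2\|i_{p,q}\|_{HS}^2\right)^{-1/2}\,|\!|\!|F|\!|\!|_{u,p}\qquad\text{for all } F\in\mathcal G_{u,p}.$$ (In particular each $F\in\mathcal G_{u,p}$ has an expansion $F(\xi)=\sum_{n}\langle f_n,\xi^{\otimes n}\rangle$ with $f_n\in\mathcal E_{q,c}^{\widehat\otimes n}$, so that $\|F\|_{u,q}$ makes sense.)
   Context: Let $\mathcal E$ be a (nonzero) real nuclear space with topology given by a sequence of inner product norms $\{|\cdot|_p\}_{p=0}^\infty$; $\mathcal E_p$ is the completion of $\mathcal E$ with respect to $|\cdot|_p$. Standing assumptions: (a) there is a constant $0<\rho<1$ with $|\cdot|_0\le\rho|\cdot|_1\le\cdots\le\rho^p|\cdot|_p\le\cdots$; (b) for any $p\ge0$ there is $q\ge p$ such that the inclusion $i_{q,p}:\mathcal E_q\to\mathcal E_p$ is Hilbert-Schmidt. For $p\ge q$ one regards $\mathcal E\subset\mathcal E_p\subset\mathcal E_q\subset\mathcal E_0$ via inclusions, $i_{p,q}:\mathcal E_p\to\mathcal E_q$. The subscript $c$ denotes complexification, with norms extended to complexifications and tensor powers as Hilbert norms (same symbols). $\mathcal E_0$ is identified with its dual; $|\cdot|_{-p}$ is the dual norm of $|\cdot|_p$, so $|\xi|_{-p}=\sup\{|\langle\xi,\eta\rangle|:\eta\in\mathcal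 E_{p,c},|\eta|_p\le1\}$ for $\xi\in\mathcal E_c$, where $\langle\cdot,\cdot\rangle$ is the complex bilinear extension of the inner product of $\mathcal E_0$ (also used on tensor powers). $\widehat\otimes n$ denotes the symmetric $n$-th Hilbert tensor power. A function $F:\mathcal E_c\to\mathbb C$ is holomorphic on $\mathcal E_c$ if for all $\xi,\eta\in\mathcal E_c$ the function $z\mapsto F(z\xi+\eta)$ is entire on $\mathbb C$ (the functions considered below are such $F$). $C_{+,\log}$ denotes the set of all positive continuous functions $u:[0,\infty)\to(0,\infty)$ with $\lim_{r\to\infty}\frac{\log u(r)}{\log r}=\infty$; its Legendre transform is $\ell_u(t)=\inf_{r>0}u(r)/r^t$, $t\ge0$. For $F$ with expansion $F(\xi)=\sum_{n=0}^\infty\langle f_n,\xi^{\otimes n}\rangle$, $f_n\in\mathcal E_{p,c}^{\widehat\otimes n}$, put $\|F\|_{u,p}=\left(\sum_{n=0}^\infty\frac{1}{\ell_u(n)}|f_n|_p^2\right)^{1/2}$. For holomorphic $F$ on $\mathcal E_c$ put $|\!|\!|F|\!|\!|_{u,p}=\sup_{\xi\in\mathcal E_c}|F(\xi)|\,u(|\xi|_{-p}^2)^{-1/2}$, and $\mathcal G_{u,p}=\{F:\ |\!|\!|F|\!|\!|_{u,p}<\infty\}$. *)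

theory Defs
  imports "HOL-Analysis.Analysis"
begin

section \<open>Inner products on subspaces, completions, Hilbert--Schmidt operators\<close>

text \<open>The spaces of the chain are subspaces of one ambient real vector space, each with its own
  inner product, so they are given by a carrier and an inner product rather than by type classes.\<close>

definition inner_product_on :: "'a::real_vector set \<Rightarrow> ('a \<Rightarrow> 'a \<Rightarrow> real) \<Rightarrow> bool" where
  "inner_product_on V g \<longleftrightarrow> subspace V \<and>
     (\<forall>x\<in>V. \<forall>y\<in>V. g x y = g y x) \<and>
     (\<forall>x\<in>V. \<forall>y\<in>V. \<forall>z\<in>V. g (x + y) z = g x z + g y z) \<and>
     (\<forall>c. \<forall>x\<in>V. \<forall>y\<in>V. g (c *\<^sub>R x) y = c * g x y) \<and>
     (\<forall>x\<in>V. x \<noteq> 0 \<longrightarrow> 0 < g x x)"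

definition nrm :: "('a \<Rightarrow> 'a \<Rightarrow> real) \<Rightarrow> 'a \<Rightarrow> real" where
  "nrm g x = sqrt (g x x)"

definition dense_wrt :: "('a::real_vector \<Rightarrow> 'a \<Rightarrow> real) \<Rightarrow> 'a set \<Rightarrow> 'a set \<Rightarrow> bool" where
  "dense_wrt g D V \<longleftrightarrow> D \<subseteq> V \<and> (\<forall>x\<in>V. \<forall>\<epsilon>>0. \<exists>y\<in>D. nrm g (x - y) < \<epsilon>)"

definition complete_wrt :: "('a::real_vector \<Rightarrow> 'a \<Rightarrow> real) \<Rightarrow> 'a set \<Rightarrow> bool" where
  "complete_wrt g V \<longleftrightarrow>
     (\<forall>X::nat \<Rightarrow> 'a. (\<forall>k. X k \<in> V) \<and>
        (\<forall>\<epsilon>>0. \<exists>N. \<forall>j\<ge>N. \<forall>k\<ge>N. nrm g (X j - X k) < \<epsilon>) \<longrightarrow>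
        (\<exists>x\<in>V. (\<lambda>k. nrm g (X k - x)) \<longlonglongrightarrow> 0))"

definition is_completion :: "'a::real_vector set \<Rightarrow> 'a set \<Rightarrow> ('a \<Rightarrow> 'a \<Rightarrow> real) \<Rightarrow> bool" where
  "is_completion E V g \<longleftrightarrow>
     subspace E \<and> inner_product_on V g \<and> complete_wrt g V \<and> dense_wrt g E V"

definition orthonormal_basis :: "'a::real_vector set \<Rightarrow> ('a \<Rightarrow> 'a \<Rightarrow> real) \<Rightarrow> 'a set \<Rightarrow> bool" where
  "orthonormal_basis V g B \<longleftrightarrow> B \<subseteq> V \<and>
     (\<forall>x\<in>B. \<forall>y\<in>B. g x y = (if x = y then 1 else 0)) \<and> dense_wrt g (span B) V"

definition hilbert_schmidt ::
    "'a::real_vector set \<Rightarrow> ('a \<Rightarrow> 'a \<Rightarrow> real) \<Rightarrow> 'b::real_vector set \<Rightarrow> ('b \<Rightarrow> 'b \<Rightarrow> real) \<Rightarrow>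
     ('a \<Rightarrow> 'b) \<Rightarrow> bool" where
  "hilbert_schmidt V g W h T \<longleftrightarrow>
     (\<forall>x\<in>V. T x \<in> W) \<and>
     (\<forall>x\<in>V. \<forall>y\<in>V. T (x + y) = T x + T y) \<and> (\<forall>c. \<forall>x\<in>V. T (c *\<^sub>R x) = c *\<^sub>R T x) \<and>
     (\<exists>B. orthonormal_basis V g B \<and> (\<lambda>b. (nrm h (T b))\<^sup>2) summable_on B)"

text \<open>Neither the convergence nor the value of the sum depends on the orthonormal basis chosen.\<close>

definition hs_norm ::
    "'a::real_vector set \<Rightarrow> ('a \<Rightarrow> 'a \<Rightarrow> real) \<Rightarrow> ('b::real_vector \<Rightarrow> 'b \<Rightarrow> real) \<Rightarrow>
     ('a \<Rightarrow> 'b) \<Rightarrow> real" where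
  "hs_norm V g h T =
     (let B = (SOME B. orthonormal_basis V g B \<and> (\<lambda>b. (nrm h (T b))\<^sup>2) summable_on B)
      in sqrt (\<Sum>\<^sub>\<infinity>b\<in>B. (nrm h (T b))\<^sup>2))"


section \<open>The nuclear space\<close>

text \<open>\<open>E\<close> is the nuclear space, \<open>H p\<close> is its completion for the norm \<open>nrm (ip p)\<close>. The chain
  \<open>E \<subseteq> \<dots> \<subseteq> H 1 \<subseteq> H 0\<close> consists of honest set inclusions, and the inclusion
  \<open>H p \<rightarrow> H q\<close> (\<open>q \<le> p\<close>) is the identity map; its continuity makes it the extension of the
  identity of \<open>E\<close>.\<close>

definition nuclear_space ::
    "'a::real_vector set \<Rightarrow> (nat \<Rightarrow> 'a set) \<Rightarrow> (nat \<Rightarrow> 'a \<Rightarrow> 'a \<Rightarrow> real) \<Rightarrow> bool" where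
  "nuclear_space E H ip \<longleftrightarrow>
     E \<noteq> {0} \<and>
     (\<forall>p. is_completion E (H p) (ip p)) \<and>
     (\<forall>p. H (Suc p) \<subseteq> H p \<and>
        (\<exists>C. \<forall>x\<in>H (Suc p). nrm (ip p) x \<le> C * nrm (ip (Suc p)) x)) \<and>
     (\<exists>\<rho>. 0 < \<rho> \<and> \<rho> < 1 \<and>
        (\<forall>p. \<forall>\<xi>\<in>E. \<rho> ^ p * nrm (ip p) \<xi> \<le> \<rho> ^ Suc p * nrm (ip (Suc p)) \<xi>)) \<and>
     (\<forall>p. \<exists>q\<ge>p. hilbert_schmidt (H q) (ip q) (H p) (ip p) (\<lambda>x. x))"


section \<open>Complexification\<close>

text \<open>The pair \<open>(x, y)\<close> stands for \<open>x + \<i> y\<close>; the complexification of \<open>V\<close> is \<open>V \<times> V\<close>.\<close>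

definition cscale :: "complex \<Rightarrow> 'a::real_vector \<times> 'a \<Rightarrow> 'a \<times> 'a" where
  "cscale z v = (Re z *\<^sub>R fst v - Im z *\<^sub>R snd v, Re z *\<^sub>R snd v + Im z *\<^sub>R fst v)"

definition cconj :: "'a::real_vector \<times> 'a \<Rightarrow> 'a \<times> 'a" where
  "cconj v = (fst v, - snd v)"

text \<open>\<open>bil g\<close> is the complex bilinear and \<open>herm g\<close> the sesquilinear extension of \<open>g\<close>.\<close>

definition bil :: "('a \<Rightarrow> 'a \<Rightarrow> real) \<Rightarrow> 'a::real_vector \<times> 'a \<Rightarrow> 'a \<times> 'a \<Rightarrow> complex" where
  "bil g v w = Complex (g (fst v) (fst w) - g (snd v) (snd w))
                       (g (fst v) (snd w) + g (snd v) (fst w))"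

definition herm :: "('a \<Rightarrow> 'a \<Rightarrow> real) \<Rightarrow> 'a::real_vector \<times> 'a \<Rightarrow> 'a \<times> 'a \<Rightarrow> complex" where
  "herm g v w = bil g v (cconj w)"

definition cnrm :: "('a \<Rightarrow> 'a \<Rightarrow> real) \<Rightarrow> 'a::real_vector \<times> 'a \<Rightarrow> real" where
  "cnrm g v = sqrt (Re (herm g v v))"

definition dual_nrm ::
    "(nat \<Rightarrow> 'a::real_vector set) \<Rightarrow> (nat \<Rightarrow> 'a \<Rightarrow> 'a \<Rightarrow> real) \<Rightarrow> nat \<Rightarrow> 'a \<times> 'a \<Rightarrow> real" where
  "dual_nrm H ip p \<xi> =
     Sup {cmod (bil (ip 0) \<xi> \<eta>) | \<eta>. \<eta> \<in> H p \<times> H p \<and> cnrm (ip p) \<eta> \<le> 1}"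


section \<open>Hilbert tensor powers\<close>

text \<open>A list of pairs \<open>(c, [x\<^sub>1, \<dots>, x\<^sub>n])\<close> stands for the algebraic tensor
  \<open>\<Sum> c x\<^sub>1 \<otimes> \<dots> \<otimes> x\<^sub>n\<close> over the complexification. Different lists may stand for the same
  tensor; all quantities below depend only on the tensor.\<close>

type_synonym 'a alg_tensor = "(complex \<times> ('a \<times> 'a) list) list"

definition alg_tensors :: "'a set \<Rightarrow> nat \<Rightarrow> 'a alg_tensor set" where
  "alg_tensors V n = {t. \<forall>(c, xs)\<in>set t. length xs = n \<and> set xs \<subseteq> V \<times> V}"

definition at_diff :: "'a alg_tensor \<Rightarrow> 'a alg_tensor \<Rightarrow> 'a alg_tensor" where
  "at_diff s t = s @ map (\<lambda>(c, xs). (- c, xs)) t"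

definition at_inner ::
    "('a::real_vector \<Rightarrow> 'a \<Rightarrow> real) \<Rightarrow> 'a alg_tensor \<Rightarrow> 'a alg_tensor \<Rightarrow> complex" where
  "at_inner g s t =
     (\<Sum>(c, xs)\<leftarrow>s. \<Sum>(d, ys)\<leftarrow>t. c * cnj d * (\<Prod>i<length xs. herm g (xs ! i) (ys ! i)))"

definition at_norm :: "('a::real_vector \<Rightarrow> 'a \<Rightarrow> real) \<Rightarrow> 'a alg_tensor \<Rightarrow> real" where
  "at_norm g t = sqrt (Re (at_inner g t t))"

text \<open>The bilinear pairing of \<open>t\<close> with \<open>y\<^sub>1 \<otimes> \<dots> \<otimes> y\<^sub>n\<close>.\<close>

definition at_pair ::
    "('a::real_vector \<Rightarrow> 'a \<Rightarrow> real) \<Rightarrow> 'a alg_tensor \<Rightarrow> ('a \<times> 'a) list \<Rightarrow> complex" where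
  "at_pair g t ys = (\<Sum>(c, xs)\<leftarrow>t. c * (\<Prod>i<length xs. bil g (xs ! i) (ys ! i)))"

text \<open>The \<open>n\<close>-th Hilbert tensor power of the complexification of \<open>H q\<close> is the completion of the
  algebraic one. As \<open>H q \<subseteq> H 0\<close>, it embeds in the tensor power of the complexification of \<open>H 0\<close>,
  and an element of the latter is determined by its bilinear pairings with all
  \<open>y\<^sub>1 \<otimes> \<dots> \<otimes> y\<^sub>n\<close>, \<open>y\<^sub>i \<in> H 0 \<times> H 0\<close>. So an element \<open>f\<close> is represented by the function
  \<open>[y\<^sub>1, \<dots>, y\<^sub>n] \<mapsto> \<langle>f, y\<^sub>1 \<otimes> \<dots> \<otimes> y\<^sub>n\<rangle>\<close> (zero on other lists).
  \<open>tensor_limit H ip q n s f\<close> says that \<open>f\<close> is the element defined by the sequence \<open>s\<close> of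
  algebraic tensors, which is Cauchy for the norm with index \<open>q\<close>.\<close>

definition tensor_limit ::
    "(nat \<Rightarrow> 'a::real_vector set) \<Rightarrow> (nat \<Rightarrow> 'a \<Rightarrow> 'a \<Rightarrow> real) \<Rightarrow> nat \<Rightarrow> nat \<Rightarrow>
     (nat \<Rightarrow> 'a alg_tensor) \<Rightarrow> (('a \<times> 'a) list \<Rightarrow> complex) \<Rightarrow> bool" where
  "tensor_limit H ip q n s f \<longleftrightarrow>
     (\<forall>k. s k \<in> alg_tensors (H q) n) \<and>
     (\<forall>\<epsilon>>0. \<exists>N. \<forall>j\<ge>N. \<forall>k\<ge>N. at_norm (ip q) (at_diff (s j) (s k)) < \<epsilon>) \<and>
     (\<forall>ys. if length ys = n \<and> set ys \<subseteq> H 0 \<times> H 0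
           then (\<lambda>k. at_pair (ip 0) (s k) ys) \<longlonglongrightarrow> f ys else f ys = 0)"

definition hilbert_tensor_power ::
    "(nat \<Rightarrow> 'a::real_vector set) \<Rightarrow> (nat \<Rightarrow> 'a \<Rightarrow> 'a \<Rightarrow> real) \<Rightarrow> nat \<Rightarrow> nat \<Rightarrow>
     (('a \<times> 'a) list \<Rightarrow> complex) set" where
  "hilbert_tensor_power H ip q n = {f. \<exists>s. tensor_limit H ip q n s f}"

definition tensor_norm ::
    "(nat \<Rightarrow> 'a::real_vector set) \<Rightarrow> (nat \<Rightarrow> 'a \<Rightarrow> 'a \<Rightarrow> real) \<Rightarrow> nat \<Rightarrow> nat \<Rightarrow>
     (('a \<times> 'a) list \<Rightarrow> complex) \<Rightarrow> real" where
  "tensor_norm H ip q n f =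
     (THE r. \<exists>s. tensor_limit H ip q n s f \<and> (\<lambda>k. at_norm (ip q) (s k)) \<longlonglongrightarrow> r)"

definition sym_tensor_power ::
    "(nat \<Rightarrow> 'a::real_vector set) \<Rightarrow> (nat \<Rightarrow> 'a \<Rightarrow> 'a \<Rightarrow> real) \<Rightarrow> nat \<Rightarrow> nat \<Rightarrow>
     (('a \<times> 'a) list \<Rightarrow> complex) set" where
  "sym_tensor_power H ip q n =
     {f \<in> hilbert_tensor_power H ip q n. \<forall>xs ys. mset xs = mset ys \<longrightarrow> f xs = f ys}"

definition pair_power :: "(('a \<times> 'a) list \<Rightarrow> complex) \<Rightarrow> nat \<Rightarrow> 'a \<times> 'a \<Rightarrow> complex" where
  "pair_power f n \<xi> = f (replicate n \<xi>)"


section \<open>Growth functions and norms of holomorphic functions\<close>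

definition C_plus_log :: "(real \<Rightarrow> real) set" where
  "C_plus_log = {u. continuous_on {0..} u \<and> (\<forall>r\<ge>0. 0 < u r) \<and>
     filterlim (\<lambda>r. ln (u r) / ln r) at_top at_top}"

definition legendre :: "(real \<Rightarrow> real) \<Rightarrow> real \<Rightarrow> real" where
  "legendre u t = (INF r\<in>{0<..}. u r / r powr t)"

definition holomorphic_c :: "'a::real_vector set \<Rightarrow> ('a \<times> 'a \<Rightarrow> complex) \<Rightarrow> bool" where
  "holomorphic_c E F \<longleftrightarrow>
     (\<forall>\<xi>\<in>E \<times> E. \<forall>\<eta>\<in>E \<times> E. (\<lambda>z. F (cscale z \<xi> + \<eta>)) holomorphic_on UNIV)"

definition expansion ::
    "'a::real_vector set \<Rightarrow> (nat \<Rightarrow> 'a set) \<Rightarrow> (nat \<Rightarrow> 'a \<Rightarrow> 'a \<Rightarrow> real) \<Rightarrow> nat \<Rightarrow>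
     ('a \<times> 'a \<Rightarrow> complex) \<Rightarrow> (nat \<Rightarrow> ('a \<times> 'a) list \<Rightarrow> complex) \<Rightarrow> bool" where
  "expansion E H ip q F f \<longleftrightarrow>
     (\<forall>n. f n \<in> sym_tensor_power H ip q n) \<and>
     (\<forall>\<xi>\<in>E \<times> E. (\<lambda>n. pair_power (f n) n \<xi>) sums F \<xi>)"

text \<open>The norm with index \<open>u, q\<close> of a function with expansion coefficients \<open>f\<close>.\<close>

definition coeff_norm ::
    "(nat \<Rightarrow> 'a::real_vector set) \<Rightarrow> (nat \<Rightarrow> 'a \<Rightarrow> 'a \<Rightarrow> real) \<Rightarrow> (real \<Rightarrow> real) \<Rightarrow> nat \<Rightarrow>
     (nat \<Rightarrow> ('a \<times> 'a) list \<Rightarrow> complex) \<Rightarrow> ennreal" where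
  "coeff_norm H ip u q f =
     (let a = (\<lambda>n. 1 / legendre u (real n) * (tensor_norm H ip q n (f n))\<^sup>2)
      in if summable a then ennreal (sqrt (\<Sum>n. a n)) else \<infinity>)"

definition sup_norm ::
    "'a::real_vector set \<Rightarrow> (nat \<Rightarrow> 'a set) \<Rightarrow> (nat \<Rightarrow> 'a \<Rightarrow> 'a \<Rightarrow> real) \<Rightarrow> (real \<Rightarrow> real) \<Rightarrow> nat \<Rightarrow>
     ('a \<times> 'a \<Rightarrow> complex) \<Rightarrow> ennreal" where
  "sup_norm E H ip u p F =
     (SUP \<xi>\<in>E \<times> E. ennreal (cmod (F \<xi>) * u ((dual_nrm H ip p \<xi>)\<^sup>2) powr (- 1 / 2)))"

definition G_space ::
    "'a::real_vector set \<Rightarrow> (nat \<Rightarrow> 'a set) \<Rightarrow> (nat \<Rightarrow> 'a \<Rightarrow> 'a \<Rightarrow> real) \<Rightarrow> (real \<Rightarrow> real) \<Rightarrow> nat \<Rightarrow>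
     ('a \<times> 'a \<Rightarrow> complex) set" where
  "G_space E H ip u p = {F. holomorphic_c E F \<and> sup_norm E H ip u p F < \<infinity>}"

end

theory Submission
  imports Defs "HOL-Complex_Analysis.Complex_Analysis"
begin

text \<open>Let \<open>|\<cdot>|\<^sub>-\<^sub>p\<close> be the dual norm and \<open>S\<close> the Hilbert-Schmidt norm of the inclusion
  \<open>H p \<rightarrow> H q\<close>. The bound \<open>|F \<xi>| \<le> M u(|\<xi>|\<^sub>-\<^sub>p\<^sup>2)\<^sup>1\<^sup>/\<^sup>2\<close> says how fast \<open>F\<close> grows, and Cauchy's
  inequality on the circle \<open>|z \<xi>|\<^sub>-\<^sub>p = \<surd>r\<close>, optimised over \<open>r\<close>, bounds the \<open>n\<close>-th Taylor
  coefficient of \<open>z \<mapsto> F(z \<xi>)\<close> by \<open>M \<ell>\<^sub>u(n)\<^sup>1\<^sup>/\<^sup>2 |\<xi>|\<^sub>-\<^sub>p\<^sup>n\<close> (\<open>Taylor_coefficient_bound\<close>). This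
  coefficient is the value on the diagonal of a symmetric \<open>n\<close>-linear form on the complexification
  of \<open>E\<close>, and polarisation costs a factor \<open>n\<^sup>n / n! \<le> e\<^sup>n\<close> (\<open>polarization_bound\<close>).

  The norm of \<open>f\<^sub>n\<close> in the tensor power of \<open>H q\<close> is the square sum of the values of the form on
  an orthonormal basis of the dual of \<open>H q\<close> (\<open>coord_norm_tendsto_tensor_norm\<close>). Gram-Schmidt
  produces such a basis \<open>e\<close> inside the nuclear space itself (\<open>dual_basis_exists\<close>), where the
  bounds on the form apply. The square sum factors into the \<open>n\<close>-th power of
  \<open>\<Sum>\<^sub>j |e\<^sub>j|\<^sub>-\<^sub>p\<^sup>2\<close>, which is at most \<open>S\<^sup>2\<close> because the adjoint inclusion of the dual spaces has
  the same Hilbert-Schmidt norm (\<open>sum_dual_nrm_le_hs_norm\<close>). Hence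
  \<open>|f\<^sub>n|\<^sub>q\<^sup>2 \<le> M\<^sup>2 \<ell>\<^sub>u(n) (e\<^sup>2 S\<^sup>2)\<^sup>n\<close>, and the claim is a geometric series.

  For the existence of the expansion, the form is built from iterated directional derivatives of
  \<open>F\<close>. They are additive in the direction and commute, although \<open>F\<close> is holomorphic only along
  complex lines, because \<open>F\<close> is also bounded on bounded sets: Cauchy's estimates then make the
  difference quotients converge uniformly. The form so obtained has square summable
  values on the basis, so it is the limit of its finite truncations in the tensor power
  (\<open>tensor_of_form\<close>).\<close>

section \<open>Inner product spaces given by a carrier\<close>

locale inner_space =
  fixes V :: "'a::real_vector set" and g :: "'a \<Rightarrow> 'a \<Rightarrow> real"
  assumes inner_product_on: "inner_product_on V g"
begin

lemma subspace: "subspace V"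
  using inner_product_on by (simp add: inner_product_on_def)

lemma closed [simp]:
  "0 \<in> V" "x \<in> V \<Longrightarrow> y \<in> V \<Longrightarrow> x + y \<in> V" "x \<in> V \<Longrightarrow> y \<in> V \<Longrightarrow> x - y \<in> V"
  "x \<in> V \<Longrightarrow> c *\<^sub>R x \<in> V" "x \<in> V \<Longrightarrow> - x \<in> V"
  using subspace by (auto intro: subspace_0 subspace_add subspace_diff subspace_scale subspace_neg)

lemma sum_closed [simp]: "(\<And>i. i \<in> I \<Longrightarrow> x i \<in> V) \<Longrightarrow> (\<Sum>i\<in>I. x i) \<in> V"
  using subspace by (rule subspace_sum)

lemma commute: "x \<in> V \<Longrightarrow> y \<in> V \<Longrightarrow> g x y = g y x"
  using inner_product_on[unfolded inner_product_on_def] by meson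

lemma add_left: "x \<in> V \<Longrightarrow> y \<in> V \<Longrightarrow> z \<in> V \<Longrightarrow> g (x + y) z = g x z + g y z"
  using inner_product_on[unfolded inner_product_on_def] by meson

lemma scale_left: "x \<in> V \<Longrightarrow> y \<in> V \<Longrightarrow> g (c *\<^sub>R x) y = c * g x y"
  using inner_product_on[unfolded inner_product_on_def] by meson

lemma add_right: "x \<in> V \<Longrightarrow> y \<in> V \<Longrightarrow> z \<in> V \<Longrightarrow> g z (x + y) = g z x + g z y"
  using add_left commute by simp

lemma scale_right: "x \<in> V \<Longrightarrow> y \<in> V \<Longrightarrow> g y (c *\<^sub>R x) = c * g y x"
  using scale_left commute by simp

lemma minus_left: "x \<in> V \<Longrightarrow> z \<in> V \<Longrightarrow> g (- x) z = - g x z"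
  using scale_left[of x z "-1"] by simp

lemma minus_right: "x \<in> V \<Longrightarrow> z \<in> V \<Longrightarrow> g z (- x) = - g z x"
  using scale_right[of x z "-1"] by simp

lemma diff_left: "x \<in> V \<Longrightarrow> y \<in> V \<Longrightarrow> z \<in> V \<Longrightarrow> g (x - y) z = g x z - g y z"
  using add_left[of x "- y" z] minus_left[of y z] by simp

lemma diff_right: "x \<in> V \<Longrightarrow> y \<in> V \<Longrightarrow> z \<in> V \<Longrightarrow> g z (x - y) = g z x - g z y"
  using diff_left commute by simp

lemma zero_left [simp]: "z \<in> V \<Longrightarrow> g 0 z = 0"
  using scale_left[of z z 0] by simp

lemma zero_right [simp]: "z \<in> V \<Longrightarrow> g z 0 = 0"
  using scale_right[of z z 0] by simp

lemmas linear_simps = add_left add_right diff_left diff_right scale_left scale_right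
  minus_left minus_right

lemma sum_left: "(\<And>i. i \<in> I \<Longrightarrow> x i \<in> V) \<Longrightarrow> z \<in> V \<Longrightarrow> g (\<Sum>i\<in>I. x i) z = (\<Sum>i\<in>I. g (x i) z)"
proof (induction I rule: infinite_finite_induct)
  case (insert i I)
  then show ?case by (simp add: add_left)
qed auto

lemma sum_right: "(\<And>i. i \<in> I \<Longrightarrow> x i \<in> V) \<Longrightarrow> z \<in> V \<Longrightarrow> g z (\<Sum>i\<in>I. x i) = (\<Sum>i\<in>I. g z (x i))"
  using sum_left[of I x z] by (simp add: commute)

lemma pos: "x \<in> V \<Longrightarrow> x \<noteq> 0 \<Longrightarrow> 0 < g x x"
  using inner_product_on[unfolded inner_product_on_def] by meson

lemma nonneg [simp]: "x \<in> V \<Longrightarrow> 0 \<le> g x x"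
  using pos[of x] by (cases "x = 0") auto

lemma eq_zero_iff: "x \<in> V \<Longrightarrow> g x x = 0 \<longleftrightarrow> x = 0"
  using pos[of x] by fastforce

lemma nrm_nonneg [simp]: "x \<in> V \<Longrightarrow> 0 \<le> nrm g x"
  by (simp add: nrm_def)

lemma nrm_power2: "x \<in> V \<Longrightarrow> (nrm g x)\<^sup>2 = g x x"
  by (simp add: nrm_def)

lemma nrm_minus: "x \<in> V \<Longrightarrow> nrm g (- x) = nrm g x"
  by (simp add: nrm_def linear_simps)

lemma nrm_minus_commute: "x \<in> V \<Longrightarrow> y \<in> V \<Longrightarrow> nrm g (x - y) = nrm g (y - x)"
  using nrm_minus[of "x - y"] by simp

lemma Cauchy_Schwarz:
  assumes x: "x \<in> V" and y: "y \<in> V"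
  shows "\<bar>g x y\<bar> \<le> nrm g x * nrm g y"
proof -
  have "(g x y)\<^sup>2 \<le> g x x * g y y"
  proof (cases "y = 0")
    case False
    then have p: "0 < g y y" using y pos by blast
    have "0 \<le> g (x - (g x y / g y y) *\<^sub>R y) (x - (g x y / g y y) *\<^sub>R y)"
      using x y by simp
    also have "\<dots> = g x x - (g x y)\<^sup>2 / g y y"
      using x y p commute[OF x y]
      by (simp add: linear_simps power2_eq_square field_simps)
    finally show ?thesis using p by (simp add: field_simps)
  qed (use x in simp)
  then have "sqrt ((g x y)\<^sup>2) \<le> sqrt (g x x * g y y)"
    by (rule real_sqrt_le_mono)
  then show ?thesis by (simp add: nrm_def real_sqrt_mult)
qed

lemma tendsto_inner_left:
  assumes "\<And>k. X k \<in> V" "x \<in> V" "y \<in> V" "(\<lambda>k. nrm g (X k - x)) \<longlonglongrightarrow> 0"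
  shows "(\<lambda>k. g (X k) y) \<longlonglongrightarrow> g x y"
proof -
  have "(\<lambda>k. g (X k) y - g x y) \<longlonglongrightarrow> 0"
  proof (rule Lim_null_comparison)
    show "\<forall>\<^sub>F k in sequentially. norm (g (X k) y - g x y) \<le> nrm g (X k - x) * nrm g y"
      using Cauchy_Schwarz[of "X _ - x" y] assms by (simp add: diff_left)
    show "(\<lambda>k. nrm g (X k - x) * nrm g y) \<longlonglongrightarrow> 0"
      using tendsto_mult_left_zero[OF assms(4)] by simp
  qed
  then show ?thesis by (simp add: LIM_zero_iff)
qed

text \<open>Riesz representation. A minimising sequence of \<open>x \<mapsto> \<langle>x, x\<rangle> - 2 \<phi> x\<close> is Cauchy by the
  parallelogram law, and the first order condition at its limit says that the limit represents
  \<open>\<phi>\<close>.\<close>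

lemma Riesz_representation:
  fixes \<phi> :: "'a \<Rightarrow> real"
  assumes complete: "complete_wrt g V"
    and add: "\<And>x y. x \<in> V \<Longrightarrow> y \<in> V \<Longrightarrow> \<phi> (x + y) = \<phi> x + \<phi> y"
    and scale: "\<And>c x. x \<in> V \<Longrightarrow> \<phi> (c *\<^sub>R x) = c * \<phi> x"
    and bound: "\<And>x. x \<in> V \<Longrightarrow> \<bar>\<phi> x\<bar> \<le> C * nrm g x"
  obtains t where "t \<in> V" "\<And>x. x \<in> V \<Longrightarrow> g t x = \<phi> x"
proof -
  define J where "J x = g x x - 2 * \<phi> x" for x
  define m where "m = (INF x\<in>V. J x)"
  have lower: "- C\<^sup>2 \<le> J x" if "x \<in> V" for x
  proof -
    have "0 \<le> (nrm g x - C)\<^sup>2" by simp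
    then show ?thesis
      using bound[OF that] nrm_power2[OF that]
      by (simp add: J_def power2_diff mult.commute abs_le_iff)
  qed
  have m_le: "m \<le> J x" if "x \<in> V" for x
    unfolding m_def by (rule cINF_lower[OF bdd_belowI2 that]) (rule lower)
  have "\<exists>x\<in>V. J x < m + 1 / real (Suc k)" for k
  proof -
    have ne: "J ` V \<noteq> {}" using closed(1) by blast
    have "Inf (J ` V) < m + 1 / real (Suc k)" by (simp add: m_def)
    from cInf_lessD[OF ne this] show ?thesis by blast
  qed
  then obtain X where X: "\<And>k. X k \<in> V" "\<And>k. J (X k) < m + 1 / real (Suc k)"
    by metis
  have par: "g (x - y) (x - y) / 2 = J x + J y - 2 * J ((1/2) *\<^sub>R (x + y))"
    if "x \<in> V" "y \<in> V" for x y
    using that commute[OF that] by (simp add: J_def linear_simps add scale field_simps)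
  have diff: "g (X j - X k) (X j - X k) \<le> 2 / real (Suc j) + 2 / real (Suc k)" for j k
  proof -
    have "m \<le> J ((1/2) *\<^sub>R (X j + X k))" using X by (intro m_le) simp
    then show ?thesis
      using par[of "X j" "X k"] X(1)[of j] X(1)[of k] X(2)[of j] X(2)[of k] by simp
  qed
  have cauchy: "\<forall>\<epsilon>>0. \<exists>N. \<forall>j\<ge>N. \<forall>k\<ge>N. nrm g (X j - X k) < \<epsilon>"
  proof (intro allI impI)
    fix \<epsilon> :: real assume e: "0 < \<epsilon>"
    obtain N where N: "4 / \<epsilon>\<^sup>2 < real N" using reals_Archimedean2 by blast
    have "0 < real N" using N e by (smt (verit) divide_pos_pos zero_less_power)
    have "nrm g (X j - X k) < \<epsilon>" if "N \<le> j" "N \<le> k" for j k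
    proof -
      have "4 / real N < \<epsilon>\<^sup>2"
        using N e \<open>0 < real N\<close> by (simp add: field_simps)
      moreover have "2 / real (Suc j) \<le> 2 / real N" "2 / real (Suc k) \<le> 2 / real N"
        using that \<open>0 < real N\<close> by (auto intro!: divide_left_mono)
      ultimately have "g (X j - X k) (X j - X k) < \<epsilon>\<^sup>2"
        using diff[of j k] by linarith
      then show ?thesis
        unfolding nrm_def using e real_sqrt_less_mono by fastforce
    qed
    then show "\<exists>N. \<forall>j\<ge>N. \<forall>k\<ge>N. nrm g (X j - X k) < \<epsilon>" by blast
  qed
  then obtain t where t: "t \<in> V" "(\<lambda>k. nrm g (X k - t)) \<longlonglongrightarrow> 0"
    using complete X(1) unfolding complete_wrt_def by blast
  have "g t y = \<phi> y" if y: "y \<in> V" for y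
  proof -
    have lim: "(\<lambda>k. g (X k) y) \<longlonglongrightarrow> g t y"
      using tendsto_inner_left X(1) t y by blast
    have quad: "0 \<le> 2 * s * (g t y - \<phi> y) + s\<^sup>2 * g y y" for s
    proof (rule LIMSEQ_le_const)
      show "(\<lambda>k. 2 * s * (g (X k) y - \<phi> y) + s\<^sup>2 * g y y + 1 / real (Suc k))
          \<longlonglongrightarrow> 2 * s * (g t y - \<phi> y) + s\<^sup>2 * g y y"
      proof -
        have "(\<lambda>k. 2 * s * (g (X k) y - \<phi> y) + s\<^sup>2 * g y y + 1 / real (Suc k))
            \<longlonglongrightarrow> 2 * s * (g t y - \<phi> y) + s\<^sup>2 * g y y + 0"
          by (intro tendsto_intros lim LIMSEQ_Suc[OF lim_inverse_n'])
        then show ?thesis by simp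
      qed
      have "0 \<le> 2 * s * (g (X k) y - \<phi> y) + s\<^sup>2 * g y y + 1 / real (Suc k)" for k
      proof -
        have "m \<le> J (X k + s *\<^sub>R y)" using X y by (intro m_le) simp
        also have "\<dots> = J (X k) + 2 * s * (g (X k) y - \<phi> y) + s\<^sup>2 * g y y"
          using X y commute[OF y X(1)]
          by (simp add: J_def linear_simps add scale power2_eq_square algebra_simps)
        finally show ?thesis using X(2)[of k] by linarith
      qed
      then show "\<exists>N. \<forall>k\<ge>N. 0 \<le> 2 * s * (g (X k) y - \<phi> y) + s\<^sup>2 * g y y + 1 / real (Suc k)"
        by blast
    qed
    show ?thesis
    proof (cases "y = 0")
      case True
      then show ?thesis using scale[of 0 0] t by simp
    next
      case False
      then have p: "0 < g y y" using y pos by blast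
      define d where "d = g t y - \<phi> y"
      have "0 \<le> 2 * (- d / g y y) * d + (- d / g y y)\<^sup>2 * g y y"
        using quad[of "- d / g y y"] by (simp add: d_def)
      also have "\<dots> = - (d\<^sup>2 / g y y)"
        using p by (simp add: power2_eq_square field_simps)
      finally have "d\<^sup>2 / g y y \<le> 0" by simp
      then have "d = 0" using p by (simp add: divide_le_0_iff)
      then show ?thesis by (simp add: d_def)
    qed
  qed
  with t show ?thesis using that by blast
qed

end

text \<open>Sequences whose members may vanish are allowed, so that finite dimension needs no separate
  treatment.\<close>

definition orthonormal_or_zero :: "('a::real_vector \<Rightarrow> 'a \<Rightarrow> real) \<Rightarrow> (nat \<Rightarrow> 'a) \<Rightarrow> bool" where
  "orthonormal_or_zero g h \<longleftrightarrow>
     (\<forall>i j. i \<noteq> j \<longrightarrow> g (h i) (h j) = 0) \<and> (\<forall>j. h j = 0 \<or> g (h j) (h j) = 1)"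

text \<open>If a vector depends linearly on its predecessors, then \<open>v = 0\<close> and the inverse of its norm
  is \<open>0\<close>, so the sequence vanishes there.\<close>

fun gram_schmidt :: "('a::real_vector \<Rightarrow> 'a \<Rightarrow> real) \<Rightarrow> (nat \<Rightarrow> 'a) \<Rightarrow> nat \<Rightarrow> 'a" where
  "gram_schmidt g d n =
     (let v = d n - sum_list (map (\<lambda>i. g (d n) (gram_schmidt g d i) *\<^sub>R gram_schmidt g d i) [0..<n])
      in v /\<^sub>R nrm g v)"

declare gram_schmidt.simps [simp del]

context inner_space
begin

lemma Gram_Schmidt:
  fixes d :: "nat \<Rightarrow> 'a"
  assumes d: "\<And>n. d n \<in> V"
  obtains e where "\<And>n. e n \<in> V" "orthonormal_or_zero g e" "\<And>n. d n \<in> span (range e)"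
proof -
  define e where "e = gram_schmidt g d"
  define v where "v n = d n - (\<Sum>i<n. g (d n) (e i) *\<^sub>R e i)" for n
  have e_eq: "e n = v n /\<^sub>R nrm g (v n)" for n
    unfolding e_def v_def
    by (subst gram_schmidt.simps)
      (simp add: Let_def sum_list_distinct_conv_sum_set atLeast0LessThan)
  have eV: "e n \<in> V" for n
  proof (induction n rule: less_induct)
    case (less n)
    then have "v n \<in> V" unfolding v_def by (auto intro!: closed sum_closed d)
    then show ?case by (simp add: e_eq)
  qed
  have vV: "v n \<in> V" for n unfolding v_def by (intro closed sum_closed d eV)
  have norm: "e j = 0 \<or> g (e j) (e j) = 1" for j
  proof (cases "v j = 0")
    case False
    then have "0 < g (v j) (v j)" using vV pos by blast
    then have "g (e j) (e j) = g (v j) (v j) / (sqrt (g (v j) (v j)) * sqrt (g (v j) (v j)))"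
      using vV[of j] by (simp add: e_eq linear_simps nrm_def field_simps)
    also have "\<dots> = 1" using \<open>0 < g (v j) (v j)\<close> by simp
    finally show ?thesis by simp
  qed (simp add: e_eq)
  have orth_less: "\<forall>i<n. g (e n) (e i) = 0" for n
  proof (induction n rule: less_induct)
    case (less n)
    have orth: "g (e k) (e i) = 0" if "k < n" "i < n" "k \<noteq> i" for i k
      using that less[of k] less[of i] commute[OF eV eV, of i k] by (cases "k < i") auto
    show ?case
    proof (intro allI impI)
      fix i assume i: "i < n"
      have "g (v n) (e i) = g (d n) (e i) - (\<Sum>k<n. g (d n) (e k) * g (e k) (e i))"
        unfolding v_def using d eV by (simp add: linear_simps sum_left)
      also have "(\<Sum>k<n. g (d n) (e k) * g (e k) (e i))
          = (\<Sum>k<n. if k = i then g (d n) (e i) * g (e i) (e i) else 0)"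
        using orth i by (intro sum.cong) auto
      also have "\<dots> = g (d n) (e i) * g (e i) (e i)" using i by simp
      also have "\<dots> = g (d n) (e i)" using norm[of i] d by auto
      finally show "g (e n) (e i) = 0" using vV eV unfolding e_eq[of n] by (simp add: linear_simps)
    qed
  qed
  have "orthonormal_or_zero g e"
    unfolding orthonormal_or_zero_def
    using orth_less norm commute[OF eV eV] by (metis linorder_neqE_nat)
  moreover have "d n \<in> span (range e)" for n
  proof -
    have "v n = nrm g (v n) *\<^sub>R e n"
    proof (cases "v n = 0")
      case False
      then have "nrm g (v n) \<noteq> 0" using vV[of n] by (simp add: nrm_def eq_zero_iff)
      then show ?thesis by (simp add: e_eq)
    qed (simp add: e_eq)
    then have "d n = nrm g (v n) *\<^sub>R e n + (\<Sum>i<n. g (d n) (e i) *\<^sub>R e i)"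
      unfolding v_def by (simp add: algebra_simps)
    then show ?thesis
      by (metis (no_types, lifting) rangeI span_add span_base span_scale span_sum)
  qed
  ultimately show ?thesis using eV that by blast
qed

lemma Bessel_identity:
  assumes h: "\<And>i. h i \<in> V" "orthonormal_or_zero g h" and x: "x \<in> V"
    and "finite I"
  defines "r \<equiv> x - (\<Sum>i\<in>I. g (h i) x *\<^sub>R h i)"
  shows "g r r = g x x - (\<Sum>i\<in>I. (g (h i) x)\<^sup>2)"
    and "j \<in> I \<Longrightarrow> g (h j) r = 0"
proof -
  have gs: "g (h j) (\<Sum>i\<in>I. g (h i) x *\<^sub>R h i) = (if j \<in> I then g (h j) x else 0)" for j
  proof -
    have "g (h j) (\<Sum>i\<in>I. g (h i) x *\<^sub>R h i) = (\<Sum>i\<in>I. if i = j then g (h j) x else 0)"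
    proof -
      have "g (h i) x * g (h j) (h i) = (if i = j then g (h j) x else 0)" for i
        using h x unfolding orthonormal_or_zero_def by (cases "h j = 0") auto
      then show ?thesis using h(1) by (simp add: sum_right scale_right)
    qed
    also have "\<dots> = (if j \<in> I then g (h j) x else 0)" using \<open>finite I\<close> by simp
    finally show ?thesis .
  qed
  show orth: "g (h j) r = 0" if "j \<in> I" for j
    unfolding r_def using h(1) x that by (simp add: linear_simps gs)
  have rV: "r \<in> V" unfolding r_def using h x by simp
  have "g r r = g x r - (\<Sum>i\<in>I. g (h i) x * g (h i) r)"
    using rV h(1) x by (subst r_def) (simp add: linear_simps sum_left)
  also have "\<dots> = g x r" by (simp add: orth)
  also have "\<dots> = g x x - (\<Sum>i\<in>I. (g (h i) x)\<^sup>2)"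
    unfolding r_def using h(1) x commute[OF x h(1)]
    by (simp add: linear_simps sum_right power2_eq_square)
  finally show "g r r = g x x - (\<Sum>i\<in>I. (g (h i) x)\<^sup>2)" .
qed

text \<open>By the Bessel identity the remainders of the Fourier series form a Cauchy sequence. Their
  limit is orthogonal to every \<open>h i\<close>, hence \<open>0\<close> by totality.\<close>

lemma Parseval_of_total:
  assumes complete: "complete_wrt g V"
    and h: "\<And>i. h i \<in> V" "orthonormal_or_zero g h" and x: "x \<in> V"
    and total: "\<And>z. z \<in> V \<Longrightarrow> (\<And>i. g (h i) z = 0) \<Longrightarrow> z = 0"
  shows "(\<lambda>i. (g (h i) x)\<^sup>2) sums g x x"
    and "(\<lambda>k. nrm g (x - (\<Sum>i<k. g (h i) x *\<^sub>R h i))) \<longlonglongrightarrow> 0"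
proof -
  define r where "r k = x - (\<Sum>i<k. g (h i) x *\<^sub>R h i)" for k
  have rV: "r k \<in> V" for k unfolding r_def using h x by simp
  have r2: "g (r k) (r k) = g x x - (\<Sum>i<k. (g (h i) x)\<^sup>2)" for k
    unfolding r_def by (rule Bessel_identity(1)[OF h x]) simp
  have orth: "g (h j) (r k) = 0" if "j < k" for j k
    unfolding r_def by (rule Bessel_identity(2)[OF h x]) (use that in auto)
  have summ: "summable (\<lambda>i. (g (h i) x)\<^sup>2)"
  proof (rule summableI_nonneg_bounded[where x = "g x x"])
    show "(\<Sum>i<k. (g (h i) x)\<^sup>2) \<le> g x x" for k
      using r2[of k] nonneg[OF rV[of k]] by linarith
  qed simp
  have diff_le: "g (r j - r k) (r j - r k) = (\<Sum>i\<in>{k..<j}. (g (h i) x)\<^sup>2)" if "k \<le> j" for j k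
  proof -
    have "r k - r j = (\<Sum>i\<in>{k..<j}. g (h i) x *\<^sub>R h i)"
      unfolding r_def using that
      by (simp add: algebra_simps sum.atLeastLessThan_concat atLeast0LessThan[symmetric])
    then have "g (r k - r j) (r j) = 0"
      using h(1) rV orth by (simp add: sum_left linear_simps)
    then have "g (r j - r k) (r j - r k) = g (r k) (r k) - g (r j) (r j)"
      using rV commute[OF rV rV, of j k] by (simp add: linear_simps)
    also have "\<dots> = (\<Sum>i<j. (g (h i) x)\<^sup>2) - (\<Sum>i<k. (g (h i) x)\<^sup>2)" by (simp add: r2)
    also have "\<dots> = (\<Sum>i\<in>{k..<j}. (g (h i) x)\<^sup>2)"
      using that by (simp add: sum_diff_nat_ivl atLeast0LessThan[symmetric])
    finally show ?thesis .
  qed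
  have "\<forall>\<epsilon>>0. \<exists>N. \<forall>j\<ge>N. \<forall>k\<ge>N. nrm g (r j - r k) < \<epsilon>"
  proof (intro allI impI)
    fix \<epsilon> :: real assume e: "0 < \<epsilon>"
    obtain N where N: "\<And>m n. N \<le> m \<Longrightarrow> norm (\<Sum>i\<in>{m..<n}. (g (h i) x)\<^sup>2) < \<epsilon>\<^sup>2"
      using summ e unfolding summable_Cauchy by (meson zero_less_power)
    have *: "nrm g (r j - r k) < \<epsilon>" if "N \<le> k" "k \<le> j" for j k
    proof -
      have "g (r j - r k) (r j - r k) < \<epsilon>\<^sup>2"
        using N[OF that(1), of j] diff_le[OF that(2)] by simp
      then show ?thesis unfolding nrm_def using e real_sqrt_less_mono by fastforce
    qed
    have "nrm g (r j - r k) < \<epsilon>" if "N \<le> j" "N \<le> k" for j k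
      using *[of k j] *[of j k] that nrm_minus_commute[OF rV rV, of j k] by linarith
    then show "\<exists>N. \<forall>j\<ge>N. \<forall>k\<ge>N. nrm g (r j - r k) < \<epsilon>" by blast
  qed
  then obtain z where z: "z \<in> V" "(\<lambda>k. nrm g (r k - z)) \<longlonglongrightarrow> 0"
    using complete rV unfolding complete_wrt_def by blast
  have "g z (h j) = 0" for j
  proof -
    have "(\<lambda>k. g (r k) (h j)) \<longlonglongrightarrow> g z (h j)"
      using tendsto_inner_left rV z h(1) by blast
    moreover have "\<forall>\<^sub>F k in sequentially. g (r k) (h j) = 0"
      using eventually_gt_at_top[of j]
      by eventually_elim (use orth commute rV h(1) in auto)
    ultimately show ?thesis
      by (metis LIMSEQ_unique tendsto_eventually)
  qed
  then have "z = 0" using total z(1) commute h(1) by metis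
  then show lim: "(\<lambda>k. nrm g (x - (\<Sum>i<k. g (h i) x *\<^sub>R h i))) \<longlonglongrightarrow> 0"
    using z(2) unfolding r_def by simp
  have "(\<lambda>k. (nrm g (r k))\<^sup>2) \<longlonglongrightarrow> 0"
    using tendsto_power[OF lim, of 2] by (simp add: r_def)
  then have "(\<lambda>k. g x x - (nrm g (r k))\<^sup>2) \<longlonglongrightarrow> g x x - 0"
    by (intro tendsto_intros)
  then show "(\<lambda>i. (g (h i) x)\<^sup>2) sums g x x"
    unfolding sums_def using nrm_power2[OF rV] r2 by simp
qed

end

section \<open>Symmetric multilinear forms on a complexified seminormed space\<close>

lemma cscale_simps:
  "cscale z (x + y) = cscale z x + cscale z y"
  "cscale (z + w) x = cscale z x + cscale w x"
  "cscale z (cscale w x) = cscale (z * w) x"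
  "cscale 1 x = x" "cscale 0 x = 0" "cscale z 0 = 0" "cscale (- 1) x = - x"
  by (simp_all add: cscale_def prod_eq_iff algebra_simps)

locale complex_seminormed =
  fixes W :: "('a::real_vector \<times> 'a) set" and N :: "'a \<times> 'a \<Rightarrow> real"
  assumes zero_mem [simp]: "0 \<in> W"
    and add_mem [simp]: "x \<in> W \<Longrightarrow> y \<in> W \<Longrightarrow> x + y \<in> W"
    and scale_mem [simp]: "x \<in> W \<Longrightarrow> cscale c x \<in> W"
    and N_nonneg [simp]: "x \<in> W \<Longrightarrow> 0 \<le> N x"
    and N_triangle: "x \<in> W \<Longrightarrow> y \<in> W \<Longrightarrow> N (x + y) \<le> N x + N y"
    and N_scale: "x \<in> W \<Longrightarrow> N (cscale c x) = cmod c * N x"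
begin

lemma diff_mem [simp]: "x \<in> W \<Longrightarrow> y \<in> W \<Longrightarrow> x - y \<in> W"
  using add_mem[of x "cscale (- 1) y"] scale_mem[of y "- 1"] by (simp add: cscale_simps)

lemma sum_mem [simp]: "(\<And>i. i \<in> I \<Longrightarrow> x i \<in> W) \<Longrightarrow> (\<Sum>i\<in>I. x i) \<in> W"
  by (induction I rule: infinite_finite_induct) auto

lemma N_zero [simp]: "N 0 = 0"
  using N_scale[of 0 0] by (simp add: cscale_simps)

text \<open>Symmetry transports linearity from the first slot to all others.\<close>

definition sym_multilinear :: "nat \<Rightarrow> (('a \<times> 'a) list \<Rightarrow> complex) \<Rightarrow> bool" where
  "sym_multilinear n A \<longleftrightarrow>
     (\<forall>xs ys. set xs \<subseteq> W \<and> length xs = n \<and> mset xs = mset ys \<longrightarrow> A xs = A ys) \<and>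
     (\<forall>x\<in>W. \<forall>y\<in>W. \<forall>zs. set zs \<subseteq> W \<and> Suc (length zs) = n \<longrightarrow>
        A ((x + y) # zs) = A (x # zs) + A (y # zs)) \<and>
     (\<forall>c. \<forall>x\<in>W. \<forall>zs. set zs \<subseteq> W \<and> Suc (length zs) = n \<longrightarrow>
        A (cscale c x # zs) = c * A (x # zs))"

context
  fixes n A
  assumes A: "sym_multilinear n A"
begin

lemma form_perm: "set xs \<subseteq> W \<Longrightarrow> length xs = n \<Longrightarrow> mset xs = mset ys \<Longrightarrow> A xs = A ys"
  using A[unfolded sym_multilinear_def] by metis

lemma form_add: "x \<in> W \<Longrightarrow> y \<in> W \<Longrightarrow> set zs \<subseteq> W \<Longrightarrow> Suc (length zs) = n \<Longrightarrow>
    A ((x + y) # zs) = A (x # zs) + A (y # zs)"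
  using A[unfolded sym_multilinear_def] by metis

lemma form_scale: "x \<in> W \<Longrightarrow> set zs \<subseteq> W \<Longrightarrow> Suc (length zs) = n \<Longrightarrow>
    A (cscale c x # zs) = c * A (x # zs)"
  using A[unfolded sym_multilinear_def] by metis

lemma form_zero: "set zs \<subseteq> W \<Longrightarrow> Suc (length zs) = n \<Longrightarrow> A (0 # zs) = 0"
  using form_scale[of 0 zs 0] by (simp add: cscale_simps)

lemma form_sum:
  assumes "set zs \<subseteq> W" "Suc (length zs) = n" "\<And>i. i \<in> I \<Longrightarrow> x i \<in> W"
  shows "A ((\<Sum>i\<in>I. x i) # zs) = (\<Sum>i\<in>I. A (x i # zs))"
  using assms(3)
proof (induction I rule: infinite_finite_induct)
  case (insert i I)
  then show ?case using form_add[of "x i" "\<Sum>i\<in>I. x i" zs] assms by simp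
qed (use form_zero assms in auto)

lemma sym_multilinear_Cons:
  assumes x: "x \<in> W" and n: "n = Suc m"
  shows "sym_multilinear m (\<lambda>zs. A (x # zs))"
proof -
  have swap: "A (x # y # zs) = A (y # x # zs)" if "y \<in> W" "set zs \<subseteq> W" "Suc (length zs) = m" for y zs
    using that x n by (intro form_perm) auto
  show ?thesis
    unfolding sym_multilinear_def
  proof (intro conjI allI ballI impI; elim conjE)
    show "A (x # xs) = A (x # ys)" if "set xs \<subseteq> W" "length xs = m" "mset xs = mset ys" for xs ys
      using that x n by (intro form_perm) auto
    show "A (x # (y + y') # zs) = A (x # y # zs) + A (x # y' # zs)"
      if "y \<in> W" "y' \<in> W" "set zs \<subseteq> W" "Suc (length zs) = m" for y y' zs
      using form_add[of y y' "x # zs"] that x n by (simp add: swap)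
    show "A (x # cscale c y # zs) = c * A (x # y # zs)"
      if "y \<in> W" "set zs \<subseteq> W" "Suc (length zs) = m" for c y zs
      using form_scale[of y "x # zs" c] that x n by (simp add: swap)
  qed
qed

lemma form_scale_all:
  "set xs \<subseteq> W \<Longrightarrow> set ys \<subseteq> W \<Longrightarrow> length xs + length ys = n \<Longrightarrow>
    A (map (\<lambda>x. cscale (c x) x) xs @ ys) = (\<Prod>x\<leftarrow>xs. c x) * A (xs @ ys)"
proof (induction xs arbitrary: ys)
  case (Cons x xs)
  let ?zs = "map (\<lambda>x. cscale (c x) x) xs"
  have zs: "set ?zs \<subseteq> W" using Cons.prems(1) by auto
  have "A (cscale (c x) x # ?zs @ ys) = c x * A (x # ?zs @ ys)"
    using Cons.prems zs by (intro form_scale) auto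
  also have "A (x # ?zs @ ys) = A (?zs @ x # ys)"
    using Cons.prems zs by (intro form_perm) auto
  also have "\<dots> = (\<Prod>x\<leftarrow>xs. c x) * A (xs @ x # ys)"
    using Cons.prems by (intro Cons.IH) auto
  also have "A (xs @ x # ys) = A (x # xs @ ys)"
    using Cons.prems by (intro form_perm) auto
  finally show ?case by simp
qed simp

text \<open>The product rule gives one summand for each of the \<open>m\<close> slots that carry \<open>z x + y\<close>; by symmetry
  the summands agree.\<close>

lemma form_power_has_derivative:
  assumes "x \<in> W" "y \<in> W"
  shows "set xs \<subseteq> W \<Longrightarrow> length xs + m = n \<Longrightarrow>
    ((\<lambda>z. A (xs @ replicate m (cscale z x + y))) has_field_derivative
      of_nat m * A (x # xs @ replicate (m - 1) (cscale z x + y))) (at z)"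
proof (induction m arbitrary: xs)
  case (Suc m)
  let ?w = "\<lambda>z. cscale z x + y"
  have w: "?w z \<in> W" for z using assms by simp
  have split: "A (xs @ replicate (Suc m) (?w z))
      = z * A ((x # xs) @ replicate m (?w z)) + A ((y # xs) @ replicate m (?w z))" for z
  proof -
    have "A (xs @ replicate (Suc m) (?w z)) = A (?w z # xs @ replicate m (?w z))"
      using Suc.prems w by (intro form_perm) auto
    also have "\<dots> = A (cscale z x # xs @ replicate m (?w z)) + A (y # xs @ replicate m (?w z))"
      using Suc.prems w[of z] assms by (intro form_add) auto
    also have "A (cscale z x # xs @ replicate m (?w z)) = z * A (x # xs @ replicate m (?w z))"
      using Suc.prems w[of z] assms by (intro form_scale) auto
    finally show ?thesis by simp
  qed
  let ?D = "\<lambda>x'. of_nat m * A (x # (x' # xs) @ replicate (m - 1) (?w z))"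
  have IH: "((\<lambda>z. A ((x' # xs) @ replicate m (?w z))) has_field_derivative ?D x') (at z)"
    if "x' \<in> W" for x'
    using Suc.prems that by (intro Suc.IH) auto
  have D: "z * ?D x + ?D y = of_nat m * A (x # xs @ replicate m (?w z))"
  proof (cases m)
    case (Suc k)
    let ?r = "replicate k (?w z)"
    have "A (x # xs @ ?w z # ?r) = A (?w z # x # xs @ ?r)"
      using Suc.prems Suc w[of z] assms by (intro form_perm) auto
    also have "\<dots> = A (cscale z x # x # xs @ ?r) + A (y # x # xs @ ?r)"
      using Suc.prems Suc w[of z] assms by (intro form_add) auto
    also have "A (cscale z x # x # xs @ ?r) = z * A (x # x # xs @ ?r)"
      using Suc.prems Suc w[of z] assms by (intro form_scale) auto
    also have "A (y # x # xs @ ?r) = A (x # y # xs @ ?r)"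
      using Suc.prems Suc w[of z] assms by (intro form_perm) auto
    finally show ?thesis using Suc by (simp add: algebra_simps)
  qed simp
  have "((\<lambda>z. z * A ((x # xs) @ replicate m (?w z)) + A ((y # xs) @ replicate m (?w z)))
      has_field_derivative
      (1 * A ((x # xs) @ replicate m (?w z)) + ?D x * z) + ?D y) (at z)"
    by (intro DERIV_add DERIV_mult DERIV_ident IH assms)
  moreover have "(1 * A ((x # xs) @ replicate m (?w z)) + ?D x * z) + ?D y
      = of_nat (Suc m) * A (x # xs @ replicate (Suc m - 1) (?w z))"
    using D by (simp add: algebra_simps)
  ultimately show ?case unfolding split by simp
qed simp

text \<open>Vectors \<open>x\<close> of norm at most \<open>1\<close> replace copies of \<open>y\<close> one at a time. Up to a factor, the form
  with one more \<open>x\<close> is the derivative at \<open>0\<close> of the form along \<open>z x + y\<close>, which Cauchy's inequality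
  bounds by the values on \<open>|z| = 1\<close>; there \<open>z x + y\<close> has norm at most \<open>1 + N y\<close>. After \<open>n\<close>
  replacements, started at \<open>y = 0\<close>, the radius has grown to \<open>n\<close>, whence \<open>n\<^sup>n / n!\<close>.\<close>

lemma polarization_step:
  assumes bound: "\<And>x. x \<in> W \<Longrightarrow> cmod (A (replicate n x)) \<le> C * N x ^ n" and "0 \<le> C"
  shows "set xs \<subseteq> W \<Longrightarrow> \<forall>x\<in>set xs. N x \<le> 1 \<Longrightarrow> length xs + m = n \<Longrightarrow> y \<in> W \<Longrightarrow>
    fact n / fact m * cmod (A (xs @ replicate m y)) \<le> C * (real (length xs) + N y) ^ n"
proof (induction xs arbitrary: m y)
  case (Cons x xs)
  define \<phi> where "\<phi> z = A (xs @ replicate (Suc m) (cscale z x + y))" for z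
  have x: "x \<in> W" "N x \<le> 1" and xs: "set xs \<subseteq> W" "length xs + Suc m = n"
    using Cons.prems by auto
  have der: "(\<phi> has_field_derivative
      of_nat (Suc m) * A (x # xs @ replicate (Suc m - 1) (cscale z x + y))) (at z)" for z
    unfolding \<phi>_def by (rule form_power_has_derivative) (use x xs Cons.prems in auto)
  have hol: "\<phi> holomorphic_on UNIV"
    using der by (auto simp: holomorphic_on_def field_differentiable_def has_field_derivative_at_within)
  define B where "B = fact (Suc m) / fact n * (C * (real (length (x # xs)) + N y) ^ n)"
  have "cmod (\<phi> z) \<le> B" if "cmod z = 1" for z
  proof -
    have w: "cscale z x + y \<in> W" using x Cons.prems by simp
    have "N (cscale z x + y) \<le> 1 + N y"
      using N_triangle[of "cscale z x" y] N_scale[of x z] x Cons.prems that by simp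
    then have "C * (real (length xs) + N (cscale z x + y)) ^ n
        \<le> C * (real (length (x # xs)) + N y) ^ n"
      using \<open>0 \<le> C\<close> w by (intro mult_left_mono power_mono) auto
    then have "fact n / fact (Suc m) * cmod (\<phi> z) \<le> C * (real (length (x # xs)) + N y) ^ n"
      using Cons.IH[of "Suc m" "cscale z x + y"] Cons.prems w unfolding \<phi>_def by auto
    then show ?thesis unfolding B_def by (simp add: field_simps del: fact_Suc)
  qed
  then have "cmod ((deriv ^^ 1) \<phi> 0) \<le> fact 1 * B / 1 ^ 1"
    using hol by (intro Cauchy_inequality holomorphic_on_imp_continuous_on)
      (auto intro: holomorphic_on_subset)
  moreover have "deriv \<phi> 0 = of_nat (Suc m) * A (x # xs @ replicate m y)"
    using DERIV_imp_deriv[OF der[of 0]] by (simp add: cscale_simps)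
  ultimately have "of_nat (Suc m) * cmod (A (x # xs @ replicate m y)) \<le> B"
    by (simp add: norm_mult del: of_nat_Suc)
  then have "fact n / fact (Suc m) * (of_nat (Suc m) * cmod (A (x # xs @ replicate m y)))
      \<le> C * (real (length (x # xs)) + N y) ^ n"
    unfolding B_def by (simp add: field_simps del: fact_Suc of_nat_Suc)
  moreover have "fact n / fact (Suc m) * (of_nat (Suc m) * r) = fact n / fact m * r" for r :: real
    by (simp add: field_simps del: of_nat_Suc)
  ultimately show ?case by simp
qed (use bound in auto)

theorem polarization_bound:
  assumes bound: "\<And>x. x \<in> W \<Longrightarrow> cmod (A (replicate n x)) \<le> C * N x ^ n" and C: "0 \<le> C"
    and xs: "set xs \<subseteq> W" "length xs = n"
  shows "cmod (A xs) \<le> real n ^ n / fact n * C * (\<Prod>x\<leftarrow>xs. N x)"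
proof -
  \<comment> \<open>The arguments are normalised by \<open>N x + \<delta>\<close> because \<open>N x\<close> may vanish.\<close>
  have approx: "cmod (A xs) \<le> real n ^ n / fact n * C * (\<Prod>x\<leftarrow>xs. N x + \<delta>)" if d: "0 < \<delta>" for \<delta>
  proof -
    define c where "c x = complex_of_real (1 / (N x + \<delta>))" for x
    have pos: "0 < N x + \<delta>" if "x \<in> W" for x using N_nonneg[OF that] d by simp
    let ?ys = "map (\<lambda>x. cscale (c x) x) xs"
    have c: "cmod (c x) = 1 / (N x + \<delta>)" if "x \<in> W" for x
      unfolding c_def norm_of_real using pos[OF that] by simp
    have "N (cscale (c x) x) \<le> 1" if "x \<in> W" for x
      using N_scale[OF that, of "c x"] pos[OF that] d N_nonneg[OF that]
      by (simp add: c[OF that])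
    then have "fact n / fact 0 * cmod (A (?ys @ replicate 0 0))
        \<le> C * (real (length ?ys) + N 0) ^ n"
      using xs by (intro polarization_step bound C) auto
    moreover have Ays: "A ?ys = (\<Prod>x\<leftarrow>xs. c x) * A xs"
      using form_scale_all[of xs "[]" c] xs by simp
    ultimately have le: "fact n * (cmod (\<Prod>x\<leftarrow>xs. c x) * cmod (A xs)) \<le> C * real n ^ n"
      using xs by (simp add: norm_mult)
    have one: "cmod (\<Prod>x\<leftarrow>xs. c x) * (\<Prod>x\<leftarrow>xs. N x + \<delta>) = 1"
      using xs(1)
    proof (induction xs)
      case (Cons x xs)
      then show ?case using c[of x] pos[of x] by (simp add: norm_mult field_simps)
    qed simp
    have nonneg: "0 \<le> (\<Prod>x\<leftarrow>xs. N x + \<delta>)"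
      using xs(1)
    proof (induction xs)
      case (Cons x xs)
      then show ?case using pos[of x] by simp
    qed simp
    have "fact n * cmod (A xs)
        = fact n * (cmod (\<Prod>x\<leftarrow>xs. c x) * cmod (A xs)) * (\<Prod>x\<leftarrow>xs. N x + \<delta>)"
      using arg_cong[OF one, of "\<lambda>r. fact n * cmod (A xs) * r"] by (simp add: mult_ac)
    also have "\<dots> \<le> C * real n ^ n * (\<Prod>x\<leftarrow>xs. N x + \<delta>)"
      using le nonneg by (rule mult_right_mono)
    finally show ?thesis by (simp add: field_simps)
  qed
  have lim: "((\<lambda>\<delta>. \<Prod>x\<leftarrow>xs. N x + \<delta>) \<longlongrightarrow> (\<Prod>x\<leftarrow>xs. N x)) (at_right 0)"
  proof (induction xs)
    case (Cons x xs)
    have "((\<lambda>\<delta>. N x + \<delta>) \<longlongrightarrow> N x + 0) (at_right 0)" by (intro tendsto_intros)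
    from tendsto_mult[OF this Cons] show ?case by simp
  qed simp
  show ?thesis
  proof (rule tendsto_lowerbound)
    show "((\<lambda>\<delta>. real n ^ n / fact n * C * (\<Prod>x\<leftarrow>xs. N x + \<delta>)) \<longlongrightarrow>
        real n ^ n / fact n * C * (\<Prod>x\<leftarrow>xs. N x)) (at_right 0)"
      by (intro tendsto_intros lim)
    show "\<forall>\<^sub>F \<delta> in at_right 0. cmod (A xs) \<le> real n ^ n / fact n * C * (\<Prod>x\<leftarrow>xs. N x + \<delta>)"
      using eventually_at_right_less by eventually_elim (rule approx)
  qed simp
qed

end

text \<open>Bounded multilinear forms are continuous: the arguments are exchanged for their limits from
  left to right, each exchange costing a term with a factor \<open>N (P k y - y)\<close>.\<close>

lemma form_tendsto:
  assumes "sym_multilinear n A"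
    and "\<And>xs. set xs \<subseteq> W \<Longrightarrow> length xs = n \<Longrightarrow> cmod (A xs) \<le> K * (\<Prod>x\<leftarrow>xs. N x)"
    and "set ys \<subseteq> W" "length ys = n"
    and "\<And>y k. y \<in> set ys \<Longrightarrow> P k y \<in> W" "\<And>y. y \<in> set ys \<Longrightarrow> (\<lambda>k. N (P k y - y)) \<longlonglongrightarrow> 0"
  shows "(\<lambda>k::nat. A (map (P k) ys)) \<longlonglongrightarrow> A ys"
  using assms
proof (induction ys arbitrary: n A K)
  case (Cons y ys)
  obtain m where n: "n = Suc m" and m: "length ys = m" using Cons.prems(4) by auto
  have y: "y \<in> W" and ys: "set ys \<subseteq> W" using Cons.prems(3) by auto
  have P: "P k x \<in> W" if "x = y \<or> x \<in> set ys" for k x using Cons.prems(5) that by auto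
  have Pys: "set (map (P k) ys) \<subseteq> W" for k using P by auto
  have second: "(\<lambda>k. A (y # map (P k) ys)) \<longlonglongrightarrow> A (y # ys)"
  proof (rule Cons.IH[where n = m and K = "K * N y"])
    show "sym_multilinear m (\<lambda>zs. A (y # zs))"
      using sym_multilinear_Cons Cons.prems(1) y n by blast
    show "cmod (A (y # xs)) \<le> K * N y * (\<Prod>x\<leftarrow>xs. N x)" if "set xs \<subseteq> W" "length xs = m" for xs
      using Cons.prems(2)[of "y # xs"] that y n by (simp add: mult.assoc)
  qed (use Cons.prems ys m in auto)
  have first: "(\<lambda>k. A ((P k y - y) # map (P k) ys)) \<longlonglongrightarrow> 0"
  proof (rule Lim_null_comparison)
    let ?b = "\<lambda>k. \<bar>K\<bar> * (N (P k y - y) * (\<Prod>x\<leftarrow>ys. N (P k x - x) + N x))"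
    have prods: "(\<Prod>x\<leftarrow>ys. N (P k x)) \<le> (\<Prod>x\<leftarrow>ys. N (P k x - x) + N x)
        \<and> 0 \<le> (\<Prod>x\<leftarrow>ys. N (P k x))" for k
      using ys P
    proof (induction ys)
      case (Cons a as)
      have "N (P k a) \<le> N (P k a - a) + N a"
        using N_triangle[of "P k a - a" a] Cons.prems by simp
      moreover have "0 \<le> N (P k a)" using Cons.prems by (intro N_nonneg) simp
      moreover have "(\<Prod>x\<leftarrow>as. N (P k x)) \<le> (\<Prod>x\<leftarrow>as. N (P k x - x) + N x)
        \<and> 0 \<le> (\<Prod>x\<leftarrow>as. N (P k x))"
        using Cons.prems by (intro Cons.IH) auto
      ultimately show ?case by (auto intro!: mult_mono mult_nonneg_nonneg)
    qed simp
    have "cmod (A ((P k y - y) # map (P k) ys)) \<le> ?b k" for k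
    proof -
      have "cmod (A ((P k y - y) # map (P k) ys))
          \<le> K * (\<Prod>x\<leftarrow>(P k y - y) # map (P k) ys. N x)"
        using Pys y P n m by (intro Cons.prems(2)) auto
      also have "\<dots> = K * (N (P k y - y) * (\<Prod>x\<leftarrow>ys. N (P k x)))" by (simp add: o_def)
      also have "\<dots> \<le> \<bar>K\<bar> * (N (P k y - y) * (\<Prod>x\<leftarrow>ys. N (P k x)))"
        using prods[of k] P y by (intro mult_right_mono) auto
      also have "\<dots> \<le> ?b k"
        using prods[of k] P y by (intro mult_left_mono) auto
      finally show ?thesis .
    qed
    then show "\<forall>\<^sub>F k in sequentially. norm (A ((P k y - y) # map (P k) ys)) \<le> ?b k" by simp
    have "(\<lambda>k. \<Prod>x\<leftarrow>ys. N (P k x - x) + N x) \<longlonglongrightarrow> (\<Prod>x\<leftarrow>ys. 0 + N x)"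
      using Cons.prems(6)
    proof (induction ys)
      case (Cons a as)
      show ?case by (simp del: add_0) (intro tendsto_intros Cons; use Cons.prems in auto)
    qed simp
    then have "?b \<longlonglongrightarrow> \<bar>K\<bar> * (0 * (\<Prod>x\<leftarrow>ys. 0 + N x))"
      by (intro tendsto_intros Cons.prems(6)) auto
    then show "?b \<longlonglongrightarrow> 0" by simp
  qed
  have "A (map (P k) (y # ys)) = A ((P k y - y) # map (P k) ys) + A (y # map (P k) ys)" for k
    using form_add[OF Cons.prems(1), of "P k y - y" y "map (P k) ys"] Pys P y n m by simp
  then show ?case using tendsto_add[OF first second] by simp
qed simp

end

definition index_lists :: "nat \<Rightarrow> nat \<Rightarrow> nat list set" where
  "index_lists k n = {is. set is \<subseteq> {..<k} \<and> length is = n}"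

lemma index_lists_mono: "k \<le> j \<Longrightarrow> index_lists k n \<subseteq> index_lists j n"
  by (auto simp: index_lists_def)

lemma finite_index_lists [simp]: "finite (index_lists k n)"
  unfolding index_lists_def by (rule finite_lists_length_eq) simp

lemma index_lists_0 [simp]: "index_lists k 0 = {[]}"
  by (auto simp: index_lists_def)

lemma sum_index_lists_Suc:
  "(\<Sum>is\<in>index_lists k (Suc n). f is) = (\<Sum>i<k. \<Sum>is\<in>index_lists k n. f (i # is))"
proof -
  have eq: "index_lists k (Suc n) = (\<lambda>(i, is). i # is) ` ({..<k} \<times> index_lists k n)"
    by (auto simp: index_lists_def length_Suc_conv image_iff)
  have "(\<Sum>is\<in>index_lists k (Suc n). f is) = (\<Sum>(i, is)\<in>{..<k} \<times> index_lists k n. f (i # is))"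
    unfolding eq by (subst sum.reindex) (auto simp: inj_on_def case_prod_beta)
  then show ?thesis by (simp add: sum.cartesian_product)
qed

lemma sum_index_lists_prod:
  fixes a :: "nat \<Rightarrow> nat \<Rightarrow> 'b::comm_semiring_1"
  shows "(\<Sum>is\<in>index_lists k n. \<Prod>i<n. a i (is ! i)) = (\<Prod>i<n. \<Sum>j<k. a i j)"
proof (induction n arbitrary: a)
  case (Suc n)
  have "(\<Sum>is\<in>index_lists k (Suc n). \<Prod>i<Suc n. a i (is ! i))
      = (\<Sum>j<k. a 0 j) * (\<Sum>is\<in>index_lists k n. \<Prod>i<n. a (Suc i) (is ! i))"
    by (simp add: sum_index_lists_Suc prod.lessThan_Suc_shift
        del: prod.lessThan_Suc flip: sum_distrib_left sum_distrib_right)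
  also have "\<dots> = (\<Prod>i<Suc n. \<Sum>j<k. a i j)"
    unfolding Suc.IH[of "\<lambda>i. a (Suc i)"] prod.lessThan_Suc_shift ..
  finally show ?case .
qed simp

lemma (in complex_seminormed) form_expand:
  assumes "sym_multilinear n A" "\<And>i. e i \<in> W" "length ys = n"
  shows "A (map (\<lambda>y. \<Sum>i<k. cscale (c i y) (e i)) ys)
    = (\<Sum>is\<in>index_lists k n. A (map e is) * (\<Prod>i<n. c (is ! i) (ys ! i)))"
  using assms
proof (induction ys arbitrary: n A)
  case (Cons y ys)
  obtain m where n: "n = Suc m" and m: "length ys = m" using Cons.prems(3) by auto
  let ?P = "\<lambda>y. \<Sum>i<k. cscale (c i y) (e i)"
  have P: "set (map ?P ys) \<subseteq> W" using assms(2) by auto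
  have "A (map ?P (y # ys)) = (\<Sum>i<k. A (cscale (c i y) (e i) # map ?P ys))"
    using form_sum[OF Cons.prems(1) P, of "{..<k}" "\<lambda>i. cscale (c i y) (e i)"] assms(2) n m by simp
  also have "\<dots> = (\<Sum>i<k. c i y * A (e i # map ?P ys))"
    using form_scale[OF Cons.prems(1) _ P] assms(2) n m by simp
  also have "\<dots> = (\<Sum>i<k. c i y *
      (\<Sum>is\<in>index_lists k m. A (e i # map e is) * (\<Prod>i<m. c (is ! i) (ys ! i))))"
    using Cons.IH[OF sym_multilinear_Cons[OF Cons.prems(1) assms(2) n] assms(2) m] by simp
  also have "\<dots> = (\<Sum>is\<in>index_lists k n. A (map e is) * (\<Prod>i<n. c (is ! i) ((y # ys) ! i)))"
    by (simp add: n sum_index_lists_Suc prod.lessThan_Suc_shift sum_distrib_left mult_ac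
        del: prod.lessThan_Suc)
  finally show ?case .
qed simp

section \<open>Taylor coefficients of entire functions bounded on bounded sets\<close>

text \<open>The error depends on \<open>g\<close> only through its bound on the disc of radius \<open>2\<close>, which is what makes
  difference quotients of a whole family of functions converge uniformly.\<close>

lemma difference_quotient_bound:
  assumes hol: "g holomorphic_on UNIV" and K: "\<And>z. cmod z \<le> 2 \<Longrightarrow> cmod (g z) \<le> K"
    and h: "h \<noteq> 0" "cmod h \<le> 1"
  shows "cmod ((g h - g 0) / h - deriv g 0) \<le> 2 * K * cmod h"
proof -
  have hold: "(deriv ^^ i) g holomorphic_on UNIV" for i
    using hol by (intro holomorphic_higher_deriv) auto
  have 2: "cmod ((deriv ^^ 2) g x) \<le> 2 * K" if "x \<in> cball 0 1" for x
  proof -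
    have "cmod (g y) \<le> K" if "cmod (x - y) = 1" for y
      using that \<open>x \<in> cball 0 1\<close> norm_triangle_ineq4[of x "x - y"] by (intro K) auto
    then have "cmod ((deriv ^^ 2) g x) \<le> fact 2 * K / 1 ^ 2"
      using hol by (intro Cauchy_inequality holomorphic_on_imp_continuous_on)
        (auto intro: holomorphic_on_subset)
    then show ?thesis by (simp add: fact_2)
  qed
  have "cmod ((deriv ^^ 0) g h - (\<Sum>i\<le>1. (deriv ^^ i) g 0 * (h - 0) ^ i / fact i))
      \<le> 2 * K * cmod (h - 0) ^ Suc 1 / fact 1"
  proof (rule complex_Taylor[where S = "cball 0 1" and f = "\<lambda>i. (deriv ^^ i) g"])
    show "((deriv ^^ i) g has_field_derivative (deriv ^^ Suc i) g x) (at x within cball 0 1)" for i x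
      using holomorphic_derivI[OF hold open_UNIV, of x i "cball 0 1"] by simp
  qed (use 2 h in \<open>auto simp: numeral_2_eq_2\<close>)
  then have "cmod (g h - g 0 - deriv g 0 * h) \<le> 2 * K * (cmod h)\<^sup>2"
    by (simp add: power2_eq_square algebra_simps)
  moreover have "(g h - g 0) / h - deriv g 0 = (g h - g 0 - deriv g 0 * h) / h"
    using h by (simp add: field_simps)
  ultimately show ?thesis
    using h by (simp add: norm_divide field_simps power2_eq_square)
qed

context complex_seminormed
begin

text \<open>Holomorphy is demanded on complex lines only; the bounds on bounded sets supply the uniformity
  that links different lines.\<close>

definition entire_bounded :: "('a \<times> 'a \<Rightarrow> complex) \<Rightarrow> bool" where
  "entire_bounded G \<longleftrightarrow>
     (\<forall>\<xi>\<in>W. \<forall>\<eta>\<in>W. (\<lambda>z. G (cscale z \<xi> + \<eta>)) holomorphic_on UNIV) \<and>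
     (\<forall>R. \<exists>K. \<forall>\<xi>\<in>W. N \<xi> \<le> R \<longrightarrow> cmod (G \<xi>) \<le> K)"

definition dir_deriv :: "'a \<times> 'a \<Rightarrow> ('a \<times> 'a \<Rightarrow> complex) \<Rightarrow> 'a \<times> 'a \<Rightarrow> complex" where
  "dir_deriv \<xi> G \<eta> = deriv (\<lambda>z. G (cscale z \<xi> + \<eta>)) 0"

lemma entire_boundedD:
  assumes "entire_bounded G" "\<xi> \<in> W" "\<eta> \<in> W"
  shows "(\<lambda>z. G (cscale z \<xi> + \<eta>)) holomorphic_on UNIV"
  using assms unfolding entire_bounded_def by blast

lemma entire_bounded_bound:
  assumes "entire_bounded G"
  obtains K where "\<And>\<xi>. \<xi> \<in> W \<Longrightarrow> N \<xi> \<le> R \<Longrightarrow> cmod (G \<xi>) \<le> K"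
  using assms unfolding entire_bounded_def by meson

lemma N_line_le: "\<xi> \<in> W \<Longrightarrow> \<eta> \<in> W \<Longrightarrow> N (cscale z \<xi> + \<eta>) \<le> cmod z * N \<xi> + N \<eta>"
  using N_triangle[of "cscale z \<xi>" \<eta>] N_scale[of \<xi> z] by simp

lemma difference_quotient_uniform:
  assumes G: "entire_bounded G" and \<xi>: "\<xi> \<in> W"
  obtains K where "0 \<le> K" "\<And>\<eta> h. \<eta> \<in> W \<Longrightarrow> N \<eta> \<le> R \<Longrightarrow> h \<noteq> 0 \<Longrightarrow> cmod h \<le> 1 \<Longrightarrow>
    cmod ((G (cscale h \<xi> + \<eta>) - G \<eta>) / h - dir_deriv \<xi> G \<eta>) \<le> K * cmod h"
proof -
  obtain K where K: "\<And>\<eta>. \<eta> \<in> W \<Longrightarrow> N \<eta> \<le> 2 * N \<xi> + R \<Longrightarrow> cmod (G \<eta>) \<le> K"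
    using entire_bounded_bound[OF G] by blast
  have *: "cmod ((G (cscale h \<xi> + \<eta>) - G \<eta>) / h - dir_deriv \<xi> G \<eta>) \<le> 2 * max K 0 * cmod h"
    if "\<eta> \<in> W" "N \<eta> \<le> R" "h \<noteq> 0" "cmod h \<le> 1" for \<eta> h
  proof -
    have "cmod (G (cscale z \<xi> + \<eta>)) \<le> max K 0" if "cmod z \<le> 2" for z
    proof -
      have "N (cscale z \<xi> + \<eta>) \<le> 2 * N \<xi> + R"
        using N_line_le[OF \<xi> \<open>\<eta> \<in> W\<close>, of z] mult_right_mono[OF that N_nonneg[OF \<xi>]] \<open>N \<eta> \<le> R\<close>
        by linarith
      then show ?thesis using K[of "cscale z \<xi> + \<eta>"] \<xi> \<open>\<eta> \<in> W\<close> by simp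
    qed
    from difference_quotient_bound[OF entire_boundedD[OF G \<xi> that(1)] this that(3,4)]
    show ?thesis by (simp add: dir_deriv_def cscale_simps)
  qed
  show ?thesis by (rule that[of "2 * max K 0"]) (use * in auto)
qed

lemma difference_quotients_line_uniform_limit:
  assumes G: "entire_bounded G" and mem: "\<xi> \<in> W" "\<zeta> \<in> W" "\<eta> \<in> W"
  defines "h \<equiv> \<lambda>n. complex_of_real (1 / real (Suc n))"
  shows "uniform_limit (ball 0 R)
    (\<lambda>n z. (G (cscale (h n) \<xi> + (cscale z \<zeta> + \<eta>)) - G (cscale z \<zeta> + \<eta>)) / h n)
    (\<lambda>z. dir_deriv \<xi> G (cscale z \<zeta> + \<eta>)) sequentially"
proof -
  have h: "h n \<noteq> 0" "cmod (h n) \<le> 1" "cmod (h n) = 1 / real (Suc n)" for n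
    unfolding h_def norm_of_real by (simp_all del: of_nat_Suc)
  obtain K where K: "0 \<le> K" "\<And>\<eta>' h. \<eta>' \<in> W \<Longrightarrow> N \<eta>' \<le> R * N \<zeta> + N \<eta> \<Longrightarrow> h \<noteq> 0 \<Longrightarrow> cmod h \<le> 1 \<Longrightarrow>
    cmod ((G (cscale h \<xi> + \<eta>') - G \<eta>') / h - dir_deriv \<xi> G \<eta>') \<le> K * cmod h"
    using difference_quotient_uniform[OF G mem(1)] by blast
  have b: "cmod ((G (cscale (h n) \<xi> + (cscale z \<zeta> + \<eta>)) - G (cscale z \<zeta> + \<eta>)) / h n
      - dir_deriv \<xi> G (cscale z \<zeta> + \<eta>)) \<le> K * (1 / real (Suc n))" if "z \<in> ball 0 R" for z n
  proof -
    have "cmod z \<le> R" using that by simp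
    have "N (cscale z \<zeta> + \<eta>) \<le> R * N \<zeta> + N \<eta>"
      using N_line_le[OF mem(2) mem(3), of z] mult_right_mono[OF \<open>cmod z \<le> R\<close> N_nonneg[OF mem(2)]] by linarith
    with K(2)[of "cscale z \<zeta> + \<eta>" "h n"] h[of n] mem show ?thesis by simp
  qed
  show ?thesis
  proof (rule uniform_limitI)
    fix \<epsilon> :: real assume "0 < \<epsilon>"
    have "(\<lambda>n. K * (1 / real (Suc n))) \<longlonglongrightarrow> K * 0"
      by (intro tendsto_intros LIMSEQ_Suc[OF lim_inverse_n'])
    then have "\<forall>\<^sub>F n in sequentially. K * (1 / real (Suc n)) < \<epsilon>"
      using order_tendstoD(2) \<open>0 < \<epsilon>\<close> by fastforce
    then show "\<forall>\<^sub>F n in sequentially. \<forall>z\<in>ball 0 R.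
        dist ((G (cscale (h n) \<xi> + (cscale z \<zeta> + \<eta>)) - G (cscale z \<zeta> + \<eta>)) / h n)
          (dir_deriv \<xi> G (cscale z \<zeta> + \<eta>)) < \<epsilon>"
      by eventually_elim (use b in \<open>unfold dist_norm, meson order_le_less_trans\<close>)
  qed
qed

lemma difference_quotient_tendsto:
  assumes G: "entire_bounded G" and mem: "\<xi> \<in> W" "\<eta> \<in> W"
  shows "(\<lambda>n. (G (cscale (complex_of_real (1 / real (Suc n))) \<xi> + \<eta>) - G \<eta>)
      / complex_of_real (1 / real (Suc n))) \<longlonglongrightarrow> dir_deriv \<xi> G \<eta>"
  using tendsto_uniform_limitI[OF difference_quotients_line_uniform_limit[OF G mem(1) zero_mem mem(2), of 1], of 0]
  by (simp add: cscale_simps)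

lemma translate_holomorphic:
  assumes G: "entire_bounded G" and mem: "\<xi> \<in> W" "\<zeta> \<in> W" "\<eta> \<in> W"
  shows "(\<lambda>z. G (cscale h \<xi> + (cscale z \<zeta> + \<eta>))) holomorphic_on UNIV"
  using entire_boundedD[OF G mem(2), of "cscale h \<xi> + \<eta>"] mem by (simp add: add_ac)

text \<open>On each line the derivative is a locally uniform limit of holomorphic difference quotients, and
  Cauchy's inequality on the unit circle bounds it.\<close>

lemma entire_bounded_dir_deriv:
  assumes G: "entire_bounded G" and \<xi>: "\<xi> \<in> W"
  shows "entire_bounded (dir_deriv \<xi> G)"
  unfolding entire_bounded_def
proof (intro conjI ballI allI)
  fix \<zeta> \<eta> assume mem: "\<zeta> \<in> W" "\<eta> \<in> W"
  let ?h = "\<lambda>n. complex_of_real (1 / real (Suc n))"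
  show "(\<lambda>z. dir_deriv \<xi> G (cscale z \<zeta> + \<eta>)) holomorphic_on UNIV"
  proof (rule holomorphic_uniform_sequence)
    show "(\<lambda>z. (G (cscale (?h n) \<xi> + (cscale z \<zeta> + \<eta>)) - G (cscale z \<zeta> + \<eta>)) / ?h n)
        holomorphic_on UNIV" for n
      by (intro holomorphic_intros translate_holomorphic[OF G \<xi> mem] entire_boundedD[OF G mem]) simp
    fix x :: complex
    show "\<exists>d>0. cball x d \<subseteq> UNIV \<and> uniform_limit (cball x d)
        (\<lambda>n z. (G (cscale (?h n) \<xi> + (cscale z \<zeta> + \<eta>)) - G (cscale z \<zeta> + \<eta>)) / ?h n)
        (\<lambda>z. dir_deriv \<xi> G (cscale z \<zeta> + \<eta>)) sequentially"
    proof (intro exI[of _ 1] conjI)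
      have sub: "cball x 1 \<subseteq> ball 0 (cmod x + 2)"
        by (auto simp: dist_norm) (smt (verit) norm_minus_commute norm_triangle_sub)
      show "uniform_limit (cball x 1)
          (\<lambda>n z. (G (cscale (?h n) \<xi> + (cscale z \<zeta> + \<eta>)) - G (cscale z \<zeta> + \<eta>)) / ?h n)
          (\<lambda>z. dir_deriv \<xi> G (cscale z \<zeta> + \<eta>)) sequentially"
        by (rule uniform_limit_on_subset[OF difference_quotients_line_uniform_limit[OF G \<xi> mem] sub])
    qed auto
  qed simp
next
  fix R
  obtain K where K: "\<And>\<eta>. \<eta> \<in> W \<Longrightarrow> N \<eta> \<le> N \<xi> + R \<Longrightarrow> cmod (G \<eta>) \<le> K"
    using entire_bounded_bound[OF G] by blast
  have "cmod (dir_deriv \<xi> G \<eta>) \<le> K" if \<eta>: "\<eta> \<in> W" "N \<eta> \<le> R" for \<eta>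
  proof -
    have "cmod (G (cscale z \<xi> + \<eta>)) \<le> K" if "cmod z = 1" for z
      using K[of "cscale z \<xi> + \<eta>"] N_line_le[OF \<xi> \<eta>(1), of z] that \<eta> \<xi> by simp
    then have "cmod ((deriv ^^ 1) (\<lambda>z. G (cscale z \<xi> + \<eta>)) 0) \<le> fact 1 * K / 1 ^ 1"
      using entire_boundedD[OF G \<xi> \<eta>(1)]
      by (intro Cauchy_inequality holomorphic_on_imp_continuous_on)
        (auto intro: holomorphic_on_subset)
    then show ?thesis by (simp add: dir_deriv_def)
  qed
  then show "\<exists>K. \<forall>\<eta>\<in>W. N \<eta> \<le> R \<longrightarrow> cmod (dir_deriv \<xi> G \<eta>) \<le> K" by blast
qed

text \<open>Difference quotients in direction \<open>\<xi>\<close> commute with the derivative in direction \<open>\<zeta>\<close>, and their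
  uniform convergence permits differentiating the limit.\<close>

lemma dir_deriv_commute:
  assumes G: "entire_bounded G" and mem: "\<xi> \<in> W" "\<zeta> \<in> W" "\<eta> \<in> W"
  shows "dir_deriv \<zeta> (dir_deriv \<xi> G) \<eta> = dir_deriv \<xi> (dir_deriv \<zeta> G) \<eta>"
proof -
  let ?h = "\<lambda>n. complex_of_real (1 / real (Suc n))"
  let ?q = "\<lambda>n z. (G (cscale (?h n) \<xi> + (cscale z \<zeta> + \<eta>)) - G (cscale z \<zeta> + \<eta>)) / ?h n"
  have hol: "(\<lambda>z. G (cscale (?h n) \<xi> + (cscale z \<zeta> + \<eta>))) holomorphic_on UNIV"
    "(\<lambda>z. G (cscale z \<zeta> + \<eta>)) holomorphic_on UNIV" for n
    using translate_holomorphic[OF G mem] entire_boundedD[OF G mem(2) mem(3)] by auto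
  have "(\<lambda>n. (deriv ^^ 1) (?q n) 0) \<longlonglongrightarrow> (deriv ^^ 1) (\<lambda>z. dir_deriv \<xi> G (cscale z \<zeta> + \<eta>)) 0"
  proof (rule higher_deriv_complex_uniform_limit[OF difference_quotients_line_uniform_limit[OF G mem]])
    show "\<forall>\<^sub>F n in sequentially. ?q n holomorphic_on ball 0 1"
      by (intro always_eventually allI holomorphic_intros holomorphic_on_subset[OF hol(1)]
          holomorphic_on_subset[OF hol(2)]) auto
  qed auto
  moreover have "(deriv ^^ 1) (?q n) 0
      = (dir_deriv \<zeta> G (cscale (?h n) \<xi> + \<eta>) - dir_deriv \<zeta> G \<eta>) / ?h n" for n
  proof -
    have "deriv (?q n) 0 = (deriv (\<lambda>z. G (cscale (?h n) \<xi> + (cscale z \<zeta> + \<eta>))) 0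
        - deriv (\<lambda>z. G (cscale z \<zeta> + \<eta>)) 0) / ?h n"
    proof -
      have "(\<lambda>z. G (cscale (?h n) \<xi> + (cscale z \<zeta> + \<eta>))) field_differentiable at 0"
        "(\<lambda>z. G (cscale z \<zeta> + \<eta>)) field_differentiable at 0"
        using hol(1)[of n] hol(2) by (auto intro: holomorphic_on_imp_differentiable_at[where s = UNIV])
      then show ?thesis
        by (subst deriv_cdivide_right) (auto intro: field_differentiable_diff simp: deriv_diff)
    qed
    then show ?thesis by (simp add: dir_deriv_def add_ac)
  qed
  ultimately have "(\<lambda>n. (dir_deriv \<zeta> G (cscale (?h n) \<xi> + \<eta>) - dir_deriv \<zeta> G \<eta>) / ?h n)
      \<longlonglongrightarrow> dir_deriv \<zeta> (dir_deriv \<xi> G) \<eta>"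
    by (simp add: dir_deriv_def)
  from LIMSEQ_unique[OF this
      difference_quotient_tendsto[OF entire_bounded_dir_deriv[OF G mem(2)] mem(1) mem(3)]]
  show ?thesis .
qed

text \<open>A step along \<open>\<xi> + \<zeta>\<close> is a step along \<open>\<xi>\<close> followed by one along \<open>\<zeta>\<close> from the moving base
  point \<open>h \<xi> + \<eta>\<close>. The second difference quotient is uniformly close to the derivative at that
  point, which is continuous along the line.\<close>

lemma dir_deriv_add:
  assumes G: "entire_bounded G" and mem: "\<xi> \<in> W" "\<zeta> \<in> W" "\<eta> \<in> W"
  shows "dir_deriv (\<xi> + \<zeta>) G \<eta> = dir_deriv \<xi> G \<eta> + dir_deriv \<zeta> G \<eta>"
proof -
  let ?h = "\<lambda>n. complex_of_real (1 / real (Suc n))"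
  have h: "?h n \<noteq> 0" "cmod (?h n) \<le> 1" for n
    unfolding norm_of_real by (simp_all del: of_nat_Suc)
  have h0: "?h \<longlonglongrightarrow> 0"
    using tendsto_of_real[OF LIMSEQ_Suc[OF lim_inverse_n']] by (simp only: of_real_0)
  obtain K where K: "0 \<le> K" "\<And>\<eta>' h. \<eta>' \<in> W \<Longrightarrow> N \<eta>' \<le> N \<xi> + N \<eta> \<Longrightarrow> h \<noteq> 0 \<Longrightarrow> cmod h \<le> 1 \<Longrightarrow>
    cmod ((G (cscale h \<zeta> + \<eta>') - G \<eta>') / h - dir_deriv \<zeta> G \<eta>') \<le> K * cmod h"
    using difference_quotient_uniform[OF G mem(2)] by blast
  let ?p = "\<lambda>n. cscale (?h n) \<xi> + \<eta>"
  let ?q = "\<lambda>n. (G (cscale (?h n) \<zeta> + ?p n) - G (?p n)) / ?h n"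
  have "(\<lambda>n. ?q n - dir_deriv \<zeta> G (?p n)) \<longlonglongrightarrow> 0"
  proof (rule Lim_null_comparison)
    have "cmod (?q n - dir_deriv \<zeta> G (?p n)) \<le> K * cmod (?h n)" for n
    proof (rule K(2))
      show "N (?p n) \<le> N \<xi> + N \<eta>"
        using N_line_le[OF mem(1,3), of "?h n"] mult_right_mono[OF h(2) N_nonneg[OF mem(1)], of n]
        by linarith
    qed (use h[of n] mem in auto)
    then show "\<forall>\<^sub>F n in sequentially. norm (?q n - dir_deriv \<zeta> G (?p n)) \<le> K * cmod (?h n)" by simp
    show "(\<lambda>n. K * cmod (?h n)) \<longlonglongrightarrow> 0"
      using tendsto_mult_right_zero[OF tendsto_norm_zero[OF h0]] by simp
  qed
  moreover have "(\<lambda>n. dir_deriv \<zeta> G (?p n)) \<longlonglongrightarrow> dir_deriv \<zeta> G (cscale 0 \<xi> + \<eta>)"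
  proof -
    have "isCont (\<lambda>z. dir_deriv \<zeta> G (cscale z \<xi> + \<eta>)) 0"
      using holomorphic_on_imp_continuous_on[OF entire_boundedD[OF entire_bounded_dir_deriv[OF G mem(2)] mem(1) mem(3)]]
      by (simp add: continuous_on_eq_continuous_at)
    from isCont_tendsto_compose[OF this h0] show ?thesis .
  qed
  ultimately have q: "?q \<longlonglongrightarrow> 0 + dir_deriv \<zeta> G (cscale 0 \<xi> + \<eta>)"
    using tendsto_add by fastforce
  have "(\<lambda>n. (G (?p n) - G \<eta>) / ?h n + ?q n) \<longlonglongrightarrow> dir_deriv \<xi> G \<eta> + dir_deriv \<zeta> G \<eta>"
    using tendsto_add[OF difference_quotient_tendsto[OF G mem(1) mem(3)] q] by (simp add: cscale_simps)
  moreover have "(G (?p n) - G \<eta>) / ?h n + ?q n = (G (cscale (?h n) (\<xi> + \<zeta>) + \<eta>) - G \<eta>) / ?h n" for n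
    by (simp only: cscale_simps add_ac add_divide_distrib[symmetric]) (simp add: algebra_simps)
  ultimately have "(\<lambda>n. (G (cscale (?h n) (\<xi> + \<zeta>) + \<eta>) - G \<eta>) / ?h n)
      \<longlonglongrightarrow> dir_deriv \<xi> G \<eta> + dir_deriv \<zeta> G \<eta>" by simp
  from LIMSEQ_unique[OF difference_quotient_tendsto[OF G _ mem(3)] this] mem show ?thesis by simp
qed

lemma dir_deriv_scale:
  assumes G: "entire_bounded G" and mem: "\<xi> \<in> W" "\<eta> \<in> W"
  shows "dir_deriv (cscale c \<xi>) G \<eta> = c * dir_deriv \<xi> G \<eta>"
proof -
  let ?g = "\<lambda>z. G (cscale z \<xi> + \<eta>)"
  have "(?g has_field_derivative dir_deriv \<xi> G \<eta>) (at (0 * c))"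
    using holomorphic_derivI[OF entire_boundedD[OF G mem] open_UNIV, of 0]
    by (simp add: dir_deriv_def)
  moreover have "((\<lambda>z. z * c) has_field_derivative c) (at 0)"
    by (auto intro!: derivative_eq_intros)
  ultimately have "((\<lambda>z. ?g (z * c)) has_field_derivative dir_deriv \<xi> G \<eta> * c) (at 0)"
    by (rule DERIV_chain2)
  then show ?thesis
    unfolding dir_deriv_def[of "cscale c \<xi>"] by (simp add: cscale_simps DERIV_imp_deriv mult.commute)
qed

lemma dir_deriv_cong:
  assumes "\<And>\<eta>. \<eta> \<in> W \<Longrightarrow> G \<eta> = G' \<eta>" "\<xi> \<in> W" "\<eta> \<in> W"
  shows "dir_deriv \<xi> G \<eta> = dir_deriv \<xi> G' \<eta>"
  using assms by (simp add: dir_deriv_def)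

lemma entire_bounded_foldr:
  "entire_bounded G \<Longrightarrow> set xs \<subseteq> W \<Longrightarrow> entire_bounded (foldr dir_deriv xs G)"
  by (induction xs) (auto intro: entire_bounded_dir_deriv)

lemma foldr_dir_deriv_move:
  assumes G: "entire_bounded G" "set xs \<subseteq> W" "x \<in> W" "set ys \<subseteq> W" "\<eta> \<in> W"
  shows "foldr dir_deriv (xs @ x # ys) G \<eta> = foldr dir_deriv (x # xs @ ys) G \<eta>"
  using assms
proof (induction xs arbitrary: \<eta>)
  case (Cons a xs)
  have "foldr dir_deriv ((a # xs) @ x # ys) G \<eta>
      = dir_deriv a (foldr dir_deriv (x # xs @ ys) G) \<eta>"
    using dir_deriv_cong[of "foldr dir_deriv (xs @ x # ys) G" _ a \<eta>] Cons by simp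
  also have "\<dots> = dir_deriv x (dir_deriv a (foldr dir_deriv (xs @ ys) G)) \<eta>"
    using dir_deriv_commute[OF entire_bounded_foldr[OF G(1)], of "xs @ ys" x a \<eta>] Cons.prems by simp
  finally show ?case by simp
qed simp

lemma foldr_dir_deriv_perm:
  assumes G: "entire_bounded G"
  shows "set xs \<subseteq> W \<Longrightarrow> mset xs = mset ys \<Longrightarrow> \<eta> \<in> W \<Longrightarrow>
    foldr dir_deriv xs G \<eta> = foldr dir_deriv ys G \<eta>"
proof (induction xs arbitrary: ys \<eta>)
  case (Cons x xs)
  have "x \<in> set ys" using Cons.prems(2) by (metis list.set_intros(1) mset_eq_setD)
  then obtain ys1 ys2 where ys: "ys = ys1 @ x # ys2" by (meson split_list)
  have W: "set ys \<subseteq> W" using Cons.prems(1,2) by (metis mset_eq_setD)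
  have "foldr dir_deriv (x # xs) G \<eta> = foldr dir_deriv (x # ys1 @ ys2) G \<eta>"
    using dir_deriv_cong[of "foldr dir_deriv xs G" "foldr dir_deriv (ys1 @ ys2) G" x \<eta>]
      Cons.IH[of "ys1 @ ys2"] Cons.prems ys by simp
  also have "\<dots> = foldr dir_deriv ys G \<eta>"
    using foldr_dir_deriv_move[OF G, of ys1 x ys2 \<eta>] W Cons.prems ys by simp
  finally show ?case .
qed simp

text \<open>The polar form of the \<open>n\<close>-th homogeneous Taylor polynomial of \<open>G\<close> at \<open>0\<close>.\<close>

definition taylor_form :: "('a \<times> 'a \<Rightarrow> complex) \<Rightarrow> nat \<Rightarrow> ('a \<times> 'a) list \<Rightarrow> complex" where
  "taylor_form G n xs = foldr dir_deriv xs G 0 / fact n"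

lemma sym_multilinear_taylor_form:
  assumes G: "entire_bounded G"
  shows "sym_multilinear n (taylor_form G n)"
  unfolding sym_multilinear_def taylor_form_def
  using foldr_dir_deriv_perm[OF G] dir_deriv_add[OF entire_bounded_foldr[OF G]]
    dir_deriv_scale[OF entire_bounded_foldr[OF G]]
  by (auto simp: add_divide_distrib)

lemma foldr_dir_deriv_replicate:
  assumes \<xi>: "\<xi> \<in> W"
  shows "foldr dir_deriv (replicate n \<xi>) G (cscale z \<xi>) = (deriv ^^ n) (\<lambda>z. G (cscale z \<xi>)) z"
proof (induction n arbitrary: z)
  case (Suc n)
  have "foldr dir_deriv (replicate (Suc n) \<xi>) G (cscale z \<xi>)
      = deriv (\<lambda>w. (deriv ^^ n) (\<lambda>z. G (cscale z \<xi>)) (w + z)) 0"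
    unfolding replicate_Suc foldr.simps o_apply dir_deriv_def[of \<xi> "foldr _ _ _"]
      cscale_simps(2)[symmetric] Suc ..
  also have "\<dots> = deriv ((deriv ^^ n) (\<lambda>z. G (cscale z \<xi>))) z"
    by (simp add: deriv_shift_0[of _ z] o_def add.commute)
  finally show ?case by simp
qed simp

lemma taylor_form_replicate:
  "\<xi> \<in> W \<Longrightarrow> taylor_form G n (replicate n \<xi>) = (deriv ^^ n) (\<lambda>z. G (cscale z \<xi>)) 0 / fact n"
  using foldr_dir_deriv_replicate[of \<xi> n G 0] by (simp add: taylor_form_def cscale_simps)

end

section \<open>Complexified inner products\<close>

lemma dense_wrtD: "dense_wrt g D V \<Longrightarrow> x \<in> V \<Longrightarrow> 0 < \<epsilon> \<Longrightarrow> \<exists>d\<in>D. nrm g (x - d) < \<epsilon>"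
  by (simp add: dense_wrt_def)

context inner_space
begin

lemma bil_linear:
  assumes "x \<in> V \<times> V" "y \<in> V \<times> V" "z \<in> V \<times> V"
  shows "bil g (x + y) z = bil g x z + bil g y z" "bil g z (x + y) = bil g z x + bil g z y"
    "bil g (cscale c x) z = c * bil g x z" "bil g z (cscale c x) = c * bil g z x"
  using assms
  by (auto simp: bil_def cscale_def linear_simps complex_eq_iff algebra_simps)

lemma cnrm_eq: "(a, b) \<in> V \<times> V \<Longrightarrow> cnrm g (a, b) = sqrt (g a a + g b b)"
  by (simp add: cnrm_def herm_def bil_def cconj_def linear_simps)

lemma nrm_le_cnrm: "(a, b) \<in> V \<times> V \<Longrightarrow> nrm g a \<le> cnrm g (a, b) \<and> nrm g b \<le> cnrm g (a, b)"
  by (simp add: cnrm_eq nrm_def)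

text \<open>A vector near \<open>x\<close> in the span of finitely many basis vectors is no closer to \<open>x\<close> than the
  Fourier sum over any larger finite set \<open>B1\<close>. One set \<open>B0\<close> thus serves all larger ones, so finitely
  many vectors can share a single \<open>B1\<close>.\<close>

lemma orthonormal_basis_approx:
  assumes B: "orthonormal_basis V g B" and x: "x \<in> V" and \<epsilon>: "0 < \<epsilon>"
  obtains B0 where "finite B0" "B0 \<subseteq> B"
    "\<And>B1. finite B1 \<Longrightarrow> B0 \<subseteq> B1 \<Longrightarrow> B1 \<subseteq> B \<Longrightarrow> g x x \<le> (\<Sum>b\<in>B1. (g b x)\<^sup>2) + \<epsilon>"
proof -
  have BV: "B \<subseteq> V" and orth: "\<And>b c. b \<in> B \<Longrightarrow> c \<in> B \<Longrightarrow> g b c = (if b = c then 1 else 0)"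
    and dense: "dense_wrt g (span B) V"
    using B unfolding orthonormal_basis_def by auto
  obtain y where y: "y \<in> span B" "nrm g (x - y) < sqrt \<epsilon>"
    using dense_wrtD[OF dense x, of "sqrt \<epsilon>"] \<epsilon> by auto
  obtain B0 c where B0: "finite B0" "B0 \<subseteq> B" and yc: "y = (\<Sum>b\<in>B0. c b *\<^sub>R b)"
    using y(1) unfolding span_explicit by blast
  have "g x x \<le> (\<Sum>b\<in>B1. (g b x)\<^sup>2) + \<epsilon>" if B1: "finite B1" "B0 \<subseteq> B1" "B1 \<subseteq> B" for B1
  proof -
    define d where "d b = (if b \<in> B0 then c b else 0)" for b
    have V: "b \<in> V" if "b \<in> B1" for b using that B1 BV by auto
    have yd: "y = (\<Sum>b\<in>B1. d b *\<^sub>R b)"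
      unfolding yc d_def using B1 by (intro sum.mono_neutral_cong_left) auto
    have yV: "y \<in> V" unfolding yd using V by simp
    have gby: "g b y = d b" if "b \<in> B1" for b
    proof -
      have "g b y = (\<Sum>b'\<in>B1. if b' = b then d b else 0)"
        unfolding yd using V that orth B1(3)
        by (subst sum_right) (auto intro!: sum.cong simp: scale_right subset_iff)
      then show ?thesis using that B1(1) by simp
    qed
    have gyz: "g y z = (\<Sum>b\<in>B1. d b * g b z)" if "z \<in> V" for z
      unfolding yd using V that by (simp add: sum_left scale_left)
    have "g (x - y) (x - y) = g x x - 2 * g y x + g y y"
      using x yV commute[OF x yV] by (simp add: linear_simps)
    also have "\<dots> = g x x - (\<Sum>b\<in>B1. (g b x)\<^sup>2) + (\<Sum>b\<in>B1. (g b x - d b)\<^sup>2)"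
      using gby by (simp add: gyz x yV power2_diff sum.distrib sum_subtractf sum_distrib_left
          power2_eq_square algebra_simps)
    finally have "g x x - (\<Sum>b\<in>B1. (g b x)\<^sup>2) \<le> g (x - y) (x - y)"
      using sum_nonneg[of B1 "\<lambda>b. (g b x - d b)\<^sup>2"] by simp
    also have "\<dots> = (nrm g (x - y))\<^sup>2" using x yV by (simp add: nrm_power2)
    also have "\<dots> \<le> (sqrt \<epsilon>)\<^sup>2"
      using y(2) x yV by (intro power_mono) auto
    finally show ?thesis using \<epsilon> by simp
  qed
  with B0 that show ?thesis by blast
qed

end

section \<open>The dual norm and Riesz representatives\<close>

locale nuclear =
  fixes E :: "'a::real_vector set" and H :: "nat \<Rightarrow> 'a set" and ip :: "nat \<Rightarrow> 'a \<Rightarrow> 'a \<Rightarrow> real"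
  assumes nuclear_space: "nuclear_space E H ip"
begin

lemma completion: "is_completion E (H p) (ip p)"
  using nuclear_space unfolding nuclear_space_def by blast

sublocale sp: inner_space "H p" "ip p" for p
  using completion[of p] by unfold_locales (simp add: is_completion_def)

lemma subspace_E: "subspace E"
  using completion[of 0] by (simp add: is_completion_def)

lemma E_closed [simp]:
  "0 \<in> E" "x \<in> E \<Longrightarrow> y \<in> E \<Longrightarrow> x + y \<in> E" "x \<in> E \<Longrightarrow> y \<in> E \<Longrightarrow> x - y \<in> E"
  "x \<in> E \<Longrightarrow> c *\<^sub>R x \<in> E" "(\<And>i. i \<in> I \<Longrightarrow> f i \<in> E) \<Longrightarrow> (\<Sum>i\<in>I. f i) \<in> E"
  using subspace_E
  by (auto intro: subspace_0 subspace_add subspace_diff subspace_scale subspace_sum)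

lemma E_H [simp]: "x \<in> E \<Longrightarrow> x \<in> H p"
  using completion[of p] unfolding is_completion_def dense_wrt_def by blast

lemma E_dense: "dense_wrt (ip p) E (H p)"
  using completion[of p] by (simp add: is_completion_def)

lemma complete: "complete_wrt (ip p) (H p)"
  using completion[of p] by (simp add: is_completion_def)

lemma H_antimono: "q \<le> p \<Longrightarrow> x \<in> H p \<Longrightarrow> x \<in> H q"
proof (induction p rule: dec_induct)
  case (step p)
  then show ?case using nuclear_space unfolding nuclear_space_def by blast
qed

lemma H_0: "x \<in> H p \<Longrightarrow> x \<in> H 0"
  by (rule H_antimono[OF le0])

lemma inclusion_bounded:
  assumes "q \<le> p"
  obtains C where "0 \<le> C" "\<And>x. x \<in> H p \<Longrightarrow> nrm (ip q) x \<le> C * nrm (ip p) x"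
proof -
  have "\<exists>C\<ge>0. \<forall>x\<in>H p. nrm (ip q) x \<le> C * nrm (ip p) x"
    using assms
  proof (induction p rule: dec_induct)
    case base
    show ?case by (rule exI[of _ 1]) simp
  next
    case (step p)
    obtain C where C: "0 \<le> C" "\<And>x. x \<in> H p \<Longrightarrow> nrm (ip q) x \<le> C * nrm (ip p) x"
      using step.IH by blast
    obtain C' where C': "\<And>x. x \<in> H (Suc p) \<Longrightarrow> nrm (ip p) x \<le> C' * nrm (ip (Suc p)) x"
      using nuclear_space unfolding nuclear_space_def by meson
    have "nrm (ip q) x \<le> (C * \<bar>C'\<bar>) * nrm (ip (Suc p)) x" if x: "x \<in> H (Suc p)" for x
    proof -
      have "nrm (ip q) x \<le> C * nrm (ip p) x" using C(2) H_antimono[OF le_SucI[OF order_refl] x] .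
      also have "\<dots> \<le> C * (C' * nrm (ip (Suc p)) x)"
        using C(1) C'[OF x] by (rule mult_left_mono[rotated])
      also have "\<dots> \<le> C * (\<bar>C'\<bar> * nrm (ip (Suc p)) x)"
        using C(1) x by (intro mult_left_mono mult_right_mono) auto
      finally show ?thesis by (simp add: mult.assoc)
    qed
    moreover have "0 \<le> C * \<bar>C'\<bar>" using C(1) by simp
    ultimately show ?case by blast
  qed
  then show ?thesis using that by blast
qed

lemma orthogonal_extends_to_closure:
  assumes D: "dense_wrt (ip p) D (H p)" and z: "z \<in> H 0" "\<And>d. d \<in> D \<Longrightarrow> ip 0 d z = 0"
    and x: "x \<in> H p"
  shows "ip 0 x z = 0"
proof -
  obtain C where C: "0 \<le> C" "\<And>x. x \<in> H p \<Longrightarrow> nrm (ip 0) x \<le> C * nrm (ip p) x"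
    using inclusion_bounded[OF le0] by blast
  have "\<bar>ip 0 x z\<bar> \<le> 0 + \<epsilon>" if \<epsilon>: "0 < \<epsilon>" for \<epsilon>
  proof -
    define c where "c = C * nrm (ip 0) z + 1"
    have c: "0 < c" using C(1) z(1) by (simp add: c_def add_nonneg_pos)
    obtain d where d: "d \<in> D" "nrm (ip p) (x - d) < \<epsilon> / c"
      using dense_wrtD[OF D x divide_pos_pos[OF \<epsilon> c]] by blast
    have dH: "d \<in> H p" using D d(1) unfolding dense_wrt_def by blast
    have "\<bar>ip 0 x z\<bar> = \<bar>ip 0 (x - d) z\<bar>"
      using z d(1) H_0[OF x] H_0[OF dH] by (simp add: sp.diff_left)
    also have "\<dots> \<le> nrm (ip 0) (x - d) * nrm (ip 0) z"
      using H_0[OF x] H_0[OF dH] z by (intro sp.Cauchy_Schwarz) auto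
    also have "\<dots> \<le> (C * nrm (ip p) (x - d)) * nrm (ip 0) z"
      using x dH z by (intro mult_right_mono C(2)) auto
    also have "\<dots> \<le> c * nrm (ip p) (x - d)"
      using x dH z by (simp add: c_def algebra_simps)
    also have "\<dots> \<le> c * (\<epsilon> / c)" using d(2) c by (intro mult_left_mono) auto
    finally show ?thesis using c by simp
  qed
  then have "\<bar>ip 0 x z\<bar> \<le> 0" by (rule field_le_epsilon)
  then show ?thesis by simp
qed

lemma orthogonal_E_imp_zero:
  assumes "z \<in> H 0" "\<And>d. d \<in> E \<Longrightarrow> ip 0 d z = 0"
  shows "z = 0"
  using orthogonal_extends_to_closure[OF E_dense assms assms(1)] assms(1) sp.eq_zero_iff by blast

text \<open>\<open>rep q y\<close> is the vector of \<open>H q\<close> that represents the functional \<open>\<langle>y, \<cdot>\<rangle>\<close> of the pivot space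
  \<open>H 0\<close>. It carries \<open>E\<close> with the dual norm isometrically into \<open>H q\<close>.\<close>

definition rep :: "nat \<Rightarrow> 'a \<Rightarrow> 'a" where
  "rep q y = (SOME t. t \<in> H q \<and> (\<forall>x\<in>H q. ip q t x = ip 0 y x))"

lemma rep:
  assumes y: "y \<in> H 0"
  shows "rep q y \<in> H q" "x \<in> H q \<Longrightarrow> ip q (rep q y) x = ip 0 y x"
proof -
  obtain C where C: "0 \<le> C" "\<And>x. x \<in> H q \<Longrightarrow> nrm (ip 0) x \<le> C * nrm (ip q) x"
    using inclusion_bounded[OF le0] by blast
  obtain t where "t \<in> H q" "\<And>x. x \<in> H q \<Longrightarrow> ip q t x = ip 0 y x"
  proof (rule sp.Riesz_representation[OF complete])
    show "\<bar>ip 0 y x\<bar> \<le> (nrm (ip 0) y * C) * nrm (ip q) x" if "x \<in> H q" for x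
    proof -
      have "\<bar>ip 0 y x\<bar> \<le> nrm (ip 0) y * nrm (ip 0) x" using sp.Cauchy_Schwarz y H_0[OF that] by auto
      also have "\<dots> \<le> nrm (ip 0) y * (C * nrm (ip q) x)"
        using y by (intro mult_left_mono C(2) that) auto
      finally show ?thesis by (simp add: mult.assoc)
    qed
  qed (use y H_0 in \<open>auto simp: sp.add_right sp.scale_right\<close>)
  then have "rep q y \<in> H q \<and> (\<forall>x\<in>H q. ip q (rep q y) x = ip 0 y x)"
    unfolding rep_def by (rule someI[where x = t, OF conjI[OF _ ballI]])
  then show "rep q y \<in> H q" "x \<in> H q \<Longrightarrow> ip q (rep q y) x = ip 0 y x" by auto
qed

lemma dual_nrm_set_bdd:
  assumes "\<xi> \<in> H 0 \<times> H 0"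
  shows "bdd_above {cmod (bil (ip 0) \<xi> \<eta>) | \<eta>. \<eta> \<in> H p \<times> H p \<and> cnrm (ip p) \<eta> \<le> 1}"
proof -
  obtain a b where ab: "\<xi> = (a, b)" "a \<in> H 0" "b \<in> H 0" using assms by auto
  obtain C where C: "0 \<le> C" "\<And>x. x \<in> H p \<Longrightarrow> nrm (ip 0) x \<le> C * nrm (ip p) x"
    using inclusion_bounded[OF le0] by blast
  have *: "\<bar>ip 0 x y\<bar> \<le> nrm (ip 0) x * C" if "x \<in> H 0" "y \<in> H p" "nrm (ip p) y \<le> 1" for x y
  proof -
    have "\<bar>ip 0 x y\<bar> \<le> nrm (ip 0) x * nrm (ip 0) y" using sp.Cauchy_Schwarz that H_0 by blast
    also have "\<dots> \<le> nrm (ip 0) x * (C * nrm (ip p) y)"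
      using that by (intro mult_left_mono C(2)) auto
    also have "\<dots> \<le> nrm (ip 0) x * (C * 1)"
      using that C(1) by (intro mult_left_mono) auto
    finally show ?thesis by simp
  qed
  have "cmod (bil (ip 0) \<xi> \<eta>) \<le> 2 * C * (nrm (ip 0) a + nrm (ip 0) b)"
    if \<eta>: "\<eta> \<in> H p \<times> H p" "cnrm (ip p) \<eta> \<le> 1" for \<eta>
  proof -
    obtain c d where cd: "\<eta> = (c, d)" "c \<in> H p" "d \<in> H p" using \<eta> by auto
    then have n: "nrm (ip p) c \<le> 1" "nrm (ip p) d \<le> 1" using sp.nrm_le_cnrm[of c d p] \<eta> by auto
    have "cmod (bil (ip 0) \<xi> \<eta>) \<le> \<bar>ip 0 a c - ip 0 b d\<bar> + \<bar>ip 0 a d + ip 0 b c\<bar>"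
      using cmod_le[of "bil (ip 0) \<xi> \<eta>"] by (simp add: bil_def ab cd)
    also have "\<dots> \<le> 2 * C * (nrm (ip 0) a + nrm (ip 0) b)"
      using *[OF ab(2) cd(2) n(1)] *[OF ab(2) cd(3) n(2)] *[OF ab(3) cd(2) n(1)] *[OF ab(3) cd(3) n(2)]
      by (simp add: algebra_simps)
    finally show ?thesis .
  qed
  then show ?thesis by (auto intro!: bdd_aboveI)
qed

lemma dual_nrm_upper:
  assumes "\<xi> \<in> H 0 \<times> H 0" "\<eta> \<in> H p \<times> H p" "cnrm (ip p) \<eta> \<le> 1"
  shows "cmod (bil (ip 0) \<xi> \<eta>) \<le> dual_nrm H ip p \<xi>"
  unfolding dual_nrm_def using assms by (intro cSup_upper dual_nrm_set_bdd) auto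

lemma dual_nrm_least:
  assumes "\<And>\<eta>. \<eta> \<in> H p \<times> H p \<Longrightarrow> cnrm (ip p) \<eta> \<le> 1 \<Longrightarrow> cmod (bil (ip 0) \<xi> \<eta>) \<le> M"
  shows "dual_nrm H ip p \<xi> \<le> M"
proof -
  have "(0, 0) \<in> H p \<times> H p \<and> cnrm (ip p) (0, 0) \<le> 1" by (simp add: sp.cnrm_eq)
  then show ?thesis
    unfolding dual_nrm_def using assms by (intro cSup_least) blast+
qed

lemma dual_nrm_nonneg: "\<xi> \<in> H 0 \<times> H 0 \<Longrightarrow> 0 \<le> dual_nrm H ip p \<xi>"
  by (rule order_trans[OF norm_ge_zero dual_nrm_upper[of \<xi> "(0, 0)"]]) (auto simp: sp.cnrm_eq)

lemma dual_nrm_scale_le: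
  assumes \<xi>: "\<xi> \<in> H 0 \<times> H 0"
  shows "dual_nrm H ip p (cscale z \<xi>) \<le> cmod z * dual_nrm H ip p \<xi>"
proof (rule dual_nrm_least)
  fix \<eta> assume \<eta>: "\<eta> \<in> H p \<times> H p" "cnrm (ip p) \<eta> \<le> 1"
  have "\<eta> \<in> H 0 \<times> H 0" using \<eta> H_0 by auto
  then have "cmod (bil (ip 0) (cscale z \<xi>) \<eta>) = cmod z * cmod (bil (ip 0) \<xi> \<eta>)"
    using sp.bil_linear(3)[of \<xi> 0 0 \<eta>] \<xi> by (simp add: sp.bil_linear(3)[of \<xi> 0 \<xi>] norm_mult)
  also have "\<dots> \<le> cmod z * dual_nrm H ip p \<xi>"
    using dual_nrm_upper[OF \<xi> \<eta>] by (rule mult_left_mono) simp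
  finally show "cmod (bil (ip 0) (cscale z \<xi>) \<eta>) \<le> cmod z * dual_nrm H ip p \<xi>" .
qed

lemma dual_nrm_scale:
  assumes \<xi>: "\<xi> \<in> H 0 \<times> H 0"
  shows "dual_nrm H ip p (cscale z \<xi>) = cmod z * dual_nrm H ip p \<xi>"
proof (rule antisym[OF dual_nrm_scale_le[OF \<xi>]])
  have z\<xi>: "cscale z \<xi> \<in> H 0 \<times> H 0" using \<xi> by (auto simp: cscale_def)
  show "cmod z * dual_nrm H ip p \<xi> \<le> dual_nrm H ip p (cscale z \<xi>)"
  proof (cases "z = 0")
    case False
    then have "dual_nrm H ip p \<xi> = dual_nrm H ip p (cscale (1 / z) (cscale z \<xi>))"
      by (simp add: cscale_simps)
    also have "\<dots> \<le> cmod (1 / z) * dual_nrm H ip p (cscale z \<xi>)"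
      by (rule dual_nrm_scale_le[OF z\<xi>])
    finally show ?thesis using False by (simp add: norm_divide field_simps)
  qed (use dual_nrm_nonneg[OF z\<xi>] in simp)
qed

lemma dual_nrm_triangle:
  assumes "\<xi> \<in> H 0 \<times> H 0" "\<zeta> \<in> H 0 \<times> H 0"
  shows "dual_nrm H ip p (\<xi> + \<zeta>) \<le> dual_nrm H ip p \<xi> + dual_nrm H ip p \<zeta>"
proof (rule dual_nrm_least)
  fix \<eta> assume \<eta>: "\<eta> \<in> H p \<times> H p" "cnrm (ip p) \<eta> \<le> 1"
  then have "\<eta> \<in> H 0 \<times> H 0" using H_0 by auto
  then have "bil (ip 0) (\<xi> + \<zeta>) \<eta> = bil (ip 0) \<xi> \<eta> + bil (ip 0) \<zeta> \<eta>"
    using assms by (intro sp.bil_linear) auto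
  then show "cmod (bil (ip 0) (\<xi> + \<zeta>) \<eta>) \<le> dual_nrm H ip p \<xi> + dual_nrm H ip p \<zeta>"
    using norm_triangle_ineq[of "bil (ip 0) \<xi> \<eta>" "bil (ip 0) \<zeta> \<eta>"]
      dual_nrm_upper[OF assms(1) \<eta>] dual_nrm_upper[OF assms(2) \<eta>] by simp
qed

text \<open>For a real vector the supremum over the complex unit ball is already controlled by real test
  vectors, since the real and the imaginary part of \<open>\<eta>\<close> contribute orthogonally.\<close>

lemma dual_nrm_real_le:
  assumes x: "x \<in> H 0" and M: "0 \<le> M" and le: "\<And>y. y \<in> H p \<Longrightarrow> \<bar>ip 0 x y\<bar> \<le> M * nrm (ip p) y"
  shows "dual_nrm H ip p (x, 0) \<le> M"
proof (rule dual_nrm_least)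
  fix \<eta> assume \<eta>: "\<eta> \<in> H p \<times> H p" "cnrm (ip p) \<eta> \<le> 1"
  then obtain c d where cd: "\<eta> = (c, d)" "c \<in> H p" "d \<in> H p" by auto
  have sq: "(ip 0 x y)\<^sup>2 \<le> M\<^sup>2 * ip p y y" if "y \<in> H p" for y
  proof -
    have "\<bar>ip 0 x y\<bar>\<^sup>2 \<le> (M * nrm (ip p) y)\<^sup>2" using le[OF that] by (intro power_mono) auto
    then show ?thesis using that by (simp add: power_mult_distrib sp.nrm_power2)
  qed
  have "cmod (bil (ip 0) (x, 0) \<eta>) = sqrt ((ip 0 x c)\<^sup>2 + (ip 0 x d)\<^sup>2)"
    using cd H_0[OF cd(2)] H_0[OF cd(3)] by (simp add: bil_def cmod_def)
  also have "\<dots> \<le> sqrt (M\<^sup>2 * (ip p c c + ip p d d))"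
    using sq[OF cd(2)] sq[OF cd(3)] by (intro real_sqrt_le_mono) (simp add: algebra_simps)
  also have "\<dots> = M * cnrm (ip p) \<eta>"
    using M cd by (simp add: real_sqrt_mult sp.cnrm_eq)
  also have "\<dots> \<le> M" using M \<eta>(2) mult_left_le by blast
  finally show "cmod (bil (ip 0) (x, 0) \<eta>) \<le> M" .
qed

lemma dual_nrm_real_le_rep: "x \<in> H 0 \<Longrightarrow> dual_nrm H ip p (x, 0) \<le> nrm (ip p) (rep p x)"
  using rep(1)[of x p] rep(2)[of x _ p] sp.Cauchy_Schwarz[where p = p and x = "rep p x"]
  by (intro dual_nrm_real_le) auto

sublocale complexified: complex_seminormed "E \<times> E" "dual_nrm H ip p" for p
proof
  show "cscale c x \<in> E \<times> E" if "x \<in> E \<times> E" for c x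
    using that by (auto simp: cscale_def)
  have sub: "E \<times> E \<subseteq> H 0 \<times> H 0" by auto
  show "0 \<le> dual_nrm H ip p x" if "x \<in> E \<times> E" for x
    using dual_nrm_nonneg that sub by blast
  show "dual_nrm H ip p (x + y) \<le> dual_nrm H ip p x + dual_nrm H ip p y"
    if "x \<in> E \<times> E" "y \<in> E \<times> E" for x y
    using dual_nrm_triangle that sub by blast
  show "dual_nrm H ip p (cscale c x) = cmod c * dual_nrm H ip p x" if "x \<in> E \<times> E" for c x
    using dual_nrm_scale that sub by blast
qed (auto simp: zero_prod_def)

lemma dual_nrm_eq_zero:
  assumes \<xi>: "\<xi> \<in> E \<times> E" and 0: "dual_nrm H ip p \<xi> = 0"
  shows "\<xi> = 0"
proof -
  obtain a b where ab: "\<xi> = (a, b)" "a \<in> E" "b \<in> E" using \<xi> by auto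
  have *: "ip 0 a c = 0 \<and> ip 0 b c = 0" if c: "c \<in> E" for c
  proof -
    define r where "r = 1 / (nrm (ip p) c + 1)"
    have np: "0 < nrm (ip p) c + 1" using c by (simp add: add_nonneg_pos)
    then have r: "0 < r" "r * nrm (ip p) c \<le> 1" by (auto simp: r_def field_simps)
    have "cnrm (ip p) (r *\<^sub>R c, 0) = r * nrm (ip p) c"
      using c r(1) by (simp add: sp.cnrm_eq sp.linear_simps nrm_def real_sqrt_mult
          power2_eq_square[symmetric] mult.assoc[symmetric])
    then have "cmod (bil (ip 0) \<xi> (r *\<^sub>R c, 0)) \<le> 0"
      using dual_nrm_upper[of \<xi> "(r *\<^sub>R c, 0)" p] c r ab 0 by simp
    then show ?thesis
      using c ab r(1) by (simp add: bil_def sp.linear_simps complex_eq_iff)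
  qed
  have "a = 0" "b = 0"
    using * ab sp.commute by (auto intro!: orthogonal_E_imp_zero)
  then show ?thesis using ab by (simp add: zero_prod_def)
qed

text \<open>A basis of \<open>H p\<close> whose vectors have square summable norms in \<open>H q\<close> is countable, so \<open>E\<close> is
  separable.\<close>

lemma total_sequence:
  assumes hs: "hilbert_schmidt (H p) (ip p) (H q) (ip q) (\<lambda>x. x)"
  shows "\<exists>d :: nat \<Rightarrow> 'a. (\<forall>n. d n \<in> E) \<and> (\<forall>z\<in>H 0. (\<forall>n. ip 0 (d n) z = 0) \<longrightarrow> z = 0)"
proof -
  obtain B where B: "orthonormal_basis (H p) (ip p) B" "(\<lambda>b. (nrm (ip q) b)\<^sup>2) summable_on B"
    and into: "\<And>x. x \<in> H p \<Longrightarrow> x \<in> H q"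
    using hs unfolding hilbert_schmidt_def by blast
  have BH: "B \<subseteq> H p" and dense: "dense_wrt (ip p) (span B) (H p)"
    using B(1) unfolding orthonormal_basis_def by auto
  have "(nrm (ip q) b)\<^sup>2 \<noteq> 0" if "b \<in> B" for b
  proof -
    have bH: "b \<in> H p" "b \<in> H q" using that BH into by auto
    have "ip p b b = 1" using B(1) \<open>b \<in> B\<close> unfolding orthonormal_basis_def by auto
    then have "b \<noteq> 0" using sp.zero_left[OF bH(1)] by auto
    then show ?thesis using sp.eq_zero_iff[OF bH(2)] sp.nrm_power2[OF bH(2)] by metis
  qed
  then have "{b \<in> B. (nrm (ip q) b)\<^sup>2 \<noteq> 0} = B" by auto
  then have cB: "countable B"
    using summable_countable_real[OF B(2)] by simp
  have "\<forall>b\<in>B. \<forall>k::nat. \<exists>e\<in>E. nrm (ip p) (b - e) < 1 / real (Suc k)"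
    using dense_wrtD[OF E_dense[of p]] BH by (metis divide_pos_pos of_nat_0_less_iff
        subsetD zero_less_Suc zero_less_one)
  then obtain e where e: "\<And>b k. b \<in> B \<Longrightarrow> e b k \<in> E"
    "\<And>b k. b \<in> B \<Longrightarrow> nrm (ip p) (b - e b k) < 1 / real (Suc k)" by metis
  define D where "D = insert 0 ((\<lambda>(b, k). e b k) ` (B \<times> (UNIV :: nat set)))"
  have cD: "countable D" unfolding D_def using cB by simp
  have DE: "D \<subseteq> E" unfolding D_def using e by auto
  have total: "z = 0" if z: "z \<in> H 0" "\<And>d. d \<in> D \<Longrightarrow> ip 0 d z = 0" for z
  proof -
    have b0: "ip 0 b z = 0" if b: "b \<in> B" for b
    proof -
      have bH: "b \<in> H p" using b BH by blast
      obtain C where C: "0 \<le> C" "\<And>x. x \<in> H p \<Longrightarrow> nrm (ip 0) x \<le> C * nrm (ip p) x"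
        using inclusion_bounded[OF le0] by blast
      have "\<bar>ip 0 b z\<bar> \<le> C * (1 / real (Suc k)) * nrm (ip 0) z" for k
      proof -
        have "ip 0 (e b k) z = 0" using z(2) b unfolding D_def by auto
        then have "\<bar>ip 0 b z\<bar> = \<bar>ip 0 (b - e b k) z\<bar>"
          using z(1) H_0[OF bH] e(1)[OF b] by (simp add: sp.diff_left)
        also have "\<dots> \<le> nrm (ip 0) (b - e b k) * nrm (ip 0) z"
          using z(1) H_0[OF bH] e(1)[OF b] by (intro sp.Cauchy_Schwarz) auto
        also have "\<dots> \<le> C * nrm (ip p) (b - e b k) * nrm (ip 0) z"
          using z(1) bH e(1)[OF b] by (intro mult_right_mono C(2)) auto
        also have "\<dots> \<le> C * (1 / real (Suc k)) * nrm (ip 0) z"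
          using z(1) C(1) e(2)[OF b, of k] by (intro mult_right_mono mult_left_mono) auto
        finally show ?thesis .
      qed
      moreover have "(\<lambda>k. C * (1 / real (Suc k)) * nrm (ip 0) z) \<longlonglongrightarrow> C * 0 * nrm (ip 0) z"
        by (intro tendsto_intros LIMSEQ_Suc[OF lim_inverse_n'])
      ultimately have "\<bar>ip 0 b z\<bar> \<le> C * 0 * nrm (ip 0) z"
        by (intro LIMSEQ_le_const) auto
      then show ?thesis by simp
    qed
    have "ip 0 y z = 0" if y: "y \<in> span B" for y
    proof -
      obtain t c where t: "finite t" "t \<subseteq> B" "y = (\<Sum>b\<in>t. c b *\<^sub>R b)"
        using y unfolding span_explicit by blast
      have "b \<in> H 0" if "b \<in> t" for b using that t(2) BH H_0 by blast
      then show ?thesis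
        using t b0 z(1) by (auto simp: sp.sum_left sp.scale_left subset_iff intro!: sum.neutral)
    qed
    then have "ip 0 x z = 0" if "x \<in> H p" for x
      using orthogonal_extends_to_closure[OF dense z(1) _ that] by blast
    then show "z = 0" using z(1) by (intro orthogonal_E_imp_zero) auto
  qed
  have range: "range (from_nat_into D) = D"
    using cD by (intro range_from_nat_into) (auto simp: D_def)
  show ?thesis
  proof (intro exI[of _ "from_nat_into D"] conjI allI ballI impI)
    show "from_nat_into D n \<in> E" for n using range DE by blast
    show "z = 0" if "z \<in> H 0" "\<forall>n. ip 0 (from_nat_into D n) z = 0" for z
      using that total range by (metis rangeE)
  qed
qed

end

section \<open>Orthonormal bases of the dual space inside the nuclear space\<close>

text \<open>Apart from zeros, the vectors \<open>e j\<close> form an orthonormal basis of the dual of \<open>H q\<close>, whose inner product is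
  \<open>\<langle>x, y\<rangle>\<^sub>-\<^sub>q = \<langle>rep q x, rep q y\<rangle>\<^sub>q\<close>. They lie in \<open>E\<close>, so that functions on the complexification of
  \<open>E\<close> and their Taylor forms can be evaluated on them.\<close>

locale dual_basis = nuclear +
  fixes q :: nat and e :: "nat \<Rightarrow> 'a"
  assumes e_mem [simp]: "e j \<in> E"
    and orthonormal: "orthonormal_or_zero (ip q) (\<lambda>j. rep q (e j))"
    and total: "z \<in> H q \<Longrightarrow> (\<And>j. ip q (rep q (e j)) z = 0) \<Longrightarrow> z = 0"

text \<open>\<open>E\<close> is not complete for the dual inner product, so a maximal orthonormal family need not be
  total. Gram-Schmidt applied to a total sequence keeps its span and therefore stays total.\<close>

lemma (in nuclear) dual_basis_exists:
  assumes hs: "hilbert_schmidt (H p) (ip p) (H q) (ip q) (\<lambda>x. x)"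
  obtains e where "dual_basis E H ip q e"
proof -
  define b where "b x y = ip q (rep q x) (rep q y)" for x y
  have b: "b x y = ip 0 x (rep q y)" if "x \<in> E" "y \<in> E" for x y
    unfolding b_def using that rep by simp
  interpret dual: inner_space E b
  proof
    have sym: "b x y = b y x" if "x \<in> E" "y \<in> E" for x y
      unfolding b_def using that rep(1) by (intro sp.commute) auto
    have add: "b (x + y) z = b x z + b y z" if "x \<in> E" "y \<in> E" "z \<in> E" for x y z
    proof -
      have "rep q z \<in> H 0" using H_0[OF rep(1)[of z q]] that by simp
      then show ?thesis using that by (simp add: b sp.add_left)
    qed
    have scale: "b (c *\<^sub>R x) y = c * b x y" if "x \<in> E" "y \<in> E" for c x y
    proof -
      have "rep q y \<in> H 0" using H_0[OF rep(1)[of y q]] that by simp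
      then show ?thesis using that by (simp add: b sp.scale_left)
    qed
    have pos: "0 < b x x" if x: "x \<in> E" "x \<noteq> 0" for x
    proof -
      have "rep q x \<noteq> 0"
      proof
        assume "rep q x = 0"
        then have "ip 0 x x = 0" using rep(2)[of x x q] x by simp
        then show False using x sp.eq_zero_iff[where p = 0 and x = x] by simp
      qed
      then show ?thesis unfolding b_def using rep(1)[of x q] x by (intro sp.pos) auto
    qed
    show "inner_product_on E b"
      unfolding inner_product_on_def using subspace_E sym add scale pos by auto
  qed
  obtain d :: "nat \<Rightarrow> 'a" where d: "\<And>n. d n \<in> E" "\<And>z. z \<in> H 0 \<Longrightarrow> (\<And>n. ip 0 (d n) z = 0) \<Longrightarrow> z = 0"
    using total_sequence[OF hs] by metis
  obtain e where e: "\<And>n. e n \<in> E" "orthonormal_or_zero b e" "\<And>n. d n \<in> span (range e)"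
    using dual.Gram_Schmidt[of d] d(1) by metis
  have "dual_basis E H ip q e"
  proof
    show "e j \<in> E" for j by (rule e)
    have "rep q 0 = 0"
      using sp.eq_zero_iff[OF rep(1)[of 0 q]] rep(2)[of 0 "rep q 0" q] rep(1)[of 0 q]
        sp.zero_left[OF H_0[OF rep(1)[of 0 q]]] by simp
    then show "orthonormal_or_zero (ip q) (\<lambda>j. rep q (e j))"
      using e(2) unfolding orthonormal_or_zero_def b_def by metis
    fix z assume z: "z \<in> H q" "\<And>j. ip q (rep q (e j)) z = 0"
    have ez: "ip 0 (e j) z = 0" for j using H_0[OF z(1)] z rep(2)[of "e j" z q] e(1) by simp
    have "ip 0 (d n) z = 0" for n
    proof -
      obtain t c where t: "finite t" "t \<subseteq> range e" "d n = (\<Sum>v\<in>t. c v *\<^sub>R v)"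
        using e(3)[of n] unfolding span_explicit by blast
      then have "v \<in> E \<and> ip 0 v z = 0" if "v \<in> t" for v using that ez e(1) by auto
      then show ?thesis
        unfolding t(3) using H_0[OF z(1)] by (simp add: sp.sum_left sp.scale_left)
    qed
    then show "z = 0" using d(2) H_0[OF z(1)] by simp
  qed
  then show ?thesis by (rule that)
qed

context dual_basis
begin

definition h :: "nat \<Rightarrow> 'a" where "h j = rep q (e j)"

lemma h_mem [simp]: "h j \<in> H q"
  unfolding h_def by (rule rep) simp

lemma h_mem_0 [simp]: "h j \<in> H 0"
  by (rule H_0[OF h_mem])

lemma h_inner: "x \<in> H q \<Longrightarrow> ip q (h j) x = ip 0 (e j) x"
  unfolding h_def by (rule rep) simp_all

lemma orthonormal_h: "orthonormal_or_zero (ip q) h"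
  using orthonormal unfolding h_def[abs_def] .

lemma h_zero_imp: "h j = 0 \<Longrightarrow> e j = 0"
  using h_inner[of "e j" j] sp.eq_zero_iff[where p = 0 and x = "e j"] by simp

lemma Parseval:
  assumes "x \<in> H q"
  shows "(\<lambda>j. (ip 0 (e j) x)\<^sup>2) sums ip q x x"
    and "(\<lambda>k. nrm (ip q) (x - (\<Sum>i<k. ip q (h i) x *\<^sub>R h i))) \<longlonglongrightarrow> 0"
  using sp.Parseval_of_total[OF complete h_mem orthonormal_h assms] total assms
  by (auto simp: h_inner h_def[symmetric])

lemma Parseval_inner:
  assumes x: "x \<in> H q" and y: "y \<in> H q"
  shows "(\<lambda>j. ip 0 (e j) x * ip 0 (e j) y) sums ip q x y"
proof -
  have "(\<lambda>j. ((ip 0 (e j) (x + y))\<^sup>2 - (ip 0 (e j) (x - y))\<^sup>2) / 4) sums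
      ((ip q (x + y) (x + y) - ip q (x - y) (x - y)) / 4)"
    using x y by (intro sums_divide sums_diff Parseval sp.closed)
  moreover have "((ip 0 (e j) (x + y))\<^sup>2 - (ip 0 (e j) (x - y))\<^sup>2) / 4 = ip 0 (e j) x * ip 0 (e j) y" for j
    using H_0[OF x] H_0[OF y] by (simp add: sp.linear_simps power2_eq_square algebra_simps)
  moreover have "(ip q (x + y) (x + y) - ip q (x - y) (x - y)) / 4 = ip q x y"
    using x y sp.commute[OF x y] by (simp add: sp.linear_simps)
  ultimately show ?thesis by simp
qed

text \<open>The Hilbert-Schmidt norm of \<open>H p \<rightarrow> H q\<close> bounds that of the adjoint inclusion of the dual
  spaces, evaluated on the basis \<open>e\<close>: interchange the two sums in
  \<open>\<Sum>\<^sub>j |e\<^sub>j|\<^sub>-\<^sub>p\<^sup>2 = \<Sum>\<^sub>j \<Sum>\<^sub>b \<langle>e\<^sub>j, b\<rangle>\<^sup>2 = \<Sum>\<^sub>b |b|\<^sub>q\<^sup>2\<close>.\<close>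

lemma sum_dual_nrm_le_hs_norm:
  assumes hs: "hilbert_schmidt (H p) (ip p) (H q) (ip q) (\<lambda>x. x)"
  shows "(\<Sum>j<k. (dual_nrm H ip p (e j, 0))\<^sup>2) \<le> (hs_norm (H p) (ip p) (ip q) (\<lambda>x. x))\<^sup>2"
proof -
  let ?P = "\<lambda>B. orthonormal_basis (H p) (ip p) B \<and> (\<lambda>b. (nrm (ip q) b)\<^sup>2) summable_on B"
  define B where "B = (SOME B. ?P B)"
  have "\<exists>B. ?P B" using hs unfolding hilbert_schmidt_def by blast
  then have B: "orthonormal_basis (H p) (ip p) B" "(\<lambda>b. (nrm (ip q) b)\<^sup>2) summable_on B"
    using someI_ex[of ?P] unfolding B_def by blast+
  have BH: "B \<subseteq> H p" using B(1) unfolding orthonormal_basis_def by auto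
  have into: "x \<in> H q" if "x \<in> H p" for x using hs that unfolding hilbert_schmidt_def by blast
  define S where "S = (\<Sum>\<^sub>\<infinity>b\<in>B. (nrm (ip q) b)\<^sup>2)"
  have S: "(hs_norm (H p) (ip p) (ip q) (\<lambda>x. x))\<^sup>2 = S"
    unfolding hs_norm_def B_def[symmetric] Let_def S_def
    by (simp add: infsum_nonneg)
  have "(\<Sum>j<k. (dual_nrm H ip p (e j, 0))\<^sup>2) \<le> S + \<epsilon>" if \<epsilon>: "0 < \<epsilon>" for \<epsilon>
  proof -
    define \<delta> where "\<delta> = \<epsilon> / real (Suc k)"
    have \<delta>: "0 < \<delta>" "real k * \<delta> \<le> \<epsilon>" using \<epsilon> by (auto simp: \<delta>_def field_simps)
    define w where "w j = rep p (e j)" for j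
    have w: "w j \<in> H p" "\<And>x. x \<in> H p \<Longrightarrow> ip p (w j) x = ip 0 (e j) x" for j
      unfolding w_def using rep by auto
    have "\<exists>B0. finite B0 \<and> B0 \<subseteq> B \<and> (\<forall>B1. finite B1 \<longrightarrow> B0 \<subseteq> B1 \<longrightarrow> B1 \<subseteq> B \<longrightarrow>
        ip p (w j) (w j) \<le> (\<Sum>b\<in>B1. (ip p b (w j))\<^sup>2) + \<delta>)" for j
      using sp.orthonormal_basis_approx[OF B(1) w(1) \<delta>(1)] by metis
    then obtain B0 where B0: "\<And>j. finite (B0 j)" "\<And>j. B0 j \<subseteq> B"
      "\<And>j B1. finite B1 \<Longrightarrow> B0 j \<subseteq> B1 \<Longrightarrow> B1 \<subseteq> B \<Longrightarrow>
        ip p (w j) (w j) \<le> (\<Sum>b\<in>B1. (ip p b (w j))\<^sup>2) + \<delta>" by metis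
    define B1 where "B1 = (\<Union>j<k. B0 j)"
    have B1: "finite B1" "B1 \<subseteq> B" unfolding B1_def using B0(1,2) by auto
    have "(dual_nrm H ip p (e j, 0))\<^sup>2 \<le> (\<Sum>b\<in>B1. (ip 0 (e j) b)\<^sup>2) + \<delta>" if "j < k" for j
    proof -
      have "(dual_nrm H ip p (e j, 0))\<^sup>2 \<le> (nrm (ip p) (w j))\<^sup>2"
        unfolding w_def by (intro power_mono dual_nrm_real_le_rep dual_nrm_nonneg) auto
      also have "\<dots> = ip p (w j) (w j)" using w(1) by (simp add: sp.nrm_power2)
      also have "\<dots> \<le> (\<Sum>b\<in>B1. (ip p b (w j))\<^sup>2) + \<delta>"
        using B1 that by (intro B0(3)) (auto simp: B1_def)
      also have "(\<Sum>b\<in>B1. (ip p b (w j))\<^sup>2) = (\<Sum>b\<in>B1. (ip 0 (e j) b)\<^sup>2)"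
      proof (rule sum.cong)
        fix b assume "b \<in> B1"
        then have "b \<in> H p" using B1 BH by blast
        then show "(ip p b (w j))\<^sup>2 = (ip 0 (e j) b)\<^sup>2" using w sp.commute by metis
      qed simp
      finally show ?thesis .
    qed
    then have "(\<Sum>j<k. (dual_nrm H ip p (e j, 0))\<^sup>2)
        \<le> (\<Sum>j<k. (\<Sum>b\<in>B1. (ip 0 (e j) b)\<^sup>2) + \<delta>)"
      by (intro sum_mono) auto
    also have "\<dots> = (\<Sum>b\<in>B1. \<Sum>j<k. (ip 0 (e j) b)\<^sup>2) + real k * \<delta>"
      by (simp add: sum.distrib sum.swap[of _ B1])
    also have "\<dots> \<le> (\<Sum>b\<in>B1. (nrm (ip q) b)\<^sup>2) + \<epsilon>"
    proof (intro add_mono sum_mono \<delta>(2))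
      fix b assume "b \<in> B1"
      then have b: "b \<in> H q" using B1 BH into by blast
      have "(\<Sum>j<k. (ip 0 (e j) b)\<^sup>2) \<le> (\<Sum>j. (ip 0 (e j) b)\<^sup>2)"
        using Parseval(1)[OF b] by (intro sum_le_suminf) (auto simp: sums_iff)
      then show "(\<Sum>j<k. (ip 0 (e j) b)\<^sup>2) \<le> (nrm (ip q) b)\<^sup>2"
        using Parseval(1)[OF b] b by (simp add: sums_iff sp.nrm_power2)
    qed
    also have "(\<Sum>b\<in>B1. (nrm (ip q) b)\<^sup>2) \<le> S"
      unfolding S_def using B(2) B1 by (intro finite_sum_le_infsum) auto
    finally show ?thesis by simp
  qed
  then show ?thesis unfolding S by (rule field_le_epsilon)
qed

text \<open>The orthogonal projection of the dual of \<open>H q\<close> onto the span of the first \<open>k\<close> basis vectors,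
  complexified and written with the pivot pairing, so that it makes sense on all of \<open>H 0 \<times> H 0\<close>.\<close>

definition proj :: "nat \<Rightarrow> 'a \<times> 'a \<Rightarrow> 'a \<times> 'a" where
  "proj k y = (\<Sum>i<k. cscale (bil (ip 0) (h i, 0) y) (e i, 0))"

lemma proj_mem [simp]: "proj k y \<in> E \<times> E"
  unfolding proj_def by (intro complexified.sum_mem complexified.scale_mem) simp

lemma proj_eq:
  assumes "a \<in> H 0" "b \<in> H 0"
  shows "proj k (a, b) = (\<Sum>i<k. ip 0 (h i) a *\<^sub>R e i, \<Sum>i<k. ip 0 (h i) b *\<^sub>R e i)"
  using assms by (simp add: proj_def bil_def cscale_def prod_eq_iff fst_sum snd_sum)

text \<open>Under \<open>rep q\<close> the error becomes the remainder of the Fourier series of \<open>rep q x\<close> in \<open>H q\<close>, and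
  the dual norm with index \<open>p\<close> is dominated by that with index \<open>q\<close>.\<close>

lemma proj_real_tendsto:
  assumes "q \<le> p" and x: "x \<in> E"
  shows "(\<lambda>k. dual_nrm H ip p ((\<Sum>i<k. ip 0 (h i) x *\<^sub>R e i) - x, 0)) \<longlonglongrightarrow> 0"
proof -
  obtain C where C: "0 \<le> C" "\<And>y. y \<in> H p \<Longrightarrow> nrm (ip q) y \<le> C * nrm (ip p) y"
    using inclusion_bounded[OF assms(1)] by blast
  define t where "t = rep q x"
  have t: "t \<in> H q" "\<And>y. y \<in> H q \<Longrightarrow> ip q t y = ip 0 x y" unfolding t_def using x rep by auto
  define r where "r k = t - (\<Sum>i<k. ip q (h i) t *\<^sub>R h i)" for k
  have rH: "r k \<in> H q" for k unfolding r_def using t by simp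
  have ht: "ip q (h i) t = ip 0 (h i) x" for i
    using t x sp.commute[where p = q and x = "h i" and y = t] sp.commute[where p = 0 and x = "h i" and y = x] by simp
  show ?thesis
  proof (rule Lim_null_comparison)
    show "(\<lambda>k. nrm (ip q) (r k) * C) \<longlonglongrightarrow> 0"
      using tendsto_mult_left_zero[OF Parseval(2)[OF t(1)]] unfolding r_def .
    have "dual_nrm H ip p ((\<Sum>i<k. ip 0 (h i) x *\<^sub>R e i) - x, 0) \<le> nrm (ip q) (r k) * C" for k
    proof (rule dual_nrm_real_le)
      fix y assume y: "y \<in> H p"
      have yq: "y \<in> H q" using H_antimono assms(1) y by blast
      have "ip 0 ((\<Sum>i<k. ip 0 (h i) x *\<^sub>R e i) - x) y = - ip q (r k) y"
        unfolding r_def using x H_0[OF y] yq t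
        by (simp add: sp.linear_simps sp.sum_left ht h_inner)
      then have "\<bar>ip 0 ((\<Sum>i<k. ip 0 (h i) x *\<^sub>R e i) - x) y\<bar> \<le> nrm (ip q) (r k) * nrm (ip q) y"
        using sp.Cauchy_Schwarz[OF rH yq] by simp
      also have "\<dots> \<le> nrm (ip q) (r k) * (C * nrm (ip p) y)"
        using C(2)[OF y] rH by (intro mult_left_mono) auto
      finally show "\<bar>ip 0 ((\<Sum>i<k. ip 0 (h i) x *\<^sub>R e i) - x) y\<bar> \<le> nrm (ip q) (r k) * C * nrm (ip p) y"
        by (simp add: mult.assoc)
    qed (use x C rH in auto)
    moreover have "0 \<le> dual_nrm H ip p ((\<Sum>i<k. ip 0 (h i) x *\<^sub>R e i) - x, 0)" for k
      using x by (intro dual_nrm_nonneg) auto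
    ultimately show "\<forall>\<^sub>F k in sequentially.
        norm (dual_nrm H ip p ((\<Sum>i<k. ip 0 (h i) x *\<^sub>R e i) - x, 0)) \<le> nrm (ip q) (r k) * C"
      by simp
  qed
qed

lemma proj_tendsto:
  assumes "q \<le> p" and y: "y \<in> E \<times> E"
  shows "(\<lambda>k. dual_nrm H ip p (proj k y - y)) \<longlonglongrightarrow> 0"
proof -
  obtain a b where ab: "y = (a, b)" "a \<in> E" "b \<in> E" using y by auto
  define r where "r x k = (\<Sum>i<k. ip 0 (h i) x *\<^sub>R e i) - x" for x k
  have rE: "r x k \<in> E" if "x \<in> E" for x k unfolding r_def using that by simp
  have split: "proj k y - y = (r a k, 0) + cscale \<i> (r b k, 0)" for k
    using ab by (simp add: proj_eq r_def cscale_def)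
  show ?thesis
  proof (rule Lim_null_comparison)
    have "dual_nrm H ip p (proj k y - y) \<le> dual_nrm H ip p (r a k, 0) + dual_nrm H ip p (r b k, 0)" for k
      unfolding split
      using complexified.N_triangle[where p = p and x = "(r a k, 0)" and y = "cscale \<i> (r b k, 0)"]
        complexified.N_scale[where p = p and x = "(r b k, 0)" and c = \<i>]
        complexified.scale_mem[where x = "(r b k, 0)" and c = \<i>] rE ab by simp
    then show "\<forall>\<^sub>F k in sequentially. norm (dual_nrm H ip p (proj k y - y))
        \<le> dual_nrm H ip p (r a k, 0) + dual_nrm H ip p (r b k, 0)"
      using complexified.N_nonneg[OF complexified.diff_mem[OF proj_mem y]] by simp
    show "(\<lambda>k. dual_nrm H ip p (r a k, 0) + dual_nrm H ip p (r b k, 0)) \<longlonglongrightarrow> 0"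
      using tendsto_add[OF proj_real_tendsto[OF assms(1) ab(2)] proj_real_tendsto[OF assms(1) ab(3)]]
      unfolding r_def by simp
  qed
qed

lemma proj_basis: "proj k (e j, 0) = (if j < k then (e j, 0) else 0)"
proof -
  have "ip 0 (h i) (e j) = (if i = j \<and> h j \<noteq> 0 then 1 else 0)" for i
  proof -
    have "ip 0 (h i) (e j) = ip q (h i) (h j)"
      using h_inner[of "h i" j] sp.commute[where p = q and x = "h i" and y = "h j"]
        sp.commute[where p = 0 and x = "h i" and y = "e j"]
        by simp
    then show ?thesis using orthonormal_h unfolding orthonormal_or_zero_def
      by (cases "h j = 0") auto
  qed
  then have "(\<Sum>i<k. ip 0 (h i) (e j) *\<^sub>R e i) = (\<Sum>i<k. if i = j then e j else 0)"
    using h_zero_imp by (intro sum.cong) auto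
  also have "\<dots> = (if j < k then e j else 0)" by simp
  finally show ?thesis by (simp add: proj_eq zero_prod_def)
qed

end

section \<open>Coordinates of tensors\<close>

lemma at_pair_simps [simp]:
  "at_pair g [] ys = 0"
  "at_pair g ((c, xs) # t) ys = c * (\<Prod>i<length xs. bil g (xs ! i) (ys ! i)) + at_pair g t ys"
  by (simp_all add: at_pair_def)

lemma at_pair_diff: "at_pair g (at_diff s t) ys = at_pair g s ys - at_pair g t ys"
proof -
  have "at_pair g (s @ t') ys = at_pair g s ys + at_pair g t' ys" for t'
    by (induction s) (auto simp: at_pair_def)
  moreover have "at_pair g (map (\<lambda>(c, xs). (- c, xs)) t) ys = - at_pair g t ys"
    by (induction t) (auto simp: at_pair_def)
  ultimately show ?thesis by (simp add: at_diff_def)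
qed

lemma alg_tensors_simps [simp]:
  "[] \<in> alg_tensors V n"
  "(c, xs) # t \<in> alg_tensors V n \<longleftrightarrow> length xs = n \<and> set xs \<subseteq> V \<times> V \<and> t \<in> alg_tensors V n"
  by (auto simp: alg_tensors_def)

lemma at_diff_alg_tensors:
  "s \<in> alg_tensors V n \<Longrightarrow> t \<in> alg_tensors V n \<Longrightarrow> at_diff s t \<in> alg_tensors V n"
  by (auto simp: alg_tensors_def at_diff_def)

lemma (in inner_space) at_pair_linear:
  assumes "t \<in> alg_tensors V n" "x \<in> V \<times> V" "y \<in> V \<times> V" "Suc (length zs) = n"
  shows "at_pair g t ((x + y) # zs) = at_pair g t (x # zs) + at_pair g t (y # zs) \<and>
    at_pair g t (cscale c x # zs) = c * at_pair g t (x # zs)"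
  using assms(1)
proof (induction t)
  case (Cons a t)
  obtain d xs where a: "a = (d, xs)" by fastforce
  have len: "length xs = Suc (length zs)" and xs0: "xs ! 0 \<in> V \<times> V"
    using Cons.prems a assms(4) nth_mem[of 0 xs] by auto
  have "at_pair g t ((x + y) # zs) = at_pair g t (x # zs) + at_pair g t (y # zs)"
    "at_pair g t (cscale c x # zs) = c * at_pair g t (x # zs)"
    using Cons a by auto
  then show ?case
    by (simp add: a len prod.lessThan_Suc_shift bil_linear[OF assms(2,3) xs0] algebra_simps
        del: prod.lessThan_Suc)
qed simp

context dual_basis
begin

definition es :: "nat list \<Rightarrow> ('a \<times> 'a) list" where
  "es is = map (\<lambda>i. (e i, 0)) is"

lemma length_es [simp]: "length (es is) = length is"
  by (simp add: es_def)

lemma set_es [simp]: "set (es is) \<subseteq> E \<times> E"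
  by (auto simp: es_def)

definition coord_norm :: "nat \<Rightarrow> nat \<Rightarrow> (('a \<times> 'a) list \<Rightarrow> complex) \<Rightarrow> real" where
  "coord_norm n k f = L2_set (\<lambda>is. cmod (f (es is))) (index_lists k n)"

lemma bil_pairing_tendsto_herm:
  assumes "x \<in> H q \<times> H q" "y \<in> H q \<times> H q"
  shows "(\<lambda>k. \<Sum>j<k. bil (ip 0) x (e j, 0) * cnj (bil (ip 0) y (e j, 0))) \<longlonglongrightarrow> herm (ip q) x y"
proof -
  obtain a b c d where xy: "x = (a, b)" "y = (c, d)"
    and mem: "a \<in> H q" "b \<in> H q" "c \<in> H q" "d \<in> H q" using assms by auto
  note mem0 = mem[THEN H_0]
  have comm: "ip 0 z (e j) = ip 0 (e j) z" if "z \<in> H 0" for z j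
    using that by (intro sp.commute) auto
  have prod_eq: "bil (ip 0) x (e j, 0) * cnj (bil (ip 0) y (e j, 0)) =
      Complex (ip 0 (e j) a * ip 0 (e j) c + ip 0 (e j) b * ip 0 (e j) d)
        (ip 0 (e j) b * ip 0 (e j) c - ip 0 (e j) a * ip 0 (e j) d)" for j
    using mem0 by (simp add: xy bil_def comm complex_eq_iff algebra_simps)
  have herm: "herm (ip q) x y = Complex (ip q a c + ip q b d) (ip q b c - ip q a d)"
    using mem by (simp add: xy herm_def bil_def cconj_def sp.linear_simps)
  have "(\<lambda>j. ip 0 (e j) a * ip 0 (e j) c + ip 0 (e j) b * ip 0 (e j) d) sums (ip q a c + ip q b d)"
    "(\<lambda>j. ip 0 (e j) b * ip 0 (e j) c - ip 0 (e j) a * ip 0 (e j) d) sums (ip q b c - ip q a d)"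
    using mem by (intro sums_add sums_diff Parseval_inner; simp)+
  then show ?thesis
    unfolding prod_eq herm by (simp add: tendsto_complex_iff sums_def Re_sum Im_sum)
qed

lemma elementary_pairing_tendsto:
  assumes "length xs = n" "set xs \<subseteq> H q \<times> H q" "length ys = n" "set ys \<subseteq> H q \<times> H q"
  shows "(\<lambda>k. \<Sum>is\<in>index_lists k n. (\<Prod>i<n. bil (ip 0) (xs ! i) (es is ! i)) *
      cnj (\<Prod>i<n. bil (ip 0) (ys ! i) (es is ! i)))
    \<longlonglongrightarrow> (\<Prod>i<n. herm (ip q) (xs ! i) (ys ! i))"
proof -
  have "(\<Sum>is\<in>index_lists k n. (\<Prod>i<n. bil (ip 0) (xs ! i) (es is ! i)) *
      cnj (\<Prod>i<n. bil (ip 0) (ys ! i) (es is ! i)))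
    = (\<Prod>i<n. \<Sum>j<k. bil (ip 0) (xs ! i) (e j, 0) * cnj (bil (ip 0) (ys ! i) (e j, 0)))" for k
    unfolding sum_index_lists_prod[symmetric]
    by (intro sum.cong) (auto simp: prod.distrib cnj_prod es_def index_lists_def)
  moreover have "xs ! i \<in> H q \<times> H q" "ys ! i \<in> H q \<times> H q" if "i < n" for i
    using that assms by (metis nth_mem subsetD)+
  ultimately show ?thesis
    by (auto intro!: tendsto_prod bil_pairing_tendsto_herm)
qed

text \<open>Parseval's identity for algebraic tensors: by sesquilinearity it suffices to treat elementary
  tensors, for which the sum over multi-indices is a product of \<open>n\<close> one-dimensional Parseval sums.\<close>

lemma at_inner_tendsto:
  assumes s: "s \<in> alg_tensors (H q) n" and t: "t \<in> alg_tensors (H q) n"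
  shows "(\<lambda>k. \<Sum>is\<in>index_lists k n. at_pair (ip 0) s (es is) * cnj (at_pair (ip 0) t (es is)))
    \<longlonglongrightarrow> at_inner (ip q) s t"
proof -
  have inner: "(\<lambda>k. \<Sum>is\<in>index_lists k n. (\<Prod>i<n. bil (ip 0) (xs ! i) (es is ! i)) *
      cnj (at_pair (ip 0) t (es is)))
    \<longlonglongrightarrow> (\<Sum>(d, ys)\<leftarrow>t. cnj d * (\<Prod>i<length xs. herm (ip q) (xs ! i) (ys ! i)))"
    if xs: "length xs = n" "set xs \<subseteq> H q \<times> H q" for xs
    using t
  proof (induction t)
    case (Cons a t)
    obtain d ys where a: "a = (d, ys)" by fastforce
    have ys: "length ys = n" "set ys \<subseteq> H q \<times> H q" using Cons.prems a by auto
    have "(\<lambda>k. cnj d * (\<Sum>is\<in>index_lists k n. (\<Prod>i<n. bil (ip 0) (xs ! i) (es is ! i)) *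
        cnj (\<Prod>i<n. bil (ip 0) (ys ! i) (es is ! i)))
      + (\<Sum>is\<in>index_lists k n. (\<Prod>i<n. bil (ip 0) (xs ! i) (es is ! i)) * cnj (at_pair (ip 0) t (es is))))
      \<longlonglongrightarrow> cnj d * (\<Prod>i<n. herm (ip q) (xs ! i) (ys ! i))
        + (\<Sum>(d, ys)\<leftarrow>t. cnj d * (\<Prod>i<length xs. herm (ip q) (xs ! i) (ys ! i)))"
      using Cons a by (intro tendsto_intros elementary_pairing_tendsto xs ys) auto
    then show ?case
      using ys xs by (simp add: a sum_distrib_left sum.distrib algebra_simps del: cnj_prod)
  qed simp
  show ?thesis
    using s
  proof (induction s)
    case (Cons a s)
    obtain c xs where a: "a = (c, xs)" by fastforce
    have xs: "length xs = n" "set xs \<subseteq> H q \<times> H q" using Cons.prems a by auto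
    have "(\<lambda>k. c * (\<Sum>is\<in>index_lists k n. (\<Prod>i<n. bil (ip 0) (xs ! i) (es is ! i)) *
        cnj (at_pair (ip 0) t (es is)))
      + (\<Sum>is\<in>index_lists k n. at_pair (ip 0) s (es is) * cnj (at_pair (ip 0) t (es is))))
      \<longlonglongrightarrow> c * (\<Sum>(d, ys)\<leftarrow>t. cnj d * (\<Prod>i<length xs. herm (ip q) (xs ! i) (ys ! i)))
        + at_inner (ip q) s t"
      using Cons a by (intro tendsto_intros inner xs) auto
    moreover have "at_inner (ip q) (a # s) t
        = c * (\<Sum>(d, ys)\<leftarrow>t. cnj d * (\<Prod>i<length xs. herm (ip q) (xs ! i) (ys ! i)))
          + at_inner (ip q) s t"
      by (simp add: at_inner_def a case_prod_unfold mult.assoc flip: sum_list_const_mult)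
    ultimately show ?case
      using xs by (simp add: a sum_distrib_left sum.distrib algebra_simps)
  qed (simp add: at_inner_def)
qed

lemma coord_norm_tendsto_at_norm:
  assumes t: "t \<in> alg_tensors (H q) n"
  shows "(\<lambda>k. coord_norm n k (at_pair (ip 0) t)) \<longlonglongrightarrow> at_norm (ip q) t"
proof -
  have "Re (\<Sum>is\<in>index_lists k n. at_pair (ip 0) t (es is) * cnj (at_pair (ip 0) t (es is)))
      = (\<Sum>is\<in>index_lists k n. (cmod (at_pair (ip 0) t (es is)))\<^sup>2)" for k
    by (simp only: complex_norm_square[symmetric] Re_sum Re_complex_of_real)
  then show ?thesis
    using tendsto_real_sqrt[OF tendsto_Re[OF at_inner_tendsto[OF t t]]]
    by (simp add: at_norm_def coord_norm_def L2_set_def)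
qed

lemma coord_norm_nonneg [simp]: "0 \<le> coord_norm n k f"
  by (simp add: coord_norm_def L2_set_nonneg)

lemma incseq_coord_norm: "incseq (\<lambda>k. coord_norm n k f)"
  unfolding incseq_def coord_norm_def L2_set_def
  by (intro allI impI real_sqrt_le_mono sum_mono2 index_lists_mono) auto

lemma coord_norm_le_at_norm:
  "t \<in> alg_tensors (H q) n \<Longrightarrow> coord_norm n k (at_pair (ip 0) t) \<le> at_norm (ip q) t"
  by (rule incseq_le[OF incseq_coord_norm coord_norm_tendsto_at_norm])

lemma coord_norm_triangle:
  "coord_norm n k f \<le> coord_norm n k g + coord_norm n k (\<lambda>xs. f xs - g xs)"
proof -
  have "coord_norm n k f \<le> L2_set (\<lambda>is. cmod (g (es is)) + cmod (f (es is) - g (es is))) (index_lists k n)"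
    unfolding coord_norm_def
    by (intro L2_set_mono) (auto intro: norm_triangle_sub)
  also have "\<dots> \<le> coord_norm n k g + coord_norm n k (\<lambda>xs. f xs - g xs)"
    unfolding coord_norm_def by (rule L2_set_triangle_ineq)
  finally show ?thesis .
qed

lemma coord_norm_minus_commute: "coord_norm n k (\<lambda>xs. f xs - g xs) = coord_norm n k (\<lambda>xs. g xs - f xs)"
  by (simp add: coord_norm_def norm_minus_commute)

lemma at_norm_nonneg: "t \<in> alg_tensors (H q) n \<Longrightarrow> 0 \<le> at_norm (ip q) t"
  by (rule order_trans[OF coord_norm_nonneg coord_norm_le_at_norm])

lemma at_Cauchy_Schwarz:
  assumes s: "s \<in> alg_tensors (H q) n" and t: "t \<in> alg_tensors (H q) n"
  shows "cmod (at_inner (ip q) s t) \<le> at_norm (ip q) s * at_norm (ip q) t"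
proof (rule LIMSEQ_le)
  show "(\<lambda>k. cmod (\<Sum>is\<in>index_lists k n. at_pair (ip 0) s (es is) * cnj (at_pair (ip 0) t (es is))))
      \<longlonglongrightarrow> cmod (at_inner (ip q) s t)"
    by (intro tendsto_norm at_inner_tendsto s t)
  show "(\<lambda>k. coord_norm n k (at_pair (ip 0) s) * coord_norm n k (at_pair (ip 0) t))
      \<longlonglongrightarrow> at_norm (ip q) s * at_norm (ip q) t"
    by (intro tendsto_mult coord_norm_tendsto_at_norm s t)
  have "cmod (\<Sum>is\<in>index_lists k n. at_pair (ip 0) s (es is) * cnj (at_pair (ip 0) t (es is)))
      \<le> coord_norm n k (at_pair (ip 0) s) * coord_norm n k (at_pair (ip 0) t)" for k
  proof -
    have "cmod (\<Sum>is\<in>index_lists k n. at_pair (ip 0) s (es is) * cnj (at_pair (ip 0) t (es is)))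
        \<le> (\<Sum>is\<in>index_lists k n. \<bar>cmod (at_pair (ip 0) s (es is))\<bar> * \<bar>cmod (at_pair (ip 0) t (es is))\<bar>)"
      by (intro sum_norm_le) (simp add: norm_mult)
    also have "\<dots> \<le> coord_norm n k (at_pair (ip 0) s) * coord_norm n k (at_pair (ip 0) t)"
      unfolding coord_norm_def by (rule L2_set_mult_ineq)
    finally show ?thesis .
  qed
  then show "\<exists>N. \<forall>k\<ge>N. cmod (\<Sum>is\<in>index_lists k n. at_pair (ip 0) s (es is) * cnj (at_pair (ip 0) t (es is)))
      \<le> coord_norm n k (at_pair (ip 0) s) * coord_norm n k (at_pair (ip 0) t)" by blast
qed

text \<open>Pairing with an elementary tensor over \<open>H 0\<close> is the inner product, with index \<open>q\<close>, against the
  elementary tensor of the conjugated Riesz representatives.\<close>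

lemma at_pair_le_at_norm:
  assumes ys: "length ys = n" "set ys \<subseteq> H 0 \<times> H 0"
  obtains C where "0 \<le> C"
    "\<And>t. t \<in> alg_tensors (H q) n \<Longrightarrow> cmod (at_pair (ip 0) t ys) \<le> C * at_norm (ip q) t"
proof -
  define \<tau> where "\<tau> y = (rep q (fst y), - rep q (snd y))" for y
  have \<tau>: "\<tau> y \<in> H q \<times> H q" if "y \<in> H 0 \<times> H 0" for y
    using that rep(1) by (auto simp: \<tau>_def)
  have herm: "herm (ip q) x (\<tau> y) = bil (ip 0) x y" if x: "x \<in> H q \<times> H q" and y: "y \<in> H 0 \<times> H 0" for x y
  proof -
    obtain a b c d where xy: "x = (a, b)" "y = (c, d)" "a \<in> H q" "b \<in> H q" "c \<in> H 0" "d \<in> H 0"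
      using x y by auto
    have *: "ip q z (rep q w) = ip 0 z w" if "z \<in> H q" "w \<in> H 0" for z w
      using sp.commute[OF that(1) rep(1)[OF that(2)]] rep(2)[OF that(2,1)]
        sp.commute[OF H_0[OF that(1)] that(2)] by simp
    show ?thesis using xy by (simp add: herm_def cconj_def \<tau>_def bil_def *)
  qed
  define w where "w = [(1 :: complex, map \<tau> ys)]"
  have w: "w \<in> alg_tensors (H q) n"
  proof -
    have "\<tau> ` set ys \<subseteq> H q \<times> H q" using ys(2) \<tau> by blast
    then show ?thesis using ys(1) by (simp add: w_def)
  qed
  have "at_pair (ip 0) t ys = at_inner (ip q) t w" if "t \<in> alg_tensors (H q) n" for t
    using that
  proof (induction t)
    case (Cons a t)
    obtain c xs where a: "a = (c, xs)" by fastforce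
    have xs: "length xs = n" "set xs \<subseteq> H q \<times> H q" using Cons.prems a by auto
    have "(\<Prod>i<n. herm (ip q) (xs ! i) (map \<tau> ys ! i)) = (\<Prod>i<n. bil (ip 0) (xs ! i) (ys ! i))"
    proof (rule prod.cong)
      fix i assume "i \<in> {..<n}"
      then have "xs ! i \<in> H q \<times> H q" "ys ! i \<in> H 0 \<times> H 0"
        using xs ys by (metis lessThan_iff nth_mem subsetD)+
      then show "herm (ip q) (xs ! i) (map \<tau> ys ! i) = bil (ip 0) (xs ! i) (ys ! i)"
        using herm \<open>i \<in> {..<n}\<close> ys by simp
    qed simp
    then show ?case using Cons a xs by (simp add: at_inner_def w_def)
  qed (simp add: at_inner_def)
  then have "cmod (at_pair (ip 0) t ys) \<le> at_norm (ip q) w * at_norm (ip q) t"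
    if "t \<in> alg_tensors (H q) n" for t
    using at_Cauchy_Schwarz[OF that w] that by (simp add: mult.commute)
  then show ?thesis using that at_norm_nonneg[OF w] by blast
qed

text \<open>The limit \<open>r\<close> is expressed by \<open>f\<close> alone, so the norm of an element of the tensor power does not
  depend on the sequence that defines it. The coordinates of \<open>s k\<close> are a Cauchy sequence in the
  space of square summable families and converge pointwise to those of \<open>f\<close>, hence also in norm.\<close>

lemma tensor_limit_norm:
  assumes lim: "tensor_limit H ip q n s f"
  shows "\<exists>r. (\<lambda>k. coord_norm n k f) \<longlonglongrightarrow> r \<and> (\<lambda>k. at_norm (ip q) (s k)) \<longlonglongrightarrow> r"
proof -
  have s: "s k \<in> alg_tensors (H q) n" for k using lim by (simp add: tensor_limit_def)
  have ptw: "(\<lambda>k. at_pair (ip 0) (s k) (es is)) \<longlonglongrightarrow> f (es is)" if "is \<in> index_lists K n" for "is" K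
  proof -
    have "length (es is) = n \<and> set (es is) \<subseteq> H 0 \<times> H 0"
      using that by (auto simp: index_lists_def es_def)
    then show ?thesis using lim unfolding tensor_limit_def by metis
  qed
  have close: "\<exists>N. \<forall>k\<ge>N. \<forall>K. coord_norm n K (\<lambda>xs. f xs - at_pair (ip 0) (s k) xs) \<le> \<epsilon>"
    if \<epsilon>: "0 < \<epsilon>" for \<epsilon>
  proof -
    obtain N where N: "\<And>j k. N \<le> j \<Longrightarrow> N \<le> k \<Longrightarrow> at_norm (ip q) (at_diff (s j) (s k)) < \<epsilon>"
      using lim \<epsilon> unfolding tensor_limit_def by metis
    have "coord_norm n K (\<lambda>xs. f xs - at_pair (ip 0) (s k) xs) \<le> \<epsilon>" if k: "N \<le> k" for k K
    proof (rule LIMSEQ_le_const2)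
      show "(\<lambda>j. coord_norm n K (at_pair (ip 0) (at_diff (s j) (s k))))
          \<longlonglongrightarrow> coord_norm n K (\<lambda>xs. f xs - at_pair (ip 0) (s k) xs)"
        unfolding coord_norm_def L2_set_def at_pair_diff by (intro tendsto_intros ptw)
      have "coord_norm n K (at_pair (ip 0) (at_diff (s j) (s k))) \<le> \<epsilon>" if "N \<le> j" for j
        using coord_norm_le_at_norm[OF at_diff_alg_tensors[OF s s], of K j k] N[OF that k] by simp
      then show "\<exists>N. \<forall>j\<ge>N. coord_norm n K (at_pair (ip 0) (at_diff (s j) (s k))) \<le> \<epsilon>" by blast
    qed
    then show ?thesis by blast
  qed
  obtain N1 where N1: "\<And>K. coord_norm n K (\<lambda>xs. f xs - at_pair (ip 0) (s N1) xs) \<le> 1"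
    using close[of 1] by auto
  have bdd: "coord_norm n K f \<le> at_norm (ip q) (s N1) + 1" for K
    using coord_norm_triangle[of n K f "at_pair (ip 0) (s N1)"] N1[of K] coord_norm_le_at_norm[OF s, of K N1]
    by linarith
  obtain r where r: "(\<lambda>k. coord_norm n k f) \<longlonglongrightarrow> r"
    using incseq_convergent[OF incseq_coord_norm] bdd by metis
  have "(\<lambda>k. at_norm (ip q) (s k)) \<longlonglongrightarrow> r"
  proof (rule LIMSEQ_I)
    fix \<epsilon> :: real assume \<epsilon>: "0 < \<epsilon>"
    obtain N where N: "\<And>k K. N \<le> k \<Longrightarrow> coord_norm n K (\<lambda>xs. f xs - at_pair (ip 0) (s k) xs) \<le> \<epsilon> / 2"
      using close[of "\<epsilon> / 2"] \<epsilon> by auto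
    have "norm (at_norm (ip q) (s k) - r) < \<epsilon>" if k: "N \<le> k" for k
    proof -
      have "\<bar>coord_norm n K (at_pair (ip 0) (s k)) - coord_norm n K f\<bar> \<le> \<epsilon> / 2" for K
        using coord_norm_triangle[of n K f "at_pair (ip 0) (s k)"]
          coord_norm_triangle[of n K "at_pair (ip 0) (s k)" f]
          coord_norm_minus_commute[of n K f "at_pair (ip 0) (s k)"] N[OF k, of K] by linarith
      moreover have "(\<lambda>K. \<bar>coord_norm n K (at_pair (ip 0) (s k)) - coord_norm n K f\<bar>)
          \<longlonglongrightarrow> \<bar>at_norm (ip q) (s k) - r\<bar>"
        by (intro tendsto_intros coord_norm_tendsto_at_norm s r)
      ultimately have "\<bar>at_norm (ip q) (s k) - r\<bar> \<le> \<epsilon> / 2"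
        by (intro LIMSEQ_le_const2) auto
      then show ?thesis using \<epsilon> by simp
    qed
    then show "\<exists>N. \<forall>k\<ge>N. norm (at_norm (ip q) (s k) - r) < \<epsilon>" by blast
  qed
  with r show ?thesis by blast
qed

lemma coord_norm_tendsto_tensor_norm:
  assumes "f \<in> hilbert_tensor_power H ip q n"
  shows "(\<lambda>k. coord_norm n k f) \<longlonglongrightarrow> tensor_norm H ip q n f"
proof -
  obtain s where s: "tensor_limit H ip q n s f"
    using assms by (auto simp: hilbert_tensor_power_def)
  obtain r where r: "(\<lambda>k. coord_norm n k f) \<longlonglongrightarrow> r" "(\<lambda>k. at_norm (ip q) (s k)) \<longlonglongrightarrow> r"
    using tensor_limit_norm[OF s] by blast
  have "tensor_norm H ip q n f = r"
    unfolding tensor_norm_def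
  proof (rule the_equality)
    show "\<exists>s. tensor_limit H ip q n s f \<and> (\<lambda>k. at_norm (ip q) (s k)) \<longlonglongrightarrow> r"
      using s r by blast
    show "r' = r" if "\<exists>s. tensor_limit H ip q n s f \<and> (\<lambda>k. at_norm (ip q) (s k)) \<longlonglongrightarrow> r'" for r'
      using that tensor_limit_norm r(1) LIMSEQ_unique by metis
  qed
  with r show ?thesis by simp
qed

lemma set_map_proj: "set (map (proj k) ys) \<subseteq> E \<times> E"
  unfolding set_map by (rule image_subsetI) (rule proj_mem)

lemma sym_multilinear_of_tensor:
  assumes f: "f \<in> sym_tensor_power H ip q n"
  shows "complexified.sym_multilinear n f"
  unfolding complexified.sym_multilinear_def
proof (intro conjI allI impI ballI; (elim conjE)?)
  show "f xs = f ys" if "mset xs = mset ys" for xs ys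
    using f that unfolding sym_tensor_power_def by blast
  obtain s where lim: "tensor_limit H ip q n s f"
    using f by (auto simp: sym_tensor_power_def hilbert_tensor_power_def)
  have s: "s k \<in> alg_tensors (H 0) n" for k
  proof -
    have "s k \<in> alg_tensors (H q) n" using lim by (simp add: tensor_limit_def)
    moreover have "H q \<times> H q \<subseteq> H 0 \<times> H 0" using H_0 by blast
    ultimately show ?thesis unfolding alg_tensors_def by fastforce
  qed
  have ptw: "(\<lambda>k. at_pair (ip 0) (s k) ys) \<longlonglongrightarrow> f ys" if "length ys = n" "set ys \<subseteq> E \<times> E" for ys
  proof -
    have "length ys = n \<and> set ys \<subseteq> H 0 \<times> H 0" using that by auto
    then show ?thesis using lim unfolding tensor_limit_def by metis
  qed
  fix x zs assume x: "x \<in> E \<times> E" and zs: "set zs \<subseteq> E \<times> E" "Suc (length zs) = n"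
  have x0: "x \<in> H 0 \<times> H 0" using x by auto
  show "f ((x + y) # zs) = f (x # zs) + f (y # zs)" if y: "y \<in> E \<times> E" for y
  proof (rule LIMSEQ_unique)
    have y0: "y \<in> H 0 \<times> H 0" using y by auto
    show "(\<lambda>k. at_pair (ip 0) (s k) ((x + y) # zs)) \<longlonglongrightarrow> f ((x + y) # zs)"
      using x y zs by (intro ptw) auto
    show "(\<lambda>k. at_pair (ip 0) (s k) ((x + y) # zs)) \<longlonglongrightarrow> f (x # zs) + f (y # zs)"
      unfolding sp.at_pair_linear[OF s x0 y0 zs(2), THEN conjunct1]
      using x y zs by (intro tendsto_add ptw) auto
  qed
  show "f (cscale c x # zs) = c * f (x # zs)" for c
  proof (rule LIMSEQ_unique)
    show "(\<lambda>k. at_pair (ip 0) (s k) (cscale c x # zs)) \<longlonglongrightarrow> f (cscale c x # zs)"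
      using complexified.scale_mem[OF x] zs by (intro ptw) auto
    show "(\<lambda>k. at_pair (ip 0) (s k) (cscale c x # zs)) \<longlonglongrightarrow> c * f (x # zs)"
      unfolding sp.at_pair_linear[OF s x0 x0 zs(2), THEN conjunct2]
      using x zs by (intro tendsto_mult_left ptw) auto
  qed
qed

text \<open>A multilinear form that is bounded for the dual norm has square summable coordinates: the sum
  over all multi-indices factors into \<open>n\<close> sums over the basis.\<close>

lemma coord_norm_le:
  assumes hs: "hilbert_schmidt (H p) (ip p) (H q) (ip q) (\<lambda>x. x)" and "0 \<le> K"
    and bound: "\<And>xs. set xs \<subseteq> E \<times> E \<Longrightarrow> length xs = n \<Longrightarrow>
      cmod (A xs) \<le> K * (\<Prod>x\<leftarrow>xs. dual_nrm H ip p x)"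
  shows "coord_norm n k A \<le> K * hs_norm (H p) (ip p) (ip q) (\<lambda>x. x) ^ n"
proof -
  let ?N = "\<lambda>i. dual_nrm H ip p (e i, 0)" and ?S = "hs_norm (H p) (ip p) (ip q) (\<lambda>x. x)"
  have S0: "0 \<le> ?S" by (simp add: hs_norm_def Let_def infsum_nonneg)
  have "(\<Sum>is\<in>index_lists k n. (cmod (A (es is)))\<^sup>2)
      \<le> (\<Sum>is\<in>index_lists k n. K\<^sup>2 * (\<Prod>i<n. (?N (is ! i))\<^sup>2))"
  proof (rule sum_mono)
    fix "is" assume "is": "is \<in> index_lists k n"
    have "(\<Prod>x\<leftarrow>es is. dual_nrm H ip p x) = (\<Prod>i<n. ?N (is ! i))"
      using "is" by (simp add: es_def o_def prod.list_conv_set_nth index_lists_def atLeast0LessThan)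
    then have "cmod (A (es is)) \<le> K * (\<Prod>i<n. ?N (is ! i))"
      using bound[of "es is"] "is" by (simp add: index_lists_def)
    then have "(cmod (A (es is)))\<^sup>2 \<le> (K * (\<Prod>i<n. ?N (is ! i)))\<^sup>2" by (intro power_mono) auto
    then show "(cmod (A (es is)))\<^sup>2 \<le> K\<^sup>2 * (\<Prod>i<n. (?N (is ! i))\<^sup>2)"
      by (simp add: power_mult_distrib prod_power_distrib)
  qed
  also have "\<dots> = K\<^sup>2 * (\<Prod>i<n. \<Sum>j<k. (?N j)\<^sup>2)"
    unfolding sum_index_lists_prod[symmetric] by (simp add: sum_distrib_left)
  also have "\<dots> \<le> K\<^sup>2 * (\<Prod>i<n. ?S\<^sup>2)"
    by (intro mult_left_mono prod_mono conjI sum_nonneg sum_dual_nrm_le_hs_norm[OF hs]) auto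
  also have "\<dots> = (K * ?S ^ n)\<^sup>2"
    by (simp add: power_mult_distrib power_mult[symmetric] mult.commute)
  finally have "coord_norm n k A \<le> sqrt ((K * ?S ^ n)\<^sup>2)"
    unfolding coord_norm_def L2_set_def by (rule real_sqrt_le_mono)
  then show ?thesis using \<open>0 \<le> K\<close> S0 by simp
qed

text \<open>The bounded form \<open>A\<close> is the limit of the tensors
  \<open>\<Sum> A (e\<^sub>i\<^sub>1, \<dots>, e\<^sub>i\<^sub>n) h\<^sub>i\<^sub>1 \<otimes> \<dots> \<otimes> h\<^sub>i\<^sub>n\<close> over the multi-indices below \<open>k\<close>: pairing this tensor
  with a list amounts to applying \<open>A\<close> to the projected list.\<close>

lemma tensor_of_form:
  assumes qp: "q \<le> p" and hs: "hilbert_schmidt (H p) (ip p) (H q) (ip q) (\<lambda>x. x)"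
    and A: "complexified.sym_multilinear n A" and "0 \<le> K"
    and bound: "\<And>xs. set xs \<subseteq> E \<times> E \<Longrightarrow> length xs = n \<Longrightarrow>
      cmod (A xs) \<le> K * (\<Prod>x\<leftarrow>xs. dual_nrm H ip p x)"
  obtains f where "f \<in> sym_tensor_power H ip q n"
    "\<And>xs. set xs \<subseteq> E \<times> E \<Longrightarrow> length xs = n \<Longrightarrow> f xs = A xs"
proof -
  define s :: "nat \<Rightarrow> 'a alg_tensor"
    where "s k = map (\<lambda>is. (A (es is), map (\<lambda>i. (h i, 0)) is)) (List.n_lists n [0..<k])" for k
  have n_lists: "set (List.n_lists n [0..<k]) = index_lists k n" for k
    by (auto simp: set_n_lists index_lists_def)
  have s: "s k \<in> alg_tensors (H q) n" for k
    unfolding s_def alg_tensors_def using n_lists[of k] by (auto simp: index_lists_def)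
  have pair: "at_pair (ip 0) (s k) ys = A (map (proj k) ys)" if ys: "length ys = n" for k ys
  proof -
    have "at_pair (ip 0) (s k) ys
        = (\<Sum>is\<in>index_lists k n. A (es is) * (\<Prod>i<length is. bil (ip 0) (map (\<lambda>i. (h i, 0)) is ! i) (ys ! i)))"
      unfolding at_pair_def s_def n_lists[symmetric]
      by (simp add: o_def sum_list_distinct_conv_sum_set distinct_n_lists)
    also have "\<dots> = (\<Sum>is\<in>index_lists k n. A (es is) * (\<Prod>i<n. bil (ip 0) (h (is ! i), 0) (ys ! i)))"
      by (intro sum.cong) (auto simp: index_lists_def)
    also have "\<dots> = A (map (proj k) ys)"
      unfolding proj_def es_def
      by (rule complexified.form_expand[OF A _ ys, symmetric]) simp
    finally show ?thesis .
  qed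
  have coord: "at_pair (ip 0) (s k) (es is) = (if is \<in> index_lists k n then A (es is) else 0)"
    if "is": "length is = n" for k "is"
  proof (cases "set is \<subseteq> {..<k}")
    case True
    then have "map (proj k) (es is) = es is" by (auto simp: es_def proj_basis)
    then show ?thesis using pair[of "es is" k] "is" True by (simp add: index_lists_def)
  next
    case False
    then obtain i where i: "i \<in> set is" "\<not> i < k" by auto
    define ys where "ys = map (proj k) (es is)"
    have "0 \<in> set ys" unfolding ys_def using i by (auto simp: es_def proj_basis image_iff)
    then obtain us vs where uv: "ys = us @ 0 # vs" by (meson split_list)
    have ysE: "set ys \<subseteq> E \<times> E" unfolding ys_def by (rule set_map_proj)
    have len: "length ys = n" using "is" by (simp add: ys_def)
    have "A ys = A (0 # us @ vs)"
      using ysE len by (rule complexified.form_perm[OF A]) (simp add: uv)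
    also have "\<dots> = 0"
      using ysE len unfolding uv by (intro complexified.form_zero[OF A]) simp_all
    finally show ?thesis using pair[of "es is" k] "is" False by (simp add: ys_def index_lists_def)
  qed
  define a where "a k = (coord_norm n k A)\<^sup>2" for k
  have at_norm_le: "(at_norm (ip q) (at_diff (s j) (s k)))\<^sup>2 = a j - a k" if kj: "k \<le> j" for j k
  proof -
    have sub: "index_lists k n \<subseteq> index_lists j n" using kj by (rule index_lists_mono)
    have "(coord_norm n m (at_pair (ip 0) (at_diff (s j) (s k))))\<^sup>2 = a j - a k" if m: "j \<le> m" for m
    proof -
      have subm: "index_lists j n \<subseteq> index_lists m n" using m by (rule index_lists_mono)
      have "(coord_norm n m (at_pair (ip 0) (at_diff (s j) (s k))))\<^sup>2
          = (\<Sum>is\<in>index_lists m n. (cmod (at_pair (ip 0) (at_diff (s j) (s k)) (es is)))\<^sup>2)"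
        by (simp add: coord_norm_def L2_set_def sum_nonneg)
      also have "\<dots> = (\<Sum>is\<in>index_lists j n - index_lists k n. (cmod (A (es is)))\<^sup>2)"
      proof (rule sum.mono_neutral_cong_right)
        show "index_lists j n - index_lists k n \<subseteq> index_lists m n" using subm by blast
        have len: "length is = n" if "is \<in> index_lists m n" for "is" using that by (simp add: index_lists_def)
        show "\<forall>is\<in>index_lists m n - (index_lists j n - index_lists k n).
            (cmod (at_pair (ip 0) (at_diff (s j) (s k)) (es is)))\<^sup>2 = 0"
          using len sub by (auto simp: at_pair_diff coord)
        show "(cmod (at_pair (ip 0) (at_diff (s j) (s k)) (es is)))\<^sup>2 = (cmod (A (es is)))\<^sup>2"
          if "is \<in> index_lists j n - index_lists k n" for "is"
          using that len subm by (auto simp: at_pair_diff coord subset_iff)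
      qed simp
      also have "\<dots> = a j - a k"
        using sub by (simp add: sum_diff a_def coord_norm_def L2_set_def sum_nonneg)
      finally show ?thesis .
    qed
    then have "(\<lambda>m. (coord_norm n m (at_pair (ip 0) (at_diff (s j) (s k))))\<^sup>2) \<longlonglongrightarrow> a j - a k"
      by (intro tendsto_eventually eventually_sequentiallyI)
    moreover have "(\<lambda>m. (coord_norm n m (at_pair (ip 0) (at_diff (s j) (s k))))\<^sup>2)
        \<longlonglongrightarrow> (at_norm (ip q) (at_diff (s j) (s k)))\<^sup>2"
      by (intro tendsto_power coord_norm_tendsto_at_norm at_diff_alg_tensors s)
    ultimately show ?thesis by (rule LIMSEQ_unique[rotated])
  qed
  have at_norm_sym: "at_norm (ip q) (at_diff (s j) (s k)) = at_norm (ip q) (at_diff (s k) (s j))" for j k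
  proof -
    have "coord_norm n m (at_pair (ip 0) (at_diff (s j) (s k)))
        = coord_norm n m (at_pair (ip 0) (at_diff (s k) (s j)))" for m
      using coord_norm_minus_commute[of n m "at_pair (ip 0) (s j)" "at_pair (ip 0) (s k)"]
      by (simp add: coord_norm_def at_pair_diff)
    then show ?thesis
      using coord_norm_tendsto_at_norm[OF at_diff_alg_tensors[OF s s], of j k]
        coord_norm_tendsto_at_norm[OF at_diff_alg_tensors[OF s s], of k j]
      by (simp add: LIMSEQ_unique)
  qed
  have "Cauchy a"
  proof -
    have inc: "incseq a"
      unfolding a_def incseq_def using incseq_coord_norm[of n A]
      by (auto simp: incseq_def intro!: power_mono)
    have "a k \<le> (K * hs_norm (H p) (ip p) (ip q) (\<lambda>x. x) ^ n)\<^sup>2" for k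
      unfolding a_def by (intro power_mono coord_norm_le[OF hs \<open>0 \<le> K\<close> bound]) auto
    then obtain L where "a \<longlonglongrightarrow> L" using incseq_convergent[OF inc] by metis
    then show ?thesis by (rule LIMSEQ_imp_Cauchy)
  qed
  have cauchy: "\<exists>N. \<forall>j\<ge>N. \<forall>k\<ge>N. at_norm (ip q) (at_diff (s j) (s k)) < \<epsilon>" if \<epsilon>: "0 < \<epsilon>" for \<epsilon>
  proof -
    obtain N where N: "\<And>j k. N \<le> j \<Longrightarrow> N \<le> k \<Longrightarrow> \<bar>a j - a k\<bar> < \<epsilon>\<^sup>2"
      using CauchyD[OF \<open>Cauchy a\<close>, of "\<epsilon>\<^sup>2"] \<epsilon> by auto
    have *: "at_norm (ip q) (at_diff (s j) (s k)) < \<epsilon>" if "N \<le> k" "k \<le> j" for j k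
    proof (rule power2_less_imp_less)
      show "(at_norm (ip q) (at_diff (s j) (s k)))\<^sup>2 < \<epsilon>\<^sup>2"
        using at_norm_le[OF that(2)] N[of j k] that by simp
    qed (use \<epsilon> in simp)
    have "at_norm (ip q) (at_diff (s j) (s k)) < \<epsilon>" if "N \<le> j" "N \<le> k" for j k
      using *[of k j] *[of j k] that at_norm_sym[of j k] by (cases "k \<le> j") auto
    then show ?thesis by blast
  qed
  define f where "f ys = (if length ys = n \<and> set ys \<subseteq> H 0 \<times> H 0
      then lim (\<lambda>k. at_pair (ip 0) (s k) ys) else 0)" for ys
  have conv: "(\<lambda>k. at_pair (ip 0) (s k) ys) \<longlonglongrightarrow> f ys" if ys: "length ys = n" "set ys \<subseteq> H 0 \<times> H 0" for ys
  proof -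
    obtain C where C: "0 \<le> C"
      "\<And>t. t \<in> alg_tensors (H q) n \<Longrightarrow> cmod (at_pair (ip 0) t ys) \<le> C * at_norm (ip q) t"
      using at_pair_le_at_norm[OF ys] by blast
    have "Cauchy (\<lambda>k. at_pair (ip 0) (s k) ys)"
    proof (rule CauchyI)
      fix \<epsilon> :: real assume \<epsilon>: "0 < \<epsilon>"
      obtain N where N: "\<And>j k. N \<le> j \<Longrightarrow> N \<le> k \<Longrightarrow> at_norm (ip q) (at_diff (s j) (s k)) < \<epsilon> / (C + 1)"
        using cauchy[of "\<epsilon> / (C + 1)"] \<epsilon> C(1) by auto
      have "norm (at_pair (ip 0) (s j) ys - at_pair (ip 0) (s k) ys) < \<epsilon>" if "N \<le> j" "N \<le> k" for j k
      proof -
        have "norm (at_pair (ip 0) (s j) ys - at_pair (ip 0) (s k) ys)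
            \<le> C * at_norm (ip q) (at_diff (s j) (s k))"
          using C(2)[OF at_diff_alg_tensors[OF s s], of j k] by (simp add: at_pair_diff)
        also have "\<dots> \<le> C * (\<epsilon> / (C + 1))"
          using C(1) N[OF that] by (intro mult_left_mono) auto
        also have "\<dots> < \<epsilon>" using C(1) \<epsilon> by (simp add: field_simps)
        finally show ?thesis .
      qed
      then show "\<exists>N. \<forall>j\<ge>N. \<forall>k\<ge>N. norm (at_pair (ip 0) (s j) ys - at_pair (ip 0) (s k) ys) < \<epsilon>" by blast
    qed
    then show ?thesis
      using ys unfolding f_def by (simp add: Cauchy_convergent_iff convergent_LIMSEQ_iff)
  qed
  have "tensor_limit H ip q n s f"
    unfolding tensor_limit_def using s cauchy conv by (auto simp: f_def)
  moreover have "f xs = f ys" if eq: "mset xs = mset ys" for xs ys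
  proof (cases "length xs = n \<and> set xs \<subseteq> H 0 \<times> H 0")
    case True
    then have xs: "length xs = n" "set xs \<subseteq> H 0 \<times> H 0" by auto
    have ys: "length ys = n" "set ys \<subseteq> H 0 \<times> H 0"
      using xs mset_eq_length[OF eq] mset_eq_setD[OF eq] by auto
    have "A (map (proj k) xs) = A (map (proj k) ys)" for k
      using xs eq by (intro complexified.form_perm[OF A] set_map_proj) auto
    then show ?thesis
      using conv[OF xs] conv[OF ys] xs ys by (simp add: pair LIMSEQ_unique)
  next
    case False
    then have "\<not> (length ys = n \<and> set ys \<subseteq> H 0 \<times> H 0)"
      using mset_eq_length[OF eq] mset_eq_setD[OF eq] by auto
    with False show ?thesis unfolding f_def by (simp only: if_False)
  qed
  ultimately have "f \<in> sym_tensor_power H ip q n"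
    unfolding sym_tensor_power_def hilbert_tensor_power_def by blast
  moreover have "f xs = A xs" if xs: "set xs \<subseteq> E \<times> E" "length xs = n" for xs
  proof (rule LIMSEQ_unique)
    have "set xs \<subseteq> H 0 \<times> H 0" using xs by auto
    then show "(\<lambda>k. at_pair (ip 0) (s k) xs) \<longlonglongrightarrow> f xs" using xs by (intro conv)
    have "(\<lambda>k. A (map (proj k) xs)) \<longlonglongrightarrow> A xs"
      by (rule complexified.form_tendsto[OF A bound xs]) (use xs proj_tendsto[OF qp] in auto)
    then show "(\<lambda>k. at_pair (ip 0) (s k) xs) \<longlonglongrightarrow> A xs" using xs by (simp add: pair)
  qed
  ultimately show ?thesis using that by blast
qed

end

section \<open>Growth of the Taylor coefficients\<close>

lemma power_over_fact_le_exp: "real n ^ n / fact n \<le> exp (real n)"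
proof -
  have "(\<Sum>k\<in>{n}. real n ^ k /\<^sub>R fact k) \<le> (\<Sum>k. real n ^ k /\<^sub>R fact k)"
    using summable_exp_generic[of "real n"] by (intro sum_le_suminf) auto
  then show ?thesis by (simp add: exp_def divide_inverse mult.commute)
qed

lemma power_series_coefficient:
  fixes a :: "nat \<Rightarrow> complex"
  assumes "\<And>z. (\<lambda>n. a n * z ^ n) sums f z"
  shows "(deriv ^^ n) f 0 / fact n = a n"
proof -
  have "f has_fps_expansion Abs_fps a"
    using assms by (intro has_fps_expansionI) simp
  from fps_nth_fps_expansion[OF this, of n] show ?thesis by simp
qed

lemma legendre_nonneg: "u \<in> C_plus_log \<Longrightarrow> 0 \<le> legendre u t"
  unfolding legendre_def C_plus_log_def by (intro cINF_greatest) (auto simp: less_imp_le)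

context nuclear
begin

lemma entire_bounded_of_growth:
  assumes F: "holomorphic_c E F" and u: "u \<in> C_plus_log" and M: "0 \<le> M"
    and bound: "\<And>\<xi>. \<xi> \<in> E \<times> E \<Longrightarrow> cmod (F \<xi>) \<le> M * sqrt (u ((dual_nrm H ip p \<xi>)\<^sup>2))"
  shows "complexified.entire_bounded p F"
  unfolding complexified.entire_bounded_def
proof (intro conjI ballI allI)
  show "(\<lambda>z. F (cscale z \<xi> + \<eta>)) holomorphic_on UNIV" if "\<xi> \<in> E \<times> E" "\<eta> \<in> E \<times> E" for \<xi> \<eta>
    using F that unfolding holomorphic_c_def by metis
  fix R :: real
  have "compact (u ` {0..R\<^sup>2})"
    using u unfolding C_plus_log_def
    by (intro compact_continuous_image) (auto intro: continuous_on_subset)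
  then have "bdd_above (u ` {0..R\<^sup>2})" by (intro bounded_imp_bdd_above compact_imp_bounded)
  then obtain B where B: "\<And>r. 0 \<le> r \<Longrightarrow> r \<le> R\<^sup>2 \<Longrightarrow> u r \<le> B"
    unfolding bdd_above_def by (metis atLeastAtMost_iff imageI)
  have "cmod (F \<xi>) \<le> M * sqrt B" if \<xi>: "\<xi> \<in> E \<times> E" "dual_nrm H ip p \<xi> \<le> R" for \<xi>
  proof -
    have "(dual_nrm H ip p \<xi>)\<^sup>2 \<le> R\<^sup>2"
      using \<xi> complexified.N_nonneg[OF \<xi>(1)] by (intro power_mono) auto
    then have "sqrt (u ((dual_nrm H ip p \<xi>)\<^sup>2)) \<le> sqrt B"
      using B by (intro real_sqrt_le_mono) auto
    then have "M * sqrt (u ((dual_nrm H ip p \<xi>)\<^sup>2)) \<le> M * sqrt B"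
      using M by (rule mult_left_mono)
    with bound[OF \<xi>(1)] show ?thesis by (rule order_trans)
  qed
  then show "\<exists>K. \<forall>\<xi>\<in>E \<times> E. dual_nrm H ip p \<xi> \<le> R \<longrightarrow> cmod (F \<xi>) \<le> K" by blast
qed

lemma Taylor_series_on_line:
  assumes F: "holomorphic_c E F" and \<xi>: "\<xi> \<in> E \<times> E"
  shows "(\<lambda>z. F (cscale z \<xi>)) holomorphic_on UNIV"
    and "(\<lambda>n. (deriv ^^ n) (\<lambda>z. F (cscale z \<xi>)) 0 / fact n) sums F \<xi>"
proof -
  have "\<forall>\<eta>\<in>E \<times> E. (\<lambda>z. F (cscale z \<xi> + \<eta>)) holomorphic_on UNIV"
    using F \<xi> unfolding holomorphic_c_def by metis
  from bspec[OF this complexified.zero_mem]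
  show hol: "(\<lambda>z. F (cscale z \<xi>)) holomorphic_on UNIV" by simp
  have "(\<lambda>n. (deriv ^^ n) (\<lambda>z. F (cscale z \<xi>)) 0 / fact n * (1 - 0) ^ n) sums F (cscale 1 \<xi>)"
    by (rule holomorphic_power_series[where r = 2]) (use hol in \<open>auto intro: holomorphic_on_subset\<close>)
  then show "(\<lambda>n. (deriv ^^ n) (\<lambda>z. F (cscale z \<xi>)) 0 / fact n) sums F \<xi>"
    by (simp add: cscale_simps)
qed

text \<open>Cauchy's inequality on the circle of radius \<open>\<surd>r / |\<xi>|\<^sub>-\<^sub>p\<close> gives
  \<open>M (u r / r\<^sup>n)\<^sup>1\<^sup>/\<^sup>2 |\<xi>|\<^sub>-\<^sub>p\<^sup>n\<close>, and the infimum over \<open>r\<close> is the Legendre transform. At \<open>\<xi> = 0\<close>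
  there is no such circle: the constant term is then estimated through some nonzero vector, and the
  other coefficients vanish.\<close>

lemma Taylor_coefficient_bound:
  assumes F: "holomorphic_c E F" and u: "u \<in> C_plus_log" and M: "0 \<le> M"
    and bound: "\<And>\<xi>. \<xi> \<in> E \<times> E \<Longrightarrow> cmod (F \<xi>) \<le> M * sqrt (u ((dual_nrm H ip p \<xi>)\<^sup>2))"
    and \<xi>: "\<xi> \<in> E \<times> E"
  shows "cmod ((deriv ^^ n) (\<lambda>z. F (cscale z \<xi>)) 0 / fact n)
    \<le> M * sqrt (legendre u (real n)) * dual_nrm H ip p \<xi> ^ n"
proof -
  define c where "c \<xi> = (deriv ^^ n) (\<lambda>z. F (cscale z \<xi>)) 0 / fact n" for \<xi>
  let ?N = "dual_nrm H ip p"
  have pos: "cmod (c \<xi>) \<le> M * sqrt (legendre u (real n)) * ?N \<xi> ^ n"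
    if \<xi>: "\<xi> \<in> E \<times> E" and N: "0 < ?N \<xi>" for \<xi>
  proof -
    have hol: "(\<lambda>z. F (cscale z \<xi>)) holomorphic_on UNIV" by (rule Taylor_series_on_line[OF F \<xi>])
    have est: "(cmod (c \<xi>))\<^sup>2 \<le> (M * ?N \<xi> ^ n)\<^sup>2 * (u r / r powr real n)" if r: "0 < r" for r
    proof -
      define R where "R = sqrt r / ?N \<xi>"
      have R: "0 < R" using r N by (simp add: R_def)
      have "cmod ((deriv ^^ n) (\<lambda>z. F (cscale z \<xi>)) 0) \<le> fact n * (M * sqrt (u r)) / R ^ n"
      proof (rule Cauchy_inequality)
        fix z :: complex assume "cmod (0 - z) = R"
        then have "?N (cscale z \<xi>) = sqrt r"
          using complexified.N_scale[OF \<xi>, where c = z and p = p] N by (simp add: R_def)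
        then show "cmod (F (cscale z \<xi>)) \<le> M * sqrt (u r)"
          using bound[OF complexified.scale_mem[OF \<xi>, of z]] r by simp
      qed (use hol R in \<open>auto intro: holomorphic_on_subset holomorphic_on_imp_continuous_on\<close>)
      then have "cmod (c \<xi>) \<le> M * sqrt (u r) / R ^ n"
        by (simp add: c_def norm_divide field_simps)
      also have "\<dots> = (M * ?N \<xi> ^ n) * sqrt (u r / r ^ n)"
        using r N by (simp add: R_def power_divide real_sqrt_divide real_sqrt_power)
      finally have "(cmod (c \<xi>))\<^sup>2 \<le> ((M * ?N \<xi> ^ n) * sqrt (u r / r ^ n))\<^sup>2"
        by (intro power_mono) auto
      also have "\<dots> = (M * ?N \<xi> ^ n)\<^sup>2 * (u r / r powr real n)"
        using r u unfolding C_plus_log_def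
        by (simp add: power_mult_distrib powr_realpow less_imp_le)
      finally show ?thesis .
    qed
    have "(cmod (c \<xi>))\<^sup>2 \<le> (M * ?N \<xi> ^ n)\<^sup>2 * legendre u (real n)"
    proof (cases "M = 0")
      case True
      then show ?thesis using est[of 1] by simp
    next
      case False
      then have K: "0 < (M * ?N \<xi> ^ n)\<^sup>2" using N by simp
      have "(cmod (c \<xi>))\<^sup>2 / (M * ?N \<xi> ^ n)\<^sup>2 \<le> legendre u (real n)"
        unfolding legendre_def
      proof (rule cINF_greatest)
        fix r :: real assume "r \<in> {0<..}"
        then show "(cmod (c \<xi>))\<^sup>2 / (M * ?N \<xi> ^ n)\<^sup>2 \<le> u r / r powr real n"
          using est[of r] K by (simp add: divide_le_eq mult.commute)
      qed simp
      then show ?thesis using K by (simp add: divide_le_eq mult.commute)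
    qed
    then have "sqrt ((cmod (c \<xi>))\<^sup>2) \<le> sqrt ((M * ?N \<xi> ^ n)\<^sup>2 * legendre u (real n))"
      by (rule real_sqrt_le_mono)
    then show ?thesis using M N by (simp add: real_sqrt_mult mult_ac)
  qed
  show ?thesis
  proof (cases "?N \<xi> = 0")
    case False
    then show ?thesis using pos[OF \<xi>] complexified.N_nonneg[OF \<xi>, where p = p] by (simp add: c_def)
  next
    case True
    then have \<xi>0: "\<xi> = 0" by (rule dual_nrm_eq_zero[OF \<xi>])
    show ?thesis
    proof (cases n)
      case 0
      obtain x where "x \<in> E" "x \<noteq> 0"
        using nuclear_space E_closed(1) unfolding nuclear_space_def by blast
      then have x: "(x, 0) \<in> E \<times> E" "?N (x, 0) \<noteq> 0"
        using dual_nrm_eq_zero[of "(x, 0)" p] by (auto simp: zero_prod_def)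
      then have "cmod (c (x, 0)) \<le> M * sqrt (legendre u (real n)) * ?N (x, 0) ^ n"
        using pos[OF x(1)] complexified.N_nonneg[OF x(1), where p = p] by simp
      then show ?thesis using 0 by (simp add: c_def cscale_simps)
    next
      case (Suc m)
      have "(\<lambda>z. F (cscale z \<xi>)) = (\<lambda>z. F 0)" by (simp add: \<xi>0 cscale_simps)
      then show ?thesis using Suc True by (simp add: higher_deriv_const)
    qed
  qed
qed

end

context dual_basis
begin

lemma expansion_exists:
  assumes qp: "q \<le> p" and hs: "hilbert_schmidt (H p) (ip p) (H q) (ip q) (\<lambda>x. x)"
    and F: "holomorphic_c E F" and u: "u \<in> C_plus_log" and M: "0 \<le> M"
    and bound: "\<And>\<xi>. \<xi> \<in> E \<times> E \<Longrightarrow> cmod (F \<xi>) \<le> M * sqrt (u ((dual_nrm H ip p \<xi>)\<^sup>2))"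
  shows "\<exists>f. expansion E H ip q F f"
proof -
  let ?A = "complexified.taylor_form F"
  have eb: "complexified.entire_bounded p F" by (rule entire_bounded_of_growth[OF F u M bound])
  have sm: "complexified.sym_multilinear n (?A n)" for n
    by (rule complexified.sym_multilinear_taylor_form[OF eb])
  have diag: "?A n (replicate n \<xi>) = (deriv ^^ n) (\<lambda>z. F (cscale z \<xi>)) 0 / fact n"
    if "\<xi> \<in> E \<times> E" for n \<xi>
    using that by (rule complexified.taylor_form_replicate)
  have "\<exists>f. f \<in> sym_tensor_power H ip q n \<and>
      (\<forall>xs. set xs \<subseteq> E \<times> E \<longrightarrow> length xs = n \<longrightarrow> f xs = ?A n xs)" for n
  proof -
    let ?C = "M * sqrt (legendre u (real n))"
    have C0: "0 \<le> ?C" using M legendre_nonneg[OF u] by simp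
    have le: "cmod (?A n (replicate n x)) \<le> ?C * dual_nrm H ip p x ^ n" if "x \<in> E \<times> E" for x
      unfolding diag[OF that] using Taylor_coefficient_bound[OF F u M bound that] .
    have polar: "cmod (?A n xs) \<le> real n ^ n / fact n * ?C * (\<Prod>x\<leftarrow>xs. dual_nrm H ip p x)"
      if "set xs \<subseteq> E \<times> E" "length xs = n" for xs
      by (rule complexified.polarization_bound[OF sm le C0 that])
    have "0 \<le> real n ^ n / fact n * ?C" using C0 by simp
    from tensor_of_form[OF qp hs sm this polar] show ?thesis by blast
  qed
  then obtain f where f: "\<And>n. f n \<in> sym_tensor_power H ip q n"
    "\<And>n xs. set xs \<subseteq> E \<times> E \<Longrightarrow> length xs = n \<Longrightarrow> f n xs = ?A n xs" by metis
  have "expansion E H ip q F f"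
    unfolding expansion_def
  proof (intro conjI allI ballI f)
    fix \<xi> assume \<xi>: "\<xi> \<in> E \<times> E"
    have "pair_power (f n) n \<xi> = (deriv ^^ n) (\<lambda>z. F (cscale z \<xi>)) 0 / fact n" for n
    proof -
      have "set (replicate n \<xi>) \<subseteq> E \<times> E" using \<xi> by (induction n) auto
      then show ?thesis using f(2)[of "replicate n \<xi>" n] diag[OF \<xi>] by (simp add: pair_power_def)
    qed
    then show "(\<lambda>n. pair_power (f n) n \<xi>) sums F \<xi>"
      using Taylor_series_on_line(2)[OF F \<xi>] by simp
  qed
  then show ?thesis by (rule exI[of _ f])
qed

text \<open>Homogeneity of the coefficients turns the expansion at \<open>z \<xi>\<close> into a power series in \<open>z\<close>, whose
  coefficients are unique. The bounds below therefore hold for every expansion of \<open>F\<close>.\<close>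

lemma expansion_coefficient:
  assumes f: "expansion E H ip q F f" and \<xi>: "\<xi> \<in> E \<times> E"
  shows "f n (replicate n \<xi>) = (deriv ^^ n) (\<lambda>z. F (cscale z \<xi>)) 0 / fact n"
proof -
  have sm: "complexified.sym_multilinear n (f n)" for n
    using f by (intro sym_multilinear_of_tensor) (simp add: expansion_def)
  have "f n (replicate n (cscale z \<xi>)) = f n (replicate n \<xi>) * z ^ n" for n z
  proof -
    have "set (replicate n \<xi>) \<subseteq> E \<times> E" using \<xi> by (induction n) auto
    then show ?thesis
      using complexified.form_scale_all[OF sm, of "replicate n \<xi>" "[]" n "\<lambda>_. z"]
      by (simp add: prod_list_replicate mult.commute)
  qed
  moreover have "(\<lambda>n. f n (replicate n (cscale z \<xi>))) sums F (cscale z \<xi>)" for z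
    using f complexified.scale_mem[OF \<xi>, of z] by (auto simp: expansion_def pair_power_def)
  ultimately show ?thesis
    using power_series_coefficient[of "\<lambda>n. f n (replicate n \<xi>)" "\<lambda>z. F (cscale z \<xi>)" n] by simp
qed

lemma tensor_norm_bound:
  assumes hs: "hilbert_schmidt (H p) (ip p) (H q) (ip q) (\<lambda>x. x)"
    and F: "holomorphic_c E F" and u: "u \<in> C_plus_log" and M: "0 \<le> M"
    and bound: "\<And>\<xi>. \<xi> \<in> E \<times> E \<Longrightarrow> cmod (F \<xi>) \<le> M * sqrt (u ((dual_nrm H ip p \<xi>)\<^sup>2))"
    and f: "expansion E H ip q F f"
  shows "(tensor_norm H ip q n (f n))\<^sup>2
    \<le> legendre u (real n) * (M\<^sup>2 * ((exp 1)\<^sup>2 * (hs_norm (H p) (ip p) (ip q) (\<lambda>x. x))\<^sup>2) ^ n)"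
proof -
  let ?C = "M * sqrt (legendre u (real n))" and ?S = "hs_norm (H p) (ip p) (ip q) (\<lambda>x. x)"
  have l0: "0 \<le> legendre u (real n)" by (rule legendre_nonneg[OF u])
  then have C0: "0 \<le> ?C" using M by simp
  have S0: "0 \<le> ?S" by (simp add: hs_norm_def Let_def infsum_nonneg)
  have fn: "f n \<in> sym_tensor_power H ip q n" using f by (simp add: expansion_def)
  have le: "cmod (f n (replicate n x)) \<le> ?C * dual_nrm H ip p x ^ n" if "x \<in> E \<times> E" for x
    unfolding expansion_coefficient[OF f that] using Taylor_coefficient_bound[OF F u M bound that] .
  have "cmod (f n xs) \<le> real n ^ n / fact n * ?C * (\<Prod>x\<leftarrow>xs. dual_nrm H ip p x)"
    if "set xs \<subseteq> E \<times> E" "length xs = n" for xs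
    by (rule complexified.polarization_bound[OF sym_multilinear_of_tensor[OF fn] le C0 that])
  then have "coord_norm n k (f n) \<le> real n ^ n / fact n * ?C * ?S ^ n" for k
    using C0 by (intro coord_norm_le[OF hs]) auto
  moreover have lim: "(\<lambda>k. coord_norm n k (f n)) \<longlonglongrightarrow> tensor_norm H ip q n (f n)"
    using fn by (intro coord_norm_tendsto_tensor_norm) (simp add: sym_tensor_power_def)
  ultimately have "tensor_norm H ip q n (f n) \<le> real n ^ n / fact n * ?C * ?S ^ n"
    by (intro LIMSEQ_le_const2[OF lim]) blast
  also have "\<dots> \<le> exp (real n) * ?C * ?S ^ n"
    using power_over_fact_le_exp C0 S0 by (intro mult_right_mono) auto
  finally have "tensor_norm H ip q n (f n) \<le> exp (real n) * ?C * ?S ^ n" .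
  moreover have "0 \<le> tensor_norm H ip q n (f n)"
    using lim by (rule LIMSEQ_le_const) auto
  ultimately have "(tensor_norm H ip q n (f n))\<^sup>2 \<le> (exp (real n) * ?C * ?S ^ n)\<^sup>2"
    by (intro power_mono)
  also have "exp (real n) = exp 1 ^ n"
    using exp_of_nat_mult[of n "1::real"] by simp
  also have "(exp 1 ^ n * ?C * ?S ^ n)\<^sup>2 = legendre u (real n) * (M\<^sup>2 * ((exp 1)\<^sup>2 * ?S\<^sup>2) ^ n)"
    using l0 by (simp add: power_mult_distrib power_mult[symmetric] mult_ac)
  finally show ?thesis .
qed

end

theorem theorem5p3:
  fixes E :: "'a::real_vector set" and H :: "nat \<Rightarrow> 'a set"
    and ip :: "nat \<Rightarrow> 'a \<Rightarrow> 'a \<Rightarrow> real"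
    and u :: "real \<Rightarrow> real" and p q :: nat
  assumes "nuclear_space E H ip"
    and "u \<in> C_plus_log"
    and "p > q"
    and "hilbert_schmidt (H p) (ip p) (H q) (ip q) (\<lambda>x. x)"
    and "hs_norm (H p) (ip p) (ip q) (\<lambda>x. x) < exp (- 1)"
  shows "\<forall>F\<in>G_space E H ip u p.
    (\<exists>f. expansion E H ip q F f) \<and>
    (\<forall>f. expansion E H ip q F f \<longrightarrow>
       coeff_norm H ip u q f
         \<le> ennreal ((1 - (exp 1)\<^sup>2 * (hs_norm (H p) (ip p) (ip q) (\<lambda>x. x))\<^sup>2) powr (- 1 / 2))
            * sup_norm E H ip u p F)"
proof (intro ballI)
  fix F assume "F \<in> G_space E H ip u p"
  then have F: "holomorphic_c E F" "sup_norm E H ip u p F < \<infinity>" by (simp_all add: G_space_def)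
  interpret nuclear E H ip by unfold_locales (rule assms)
  obtain e where "dual_basis E H ip q e" by (rule dual_basis_exists[OF assms(4)])
  then interpret dual_basis E H ip q e .
  have u_pos: "0 < u r" if "0 \<le> r" for r using assms(2) that by (simp add: C_plus_log_def)
  define M where "M = enn2real (sup_norm E H ip u p F)"
  have M: "sup_norm E H ip u p F = ennreal M" "0 \<le> M"
    using F(2) by (simp_all add: M_def ennreal_enn2real_if less_top)
  have bound: "cmod (F \<xi>) \<le> M * sqrt (u ((dual_nrm H ip p \<xi>)\<^sup>2))" if \<xi>: "\<xi> \<in> E \<times> E" for \<xi>
  proof -
    let ?v = "u ((dual_nrm H ip p \<xi>)\<^sup>2)"
    have v: "0 < ?v" using u_pos by simp
    have "ennreal (cmod (F \<xi>) * ?v powr (- 1 / 2)) \<le> sup_norm E H ip u p F"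
      unfolding sup_norm_def by (rule SUP_upper[OF \<xi>])
    then have "cmod (F \<xi>) * ?v powr (- 1 / 2) \<le> M"
      unfolding M(1) using M(2) by (simp add: ennreal_le_iff)
    moreover have "?v powr (- 1 / 2) = 1 / sqrt ?v"
      using v by (simp add: powr_minus_divide powr_half_sqrt)
    ultimately have "cmod (F \<xi>) / sqrt ?v \<le> M" by simp
    then show ?thesis using v by (simp only: pos_divide_le_eq real_sqrt_gt_0_iff)
  qed
  define x where "x = (exp 1)\<^sup>2 * (hs_norm (H p) (ip p) (ip q) (\<lambda>x. x))\<^sup>2"
  have S0: "0 \<le> hs_norm (H p) (ip p) (ip q) (\<lambda>x. x)"
    by (simp add: hs_norm_def Let_def infsum_nonneg)
  have "(exp 1 * hs_norm (H p) (ip p) (ip q) (\<lambda>x. x)) < 1"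
    using assms(5) by (simp add: exp_minus field_simps)
  then have "(exp 1 * hs_norm (H p) (ip p) (ip q) (\<lambda>x. x))\<^sup>2 < 1"
    using S0 by (simp add: power_less_one_iff abs_square_less_1)
  then have x: "0 \<le> x" "x < 1" by (simp_all add: x_def power_mult_distrib)
  show "(\<exists>f. expansion E H ip q F f) \<and>
    (\<forall>f. expansion E H ip q F f \<longrightarrow>
       coeff_norm H ip u q f
         \<le> ennreal ((1 - (exp 1)\<^sup>2 * (hs_norm (H p) (ip p) (ip q) (\<lambda>x. x))\<^sup>2) powr (- 1 / 2))
            * sup_norm E H ip u p F)"
  proof (intro conjI allI impI)
    show "\<exists>f. expansion E H ip q F f"
      using assms(3) by (intro expansion_exists[OF _ assms(4) F(1) assms(2) M(2) bound]) simp_all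
    fix f assume f: "expansion E H ip q F f"
    define a where "a n = 1 / legendre u (real n) * (tensor_norm H ip q n (f n))\<^sup>2" for n
    have a: "0 \<le> a n" "a n \<le> M\<^sup>2 * x ^ n" for n
    proof -
      have l: "0 \<le> legendre u (real n)" by (rule legendre_nonneg[OF assms(2)])
      then show "0 \<le> a n" by (simp add: a_def)
      show "a n \<le> M\<^sup>2 * x ^ n"
      \<comment> \<open>Where the Legendre transform vanishes, \<open>1 / 0 = 0\<close> makes \<open>a n\<close> zero.\<close>
      proof (cases "legendre u (real n) = 0")
        case False
        then show ?thesis
          using tensor_norm_bound[OF assms(4) F(1) assms(2) M(2) bound f, of n] l
          by (simp add: a_def x_def field_simps)
      qed (use x in \<open>simp add: a_def\<close>)
    qed
    have geo: "(\<lambda>n. M\<^sup>2 * x ^ n) sums (M\<^sup>2 * (1 / (1 - x)))"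
      using x by (intro sums_mult geometric_sums) simp
    have summ: "summable a"
      using a by (intro summable_comparison_test'[OF sums_summable[OF geo]]) auto
    have "(\<Sum>n. a n) \<le> M\<^sup>2 * (1 / (1 - x))"
      using suminf_le[OF a(2) summ sums_summable[OF geo]] sums_unique[OF geo] by simp
    then have "sqrt (\<Sum>n. a n) \<le> sqrt (M\<^sup>2 * (1 / (1 - x)))" by (rule real_sqrt_le_mono)
    also have "\<dots> = (1 - x) powr (- 1 / 2) * M"
      using M(2) x by (simp add: real_sqrt_mult real_sqrt_divide powr_minus_divide powr_half_sqrt)
    finally have "ennreal (sqrt (\<Sum>n. a n)) \<le> ennreal ((1 - x) powr (- 1 / 2)) * ennreal M"
      using M(2) by (simp add: ennreal_mult[symmetric] ennreal_leI)
    then show "coeff_norm H ip u q f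
         \<le> ennreal ((1 - (exp 1)\<^sup>2 * (hs_norm (H p) (ip p) (ip q) (\<lambda>x. x))\<^sup>2) powr (- 1 / 2))
            * sup_norm E H ip u p F"
      using summ unfolding coeff_norm_def Let_def a_def[abs_def, symmetric] x_def[symmetric] M(1) by simp
  qed
qed

end
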